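(* Let $T>0$, $H\in(1/2,1)$, let $B^1,\dots,B^m$ be fractional Brownian motions with Hurst parameter $H$ on a complete probability space $(\Omega,\mathcal F,P)$, let $X_0$ be a $d$-dimensional random variable, and let $\sigma=(\sigma^{ij})_{d\times m}$, $b=(b^i)_{d\times 1}$ with $\sigma^{ij},b^i:\Omega\times[0,T]\times\mathbb R^d\to\mathbb R$ measurable. Assume: (A) $\sigma(t,x)$ is differentiable in $x$ and there exist $M>0$, $\beta\in(1-H,1]$, $\kappa\in(\frac1H-1,1]$ such that for all $t,s\in[0,T]$, $x,y\in\mathbb R^d$ and all $i$: 1) $|\sigma(t,x)-\sigma(t,y)|\le M|x-y|$; 2) $|\partial_{x_i}\sigma(t,x)-\partial_{x_i}\sigma(t,y)|\le M|x-y|^\kappa$; 3) $|\sigma(t,x)-\sigma(s,x)|+|\partial_{x_i}\sigma(t,x)-\partial_{x_i}\sigma(s,x)|\le M|t-s|^\beta$. (B) There is $L>0$ such that for all $t\in[0,T]$, $x,y\in\mathbb R^d$: 1) $|b(t,x)-b(t,y)|\le L|x-y|$; 2) $|b(t,x)|\le L(1+|x|)$. (C) There is a constant $C>0$ with $|\sigma(t,x)|\le C(1+|x|)$ for all $t\in[0,T]$, $x\in\mathbb R^d$. (D) 1) There are $C>0$ and $\gamma\in(2H-1,1]$ with $|b(t,x)-b(s,x)|\le C|t-s|^\gamma$ for all $t,s\in[0,T]$, $x\in\mathbb R^d$; 2) the exponent $\beta$ in (A) 3) satisfies $\beta>H$. Let $X$ be the solution of the pathwise equation $X^i_t=X^i_0+\sum_{j=1}^m\int_0^t\sigma^{ij}(s,X_s)\,dB^j_s+\int_0^t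 b^i(s,X_s)\,ds$, $i=1,\dots,d$, $t\in[0,T]$, and let $Y^\delta$ be its continuously interpolated Euler approximation with step $\delta=T/N$, $N\in\mathbb N$. Put $$U_\delta:=\sup_{0\le s\le T}\Big(|X_s-Y^\delta_s|+\int_0^{t_s}\big|X_s-Y^\delta_s-X_u+Y^\delta_u\big|\,(s-u)^{-\alpha-1}\,du\Big),$$ where $\alpha$ is the order of the fractional derivative used in the pathwise integral (see context). Then: (i) For any $\varepsilon>0$ and any sufficiently small $\rho>0$ there exist $\delta_0>0$ and $\Omega_{\varepsilon,\delta_0,\rho}\subset\Omega$ such that $P(\Omega_{\varepsilon,\delta_0,\rho})>1-\varepsilon$ and for any $\omega\in\Omega_{\varepsilon,\delta_0,\rho}$ and any $\delta<\delta_0$, $$U_\delta\le C(\omega)\,\delta^{2H-1-\rho},$$ where $C(\omega)$ does not depend on $\delta$ and $\varepsilon$ (but depends on $\rho$). (ii) If, in addition, the coefficients $b$ and $\sigma$ are bounded, then for any $\rho\in(0,2H-1)$ there exists $C(\omega)<\infty$ a.s., not depending on $\delta$, such that $U_\delta\le C(\omega)\,\delta^{2H-1-\rho}$.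
   Context: Fractional Brownian motion with Hurst parameter $H$ is a centered Gaussian process with stationary increments and covariance $\frac12(t^{2H}+s^{2H}-|t-s|^{2H})$. Norms: $|A|=\sum_{i,j}|a^{ij}|$ for a matrix and $|y|=\sum_i|y^i|$ for a vector. Stochastic integrals with respect to a one-dimensional fractional Brownian motion $B$ are pathwise: $\int_a^b f\,dB=\int_a^b (D^{\alpha}_{a+}f)(s)\,(D^{1-\alpha}_{b-}B_{b-})(s)\,ds$, where $D^{\alpha}_{a+}$ and $D^{1-\alpha}_{b-}$ are the left- and right-sided fractional (Weyl) derivatives of orders $\alpha$ and $1-\alpha$ on $(a,b)$, and $B_{b-}(s)=(B_s-B_b)\mathbf 1_{(a,b)}(s)$. The integral exists for any $\alpha\in(1-H,\nu)$ if, for example, $f$ is Hölder continuous of order $\nu$ with $\nu+H>1$. The exponent $\alpha$ in $U_\delta$ is this order of fractional differentiation. Under (A)–(B) it is known (Nualart–Răşcanu) that the equation has a unique solution $X$, and its paths a.s. belong to the Hölder space $C^{H-\rho}[0,T]$ for every $0<\rho<H$; $X$ denotes this solution. Euler scheme: $\delta=T/N$, $\tau_n=n\delta$, $n=0,\dots,N$; $t_u:=\max\{\tau_n:\tau_n\le u\}$. Set $Y^\delta_0=X_0$ and, for $t\in[\tau_n,\tau_{n+1}]$, $$Y^{i,\delta}_t=Y^{i,\delta}_{\tau_n}+b^i(\tau_n,Y^\delta_{\tau_n})(t-\tau_n)+\sum_{j=1}^m\sigma^{ij}(\tau_n,Y^\delta_{\tau_n})(B^j_t-B^j_{\tau_n}).$$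 *)

theory Defs
  imports "HOL-Probability.Probability"
begin

section \<open>Norms and Hoelder continuity\<close>

definition vnorm :: "real ^ 'd \<Rightarrow> real" where
  "vnorm y = (\<Sum>i\<in>UNIV. \<bar>y $ i\<bar>)"

definition mnorm :: "real ^ 'm ^ 'd \<Rightarrow> real" where
  "mnorm A = (\<Sum>i\<in>UNIV. \<Sum>j\<in>UNIV. \<bar>A $ i $ j\<bar>)"

definition holder_on :: "real \<Rightarrow> real set \<Rightarrow> (real \<Rightarrow> real ^ 'd) \<Rightarrow> bool" where
  "holder_on \<theta> S f \<longleftrightarrow> (\<exists>K. \<forall>s\<in>S. \<forall>t\<in>S. vnorm (f t - f s) \<le> K * \<bar>t - s\<bar> powr \<theta>)"

definition partial_deriv ::
    "'d \<Rightarrow> (real ^ 'd \<Rightarrow> real ^ 'm ^ 'd) \<Rightarrow> real ^ 'd \<Rightarrow> real ^ 'm ^ 'd" where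
  "partial_deriv i f x = frechet_derivative f (at x) (axis i 1)"


section \<open>Fractional Brownian motion\<close>

text \<open>Gaussian laws are allowed to be degenerate, since a fractional Brownian motion starts at 0.\<close>

definition gaussian_rv :: "'w measure \<Rightarrow> ('w \<Rightarrow> real) \<Rightarrow> bool" where
  "gaussian_rv M Z \<longleftrightarrow> Z \<in> borel_measurable M \<and>
     (\<exists>\<mu>. (AE w in M. Z w = \<mu>) \<or> (\<exists>s>0. distributed M lborel Z (normal_density \<mu> s)))"

definition gaussian_process :: "'w measure \<Rightarrow> real set \<Rightarrow> (real \<Rightarrow> 'w \<Rightarrow> real) \<Rightarrow> bool" where
  "gaussian_process M I B \<longleftrightarrow>
     (\<forall>J c. finite J \<and> J \<subseteq> I \<longrightarrow> gaussian_rv M (\<lambda>w. \<Sum>t\<in>J. c t * B t w))"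

definition stationary_increments :: "'w measure \<Rightarrow> real set \<Rightarrow> (real \<Rightarrow> 'w \<Rightarrow> real) \<Rightarrow> bool" where
  "stationary_increments M I B \<longleftrightarrow>
     (\<forall>J s h. finite J \<and> insert s J \<subseteq> I \<and> (\<lambda>t. t + h) ` insert s J \<subseteq> I \<longrightarrow>
        distr M (PiM J (\<lambda>_. borel)) (\<lambda>w. \<lambda>t\<in>J. B (t + h) w - B (s + h) w) =
        distr M (PiM J (\<lambda>_. borel)) (\<lambda>w. \<lambda>t\<in>J. B t w - B s w))"

text \<open>
  The laws do not determine the paths. As usual, a version with almost surely continuous
  paths is meant: the pathwise integral is not meaningful otherwise.
\<close>

definition fractional_brownian_motion ::
    "'w measure \<Rightarrow> real \<Rightarrow> real set \<Rightarrow> (real \<Rightarrow> 'w \<Rightarrow> real) \<Rightarrow> bool" where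
  "fractional_brownian_motion M H I B \<longleftrightarrow>
     gaussian_process M I B \<and>
     (\<forall>t\<in>I. (LINT w|M. B t w) = 0) \<and>
     stationary_increments M I B \<and>
     (\<forall>t\<in>I. \<forall>s\<in>I. (LINT w|M. B t w * B s w) =
        (t powr (2 * H) + s powr (2 * H) - \<bar>t - s\<bar> powr (2 * H)) / 2) \<and>
     (AE w in M. continuous_on I (\<lambda>t. B t w))"


section \<open>The pathwise integral\<close>

definition weyl_left :: "real \<Rightarrow> real \<Rightarrow> (real \<Rightarrow> real) \<Rightarrow> real \<Rightarrow> real" where
  "weyl_left \<alpha> a f s =
     (f s / (s - a) powr \<alpha> +
      \<alpha> * (LBINT u:{a<..<s}. (f s - f u) / (s - u) powr (\<alpha> + 1))) / Gamma (1 - \<alpha>)"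

text \<open>
  The right-sided derivative of order \<open>\<alpha>\<close> customarily carries a complex phase
  \<open>(-1) powr \<alpha>\<close>; here it is left out.
\<close>

definition weyl_right :: "real \<Rightarrow> real \<Rightarrow> (real \<Rightarrow> real) \<Rightarrow> real \<Rightarrow> real" where
  "weyl_right \<alpha> b g s =
     (g s / (b - s) powr \<alpha> +
      \<alpha> * (LBINT u:{s<..<b}. (g s - g u) / (u - s) powr (\<alpha> + 1))) / Gamma (1 - \<alpha>)"

definition shift_right :: "real \<Rightarrow> real \<Rightarrow> (real \<Rightarrow> real) \<Rightarrow> real \<Rightarrow> real" where
  "shift_right a b g s = (g s - g b) * indicator {a<..<b} s"

text \<open>
  The generalized Lebesgue--Stieltjes integral is \<open>(-1) powr \<alpha>\<close> times the integral of the product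
  of the two derivatives. That factor and the phase of the right-sided derivative of order
  \<open>1 - \<alpha>\<close> multiply to \<open>-1\<close>; with this sign the integral of 1 against \<open>g\<close> is \<open>g b - g a\<close>.
\<close>

definition pathwise_integral ::
    "real \<Rightarrow> real \<Rightarrow> real \<Rightarrow> (real \<Rightarrow> real) \<Rightarrow> (real \<Rightarrow> real) \<Rightarrow> real" where
  "pathwise_integral \<alpha> a b f g =
     - (LBINT s:{a<..<b}. weyl_left \<alpha> a f s * weyl_right (1 - \<alpha>) b (shift_right a b g) s)"

text \<open>Existence of the integral, needed because the Bochner integral is total.\<close>

definition pathwise_integrable ::
    "real \<Rightarrow> real \<Rightarrow> real \<Rightarrow> (real \<Rightarrow> real) \<Rightarrow> (real \<Rightarrow> real) \<Rightarrow> bool" where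
  "pathwise_integrable \<alpha> a b f g \<longleftrightarrow>
     (AE s in lborel. s \<in> {a<..<b} \<longrightarrow>
        set_integrable lborel {a<..<s} (\<lambda>u. (f s - f u) / (s - u) powr (\<alpha> + 1)) \<and>
        set_integrable lborel {s<..<b}
          (\<lambda>u. (shift_right a b g s - shift_right a b g u) / (u - s) powr (2 - \<alpha>))) \<and>
     set_integrable lborel {a<..<b}
       (\<lambda>s. weyl_left \<alpha> a f s * weyl_right (1 - \<alpha>) b (shift_right a b g) s)"


section \<open>Coefficients\<close>

definition cond_A ::
    "real \<Rightarrow> real \<Rightarrow> real \<Rightarrow> real \<Rightarrow> (real \<Rightarrow> real ^ 'd \<Rightarrow> real ^ 'm ^ 'd) \<Rightarrow> bool" where
  "cond_A T K \<beta> \<kappa> \<sigma> \<longleftrightarrow>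
     (\<forall>t\<in>{0..T}. \<forall>x. \<sigma> t differentiable at x) \<and>
     (\<forall>t\<in>{0..T}. \<forall>x y. mnorm (\<sigma> t x - \<sigma> t y) \<le> K * vnorm (x - y)) \<and>
     (\<forall>t\<in>{0..T}. \<forall>x y i.
        mnorm (partial_deriv i (\<sigma> t) x - partial_deriv i (\<sigma> t) y) \<le> K * vnorm (x - y) powr \<kappa>) \<and>
     (\<forall>t\<in>{0..T}. \<forall>s\<in>{0..T}. \<forall>x i.
        mnorm (\<sigma> t x - \<sigma> s x) + mnorm (partial_deriv i (\<sigma> t) x - partial_deriv i (\<sigma> s) x)
          \<le> K * \<bar>t - s\<bar> powr \<beta>)"

definition cond_B :: "real \<Rightarrow> real \<Rightarrow> (real \<Rightarrow> real ^ 'd \<Rightarrow> real ^ 'd) \<Rightarrow> bool" where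
  "cond_B T L b \<longleftrightarrow>
     (\<forall>t\<in>{0..T}. \<forall>x y. vnorm (b t x - b t y) \<le> L * vnorm (x - y)) \<and>
     (\<forall>t\<in>{0..T}. \<forall>x. vnorm (b t x) \<le> L * (1 + vnorm x))"

definition cond_C :: "real \<Rightarrow> real \<Rightarrow> (real \<Rightarrow> real ^ 'd \<Rightarrow> real ^ 'm ^ 'd) \<Rightarrow> bool" where
  "cond_C T C \<sigma> \<longleftrightarrow> (\<forall>t\<in>{0..T}. \<forall>x. mnorm (\<sigma> t x) \<le> C * (1 + vnorm x))"

definition cond_D1 :: "real \<Rightarrow> real \<Rightarrow> real \<Rightarrow> (real \<Rightarrow> real ^ 'd \<Rightarrow> real ^ 'd) \<Rightarrow> bool" where
  "cond_D1 T C \<gamma> b \<longleftrightarrow>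
     (\<forall>t\<in>{0..T}. \<forall>s\<in>{0..T}. \<forall>x. vnorm (b t x - b s x) \<le> C * \<bar>t - s\<bar> powr \<gamma>)"

text \<open>Measurability on \<open>\<Omega> \<times> [0,T] \<times> \<real>\<^sup>d\<close>.\<close>

definition coeff_measurable ::
    "'w measure \<Rightarrow> real \<Rightarrow> ('w \<Rightarrow> real \<Rightarrow> real ^ 'd \<Rightarrow> real) \<Rightarrow> bool" where
  "coeff_measurable M T f \<longleftrightarrow>
     (\<lambda>(w, t, x). f w t x) \<in>
       borel_measurable (M \<Otimes>\<^sub>M restrict_space borel {0..T} \<Otimes>\<^sub>M borel)"


section \<open>The solution and its Euler approximation\<close>

text \<open>
  The solution is unique in the class of processes whose paths are almost surely Hoelder
  continuous of every order less than \<open>H\<close>, which is therefore part of the definition.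
\<close>

definition sde_solution ::
    "'w measure \<Rightarrow> real \<Rightarrow> real \<Rightarrow> real \<Rightarrow> ('w \<Rightarrow> real \<Rightarrow> real ^ 'd \<Rightarrow> real ^ 'd) \<Rightarrow>
     ('w \<Rightarrow> real \<Rightarrow> real ^ 'd \<Rightarrow> real ^ 'm ^ 'd) \<Rightarrow> ('m \<Rightarrow> real \<Rightarrow> 'w \<Rightarrow> real) \<Rightarrow>
     ('w \<Rightarrow> real ^ 'd) \<Rightarrow> (real \<Rightarrow> 'w \<Rightarrow> real ^ 'd) \<Rightarrow> bool" where
  "sde_solution M T H \<alpha> b \<sigma> B X\<^sub>0 X \<longleftrightarrow>
     (\<forall>t\<in>{0..T}. X t \<in> borel_measurable M) \<and>
     (AE w in M.
        (\<forall>\<rho>. 0 < \<rho> \<and> \<rho> < H \<longrightarrow> holder_on (H - \<rho>) {0..T} (\<lambda>t. X t w)) \<and>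
        (\<forall>t\<in>{0..T}. \<forall>i.
           (\<forall>j. pathwise_integrable \<alpha> 0 t (\<lambda>s. \<sigma> w s (X s w) $ i $ j) (\<lambda>s. B j s w)) \<and>
           set_integrable lborel {0..t} (\<lambda>s. b w s (X s w) $ i) \<and>
           X t w $ i = X\<^sub>0 w $ i
             + (\<Sum>j\<in>UNIV. pathwise_integral \<alpha> 0 t (\<lambda>s. \<sigma> w s (X s w) $ i $ j) (\<lambda>s. B j s w))
             + (LBINT s:{0..t}. b w s (X s w) $ i)))"

definition grid :: "real \<Rightarrow> nat \<Rightarrow> nat \<Rightarrow> real" where
  "grid T N n = real n * (T / real N)"

definition grid_floor :: "real \<Rightarrow> nat \<Rightarrow> real \<Rightarrow> real" where
  "grid_floor T N u = Max {grid T N n | n. n \<le> N \<and> grid T N n \<le> u}"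

text \<open>
  For \<open>N > 0\<close> this determines \<open>Y\<close> uniquely on \<open>{0..T}\<close>.
\<close>

definition euler_approximation ::
    "real \<Rightarrow> nat \<Rightarrow> (real \<Rightarrow> real ^ 'd \<Rightarrow> real ^ 'd) \<Rightarrow> (real \<Rightarrow> real ^ 'd \<Rightarrow> real ^ 'm ^ 'd) \<Rightarrow>
     ('m \<Rightarrow> real \<Rightarrow> real) \<Rightarrow> real ^ 'd \<Rightarrow> (real \<Rightarrow> real ^ 'd) \<Rightarrow> bool" where
  "euler_approximation T N b \<sigma> B x\<^sub>0 Y \<longleftrightarrow>
     Y 0 = x\<^sub>0 \<and>
     (\<forall>n<N. \<forall>t\<in>{grid T N n..grid T N (Suc n)}. \<forall>i.
        Y t $ i = Y (grid T N n) $ i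
          + b (grid T N n) (Y (grid T N n)) $ i * (t - grid T N n)
          + (\<Sum>j\<in>UNIV. \<sigma> (grid T N n) (Y (grid T N n)) $ i $ j * (B j t - B j (grid T N n))))"

text \<open>Taken in \<open>[0,\<infinity>]\<close>, so that neither the supremum nor the integral needs a finiteness assumption.\<close>

definition euler_error ::
    "real \<Rightarrow> real \<Rightarrow> nat \<Rightarrow> (real \<Rightarrow> real ^ 'd) \<Rightarrow> (real \<Rightarrow> real ^ 'd) \<Rightarrow> ennreal" where
  "euler_error \<alpha> T N X Y =
     (SUP s\<in>{0..T}. ennreal (vnorm (X s - Y s)) +
        (\<integral>\<^sup>+u\<in>{0..grid_floor T N s}.
           ennreal (vnorm (X s - Y s - X u + Y u) * (s - u) powr (- \<alpha> - 1)) \<partial>lborel))"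

end

theory Submission
  imports Defs
begin

text \<open>
  The argument is pathwise. Approximating both functions by \<open>C\<^sup>1\<close> functions with the same Hoelder
  constants shows that the pathwise integral is additive in its endpoints and satisfies Young's
  estimate. Hence the solution obeys the Euler recursion up to a local error of order
  \<open>h powr (2 * \<theta>)\<close>, for any \<open>\<theta> < H\<close> such that the paths of the noise are Hoelder continuous of order
  \<open>\<theta>\<close>, and the error on the grid solves a discrete linear Young equation with a source of size
  \<open>h powr (2 * \<theta> - 1)\<close> per unit of time. A discrete Young inequality and a Gronwall argument over
  windows whose length does not depend on \<open>h\<close> bound the full \<open>\<theta>\<close>-Hoelder seminorm of the error by
  a multiple of \<open>h powr (2 * \<theta> - 1)\<close>, from which the integral in \<open>U\<close> is controlled because
  \<open>\<alpha> < \<theta>\<close>. The resulting bound holds almost surely for all step sizes, and so gives both parts.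
\<close>


section \<open>Discrete Young equations\<close>

lemma powr_superadd_balanced:
  fixes a c q :: real
  assumes "0 \<le> a" "0 \<le> c" "a \<le> 2 / 3 * (a + c)" "c \<le> 2 / 3 * (a + c)" "1 < q"
  shows "a powr q + c powr q \<le> (2 / 3) powr (q - 1) * (a + c) powr q"
proof -
  have *: "x powr q \<le> (2 / 3 * (a + c)) powr (q - 1) * x" if "0 \<le> x" "x \<le> 2 / 3 * (a + c)" for x
  proof -
    have "x powr q = x powr (q - 1) * x"
      using that by (cases "x = 0") (auto simp: powr_diff)
    also have "\<dots> \<le> (2 / 3 * (a + c)) powr (q - 1) * x"
      using that assms(5) by (intro mult_right_mono powr_mono2) auto
    finally show ?thesis .
  qed
  have "a powr q + c powr q \<le> (2 / 3 * (a + c)) powr (q - 1) * (a + c)"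
    using *[of a] *[of c] assms by (simp add: algebra_simps)
  also have "\<dots> = (2 / 3) powr (q - 1) * ((a + c) powr (q - 1) * (a + c))"
    using assms powr_mult[of "2 / 3" "a + c" "q - 1"] by simp
  also have "(a + c) powr (q - 1) * (a + c) = (a + c) powr q"
    using assms by (cases "a + c = 0") (auto simp: powr_diff)
  finally show ?thesis .
qed

text \<open>
  Bisection replaces Young's removal of points: splitting a range of at least two steps in the middle
  leaves no part longer than two thirds, so the powers of order \<open>\<mu> + \<theta> > 1\<close> contract by a fixed factor.
\<close>

lemma discrete_young:
  fixes s :: "nat \<Rightarrow> 'a::real_normed_vector" and g :: "nat \<Rightarrow> real"
  assumes "m \<le> n" "0 \<le> h" "0 \<le> S" "0 \<le> G" "0 \<le> \<mu>" "0 \<le> \<theta>" "1 < \<mu> + \<theta>"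
    and "\<And>i j. m \<le> i \<Longrightarrow> i \<le> j \<Longrightarrow> j \<le> n \<Longrightarrow> norm (s j - s i) \<le> S * (h * (real j - real i)) powr \<mu>"
    and "\<And>i j. m \<le> i \<Longrightarrow> i \<le> j \<Longrightarrow> j \<le> n \<Longrightarrow> \<bar>g j - g i\<bar> \<le> G * (h * (real j - real i)) powr \<theta>"
  shows "norm (\<Sum>k=m..<n. (g (Suc k) - g k) *\<^sub>R (s k - s m))
           \<le> S * G / (1 - (2 / 3) powr (\<mu> + \<theta> - 1)) * (h * (real n - real m)) powr (\<mu> + \<theta>)"
  using assms(1,8,9)
proof (induction "n - m" arbitrary: m n rule: less_induct)
  case less
  define r where "r = (2 / 3 :: real) powr (\<mu> + \<theta> - 1)"
  have r: "0 < r" "r < 1"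
    using assms(7) by (auto simp: r_def powr_def mult_pos_neg)
  define D where "D = S * G / (1 - r)"
  have D: "D * r + S * G = D" "0 \<le> D"
    using r assms(3,4) by (auto simp: D_def field_simps)
  show ?case
  proof (cases "n \<le> Suc m")
    case True
    then have "(\<Sum>k=m..<n. (g (Suc k) - g k) *\<^sub>R (s k - s m)) = 0"
      using less.prems(1) by (intro sum.neutral) (auto simp: le_Suc_eq)
    then show ?thesis
      using mult_nonneg_nonneg[OF D(2), of "(h * (real n - real m)) powr (\<mu> + \<theta>)"]
      by (simp add: D_def r_def)
  next
    case False
    define p where "p = m + (n - m) div 2"
    have p: "m < p" "p < n"
      using False by (auto simp: p_def)
    define a where "a = h * (real p - real m)"
    define c where "c = h * (real n - real p)"
    have "3 * p \<le> 2 * n + m" "n + 2 * m \<le> 3 * p"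
      using False by (auto simp: p_def)
    then have "real (3 * p) \<le> real (2 * n + m)" "real (n + 2 * m) \<le> real (3 * p)"
      by (simp_all only: of_nat_le_iff)
    then have "h * (3 * (real p - real m)) \<le> h * (2 * (real n - real m))"
        "h * (3 * (real n - real p)) \<le> h * (2 * (real n - real m))"
      using assms(2) by (intro mult_left_mono; simp)+
    then have "3 * a \<le> 2 * (a + c)" "3 * c \<le> 2 * (a + c)"
      unfolding a_def c_def by (simp_all add: algebra_simps)
    moreover have "0 \<le> a" "0 \<le> c"
      unfolding a_def c_def using assms(2) p by auto
    ultimately have ac: "a powr (\<mu> + \<theta>) + c powr (\<mu> + \<theta>) \<le> r * (a + c) powr (\<mu> + \<theta>)"
      unfolding r_def using assms(7) by (intro powr_superadd_balanced) auto
    have ac_eq: "a + c = h * (real n - real m)"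
      by (simp add: a_def c_def algebra_simps)
    let ?J = "\<lambda>m n. \<Sum>k=m..<n. (g (Suc k) - g k) *\<^sub>R (s k - s m)"
    have tele: "(\<Sum>k=p..<n. g (Suc k) - g k) = g n - g p"
      using p by (intro sum_Suc_diff') auto
    have "?J m n = ?J m p + (\<Sum>k=p..<n. (g (Suc k) - g k) *\<^sub>R (s k - s m))"
      using p by (subst sum.atLeastLessThan_concat) auto
    also have "(\<Sum>k=p..<n. (g (Suc k) - g k) *\<^sub>R (s k - s m))
        = (\<Sum>k=p..<n. (g (Suc k) - g k) *\<^sub>R (s k - s p) + (g (Suc k) - g k) *\<^sub>R (s p - s m))"
      by (intro sum.cong refl) (simp flip: scaleR_add_right)
    also have "\<dots> = ?J p n + (g n - g p) *\<^sub>R (s p - s m)"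
      by (simp add: sum.distrib tele flip: scaleR_sum_left)
    finally have split: "?J m n = ?J m p + (?J p n + (g n - g p) *\<^sub>R (s p - s m))" .
    have 1: "norm (?J m p) \<le> D * a powr (\<mu> + \<theta>)"
      unfolding D_def r_def a_def using p less.prems
      by (intro less.hyps) auto
    have 2: "norm (?J p n) \<le> D * c powr (\<mu> + \<theta>)"
      unfolding D_def r_def c_def using p less.prems
      by (intro less.hyps) auto
    have "norm ((g n - g p) *\<^sub>R (s p - s m)) \<le> (G * c powr \<theta>) * (S * a powr \<mu>)"
      unfolding norm_scaleR a_def c_def using p less.prems assms
      by (intro mult_mono) auto
    also have "\<dots> \<le> (G * (a + c) powr \<theta>) * (S * (a + c) powr \<mu>)"
      using \<open>0 \<le> a\<close> \<open>0 \<le> c\<close> assms(3-6) by (intro mult_mono powr_mono2) auto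
    also have "\<dots> = S * G * (a + c) powr (\<mu> + \<theta>)"
      by (simp add: powr_add)
    finally have 3: "norm ((g n - g p) *\<^sub>R (s p - s m)) \<le> S * G * (a + c) powr (\<mu> + \<theta>)" .
    have "norm (?J m n) \<le> norm (?J m p) + (norm (?J p n) + norm ((g n - g p) *\<^sub>R (s p - s m)))"
      unfolding split by (intro order_trans[OF norm_triangle_ineq] add_left_mono norm_triangle_ineq)
    also have "\<dots> \<le> D * (a powr (\<mu> + \<theta>) + c powr (\<mu> + \<theta>)) + S * G * (a + c) powr (\<mu> + \<theta>)"
      using 1 2 3 by (simp add: algebra_simps)
    also have "\<dots> \<le> D * (r * (a + c) powr (\<mu> + \<theta>)) + S * G * (a + c) powr (\<mu> + \<theta>)"
      using ac D(2) by (intro add_right_mono mult_left_mono)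
    also have "\<dots> = (D * r + S * G) * (a + c) powr (\<mu> + \<theta>)"
      by (simp add: algebra_simps)
    also have "\<dots> = D * (h * (real n - real m)) powr (\<mu> + \<theta>)"
      unfolding D(1) ac_eq ..
    finally show ?thesis
      by (simp add: D_def r_def)
  qed
qed

text \<open>
  The seminorm estimate behind \<open>window\<close> below is uniform in \<open>h\<close> only on windows of length at most \<open>l\<close>;
  if the step exceeds \<open>l\<close>, the single steps play the role of the windows.
\<close>

locale young_recursion =
  fixes T \<theta> \<mu> K1 K2 K3 G R h :: real and N :: nat
    and z d :: "nat \<Rightarrow> 'a::real_normed_vector"
    and s :: "'j::finite \<Rightarrow> nat \<Rightarrow> 'a" and g :: "'j \<Rightarrow> nat \<Rightarrow> real"
  assumes T: "0 < T" and N: "0 < N" and h: "h = T / real N"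
    and \<mu>: "0 < \<mu>" "\<mu> \<le> \<theta>" "\<theta> < 1" "1 < \<mu> + \<theta>"
    and K: "0 \<le> K1" "0 \<le> K2" "0 \<le> K3" "0 \<le> G" "0 \<le> R"
    and rec: "\<And>n. n < N \<Longrightarrow> z (Suc n) = z n + (\<Sum>j\<in>UNIV. (g j (Suc n) - g j n) *\<^sub>R s j n) + d n"
    and s_bound: "\<And>j n. n \<le> N \<Longrightarrow> norm (s j n) \<le> K1 * norm (z n)"
    and s_holder: "\<And>j m n. m \<le> n \<Longrightarrow> n \<le> N \<Longrightarrow>
      norm (s j n - s j m) \<le> K1 * norm (z n - z m) + K2 * norm (z m) * (h * (real n - real m)) powr \<mu>"
    and d_bound: "\<And>n. n < N \<Longrightarrow> norm (d n) \<le> K3 * (norm (z n) + R) * h"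
    and g_holder: "\<And>j m n. m \<le> n \<Longrightarrow> n \<le> N \<Longrightarrow> \<bar>g j n - g j m\<bar> \<le> G * (h * (real n - real m)) powr \<theta>"
begin

definition "J = real CARD('j)"
definition "D = J * G * K1 + J * G * (1 / (1 - (2 / 3) powr (\<mu> + \<theta> - 1))) * (K1 + K2) + K3"

lemma h_pos: "0 < h"
  using T N by (simp add: h)

lemma N_h: "h * real N = T"
  using N by (simp add: h)

lemma young_const: "0 \<le> 1 / (1 - (2 / 3 :: real) powr (\<mu> + \<theta> - 1))"
  using \<mu>(4) by (auto simp: powr_def mult_pos_neg intro!: less_imp_le)

lemma D_nonneg: "0 \<le> D"
  unfolding D_def J_def using K young_const by (intro add_nonneg_nonneg mult_nonneg_nonneg) auto

lemma telescope:
  assumes "m \<le> n" "n \<le> N"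
  shows "z n - z m = (\<Sum>j\<in>UNIV. (g j n - g j m) *\<^sub>R s j m
      + (\<Sum>k=m..<n. (g j (Suc k) - g j k) *\<^sub>R (s j k - s j m))) + (\<Sum>k=m..<n. d k)"
proof -
  have *: "(\<Sum>k=m..<n. (g j (Suc k) - g j k) *\<^sub>R s j k) = (g j n - g j m) *\<^sub>R s j m
      + (\<Sum>k=m..<n. (g j (Suc k) - g j k) *\<^sub>R (s j k - s j m))" for j
  proof -
    have "(g j n - g j m) *\<^sub>R s j m = (\<Sum>k=m..<n. (g j (Suc k) - g j k) *\<^sub>R s j m)"
      using sum_Suc_diff'[OF assms(1), of "g j"] by (simp flip: scaleR_sum_left)
    then show ?thesis
      by (simp add: scaleR_diff_right flip: sum.distrib)
  qed
  have "z n - z m = (\<Sum>k=m..<n. z (Suc k) - z k)"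
    using assms by (simp add: sum_Suc_diff')
  also have "\<dots> = (\<Sum>k=m..<n. (\<Sum>j\<in>UNIV. (g j (Suc k) - g j k) *\<^sub>R s j k) + d k)"
    using assms by (intro sum.cong) (auto simp: rec)
  also have "\<dots> = (\<Sum>j\<in>UNIV. \<Sum>k=m..<n. (g j (Suc k) - g j k) *\<^sub>R s j k) + (\<Sum>k=m..<n. d k)"
    by (simp add: sum.distrib) (rule sum.swap)
  finally show ?thesis
    by (simp add: *)
qed

lemma window_pair:
  assumes "m \<le> n" "n \<le> N" "h * (real n - real m) \<le> l" "0 < l" "l \<le> 1" "0 \<le> E"
    and E: "\<And>i j. m \<le> i \<Longrightarrow> i \<le> j \<Longrightarrow> j \<le> n \<Longrightarrow> norm (z j - z i) \<le> E * (h * (real j - real i)) powr \<theta>"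
    and "m \<le> i" "i \<le> j" "j \<le> n"
  shows "norm (z j - z i) \<le> (D * (norm (z m) + R) + D * l powr \<mu> * E) * (h * (real j - real i)) powr \<theta>"
proof -
  define L where "L = norm (z m) + R"
  define e where "e = E * l powr \<mu>"
  define \<tau> where "\<tau> = h * (real j - real i)"
  define c where "c = 1 / (1 - (2 / 3 :: real) powr (\<mu> + \<theta> - 1))"
  define S where "S = K1 * E + K2 * (norm (z m) + E)"
  have c: "0 \<le> c"
    unfolding c_def by (rule young_const)
  have S: "0 \<le> S"
    unfolding S_def using assms(6) K by (intro add_nonneg_nonneg mult_nonneg_nonneg) auto
  have e: "0 \<le> e"
    using assms(6) by (simp add: e_def)
  have within: "0 \<le> h * (real v - real u)" "h * (real v - real u) \<le> l" if "m \<le> u" "u \<le> v" "v \<le> n" for u v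
  proof -
    have "h * (real v - real u) \<le> h * (real n - real m)"
      using that h_pos by (intro mult_left_mono) auto
    then show "h * (real v - real u) \<le> l"
      using assms(3) by simp
  qed (use that h_pos in auto)
  have \<tau>: "0 \<le> \<tau>" "\<tau> \<le> l" "\<tau> \<le> 1"
    unfolding \<tau>_def using within[of i j] assms(5,8-10) by auto
  have l_powr: "l powr \<theta> \<le> l powr \<mu>" "l powr \<mu> \<le> 1"
    using assms(4,5) \<mu> by (auto intro: powr_mono' powr_le1)
  have z_bound: "norm (z k) \<le> norm (z m) + e" "norm (z k) \<le> norm (z m) + E" if "m \<le> k" "k \<le> n" for k
  proof -
    have "norm (z k) \<le> norm (z m) + norm (z k - z m)"
      by (metis add.commute diff_add_cancel norm_triangle_ineq)
    also have "norm (z k - z m) \<le> E * (h * (real k - real m)) powr \<theta>"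
      using E[of m k] that by simp
    also have "\<dots> \<le> E * l powr \<theta>"
      using within[of m k] that \<mu> assms(6) by (intro mult_left_mono powr_mono2) auto
    also have "\<dots> \<le> e"
      unfolding e_def using l_powr assms(6) by (intro mult_left_mono) auto
    finally show "norm (z k) \<le> norm (z m) + e" by simp
    also have "e \<le> E"
      unfolding e_def using l_powr assms(6) by (intro mult_left_le) auto
    finally show "norm (z k) \<le> norm (z m) + E" by simp
  qed
  have S_holder: "norm (s q v - s q u) \<le> S * (h * (real v - real u)) powr \<mu>"
    if "i \<le> u" "u \<le> v" "v \<le> j" for q u v
  proof -
    let ?t = "h * (real v - real u)"
    have uv: "m \<le> u" "u \<le> v" "v \<le> n"
      using that assms by auto
    have t: "0 \<le> ?t" "?t \<le> 1"
      using within[OF uv] assms(5) by auto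
    have "norm (s q v - s q u) \<le> K1 * norm (z v - z u) + K2 * norm (z u) * ?t powr \<mu>"
      using uv assms(2) by (intro s_holder) auto
    also have "\<dots> \<le> K1 * (E * ?t powr \<mu>) + K2 * (norm (z m) + E) * ?t powr \<mu>"
    proof (intro add_mono mult_left_mono mult_right_mono)
      have "norm (z v - z u) \<le> E * ?t powr \<theta>"
        using uv by (intro E)
      also have "\<dots> \<le> E * ?t powr \<mu>"
        using assms(6) t \<mu> by (intro mult_left_mono) (auto intro: powr_mono')
      finally show "norm (z v - z u) \<le> E * ?t powr \<mu>" .
      show "norm (z u) \<le> norm (z m) + E"
        using uv by (intro z_bound) auto
    qed (use K in auto)
    finally show ?thesis
      by (simp add: S_def algebra_simps)
  qed
  have noise: "norm ((g q j - g q i) *\<^sub>R s q i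
      + (\<Sum>k=i..<j. (g q (Suc k) - g q k) *\<^sub>R (s q k - s q i)))
      \<le> (G * K1 + G * c * (K1 + K2)) * (L + e) * \<tau> powr \<theta>" for q
  proof -
    have 1: "norm ((g q j - g q i) *\<^sub>R s q i) \<le> (G * \<tau> powr \<theta>) * (K1 * (L + e))"
      unfolding norm_scaleR
    proof (intro mult_mono)
      show "\<bar>g q j - g q i\<bar> \<le> G * \<tau> powr \<theta>"
        unfolding \<tau>_def using assms by (intro g_holder) auto
      have "norm (s q i) \<le> K1 * norm (z i)"
        using assms by (intro s_bound) auto
      also have "\<dots> \<le> K1 * (L + e)"
        using z_bound(1)[of i] assms K unfolding L_def by (intro mult_left_mono) auto
      finally show "norm (s q i) \<le> K1 * (L + e)" .
    qed (use K in auto)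
    have "norm (\<Sum>k=i..<j. (g q (Suc k) - g q k) *\<^sub>R (s q k - s q i))
        \<le> S * G / (1 - (2 / 3) powr (\<mu> + \<theta> - 1)) * (h * (real j - real i)) powr (\<mu> + \<theta>)"
      using assms(2,9,10) h_pos S K \<mu> S_holder by (intro discrete_young g_holder) auto
    also have "\<dots> = G * c * \<tau> powr \<theta> * (S * \<tau> powr \<mu>)"
      by (simp add: c_def \<tau>_def powr_add)
    also have "S * \<tau> powr \<mu> \<le> S * l powr \<mu>"
      using \<tau> \<mu> S by (intro mult_left_mono powr_mono2) auto
    also have "\<dots> = (K1 + K2) * e + K2 * norm (z m) * l powr \<mu>"
      by (simp add: S_def e_def algebra_simps)
    also have "\<dots> \<le> (K1 + K2) * e + K2 * norm (z m) * 1"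
      using l_powr K by (intro add_left_mono mult_left_mono) auto
    also have "\<dots> \<le> (K1 + K2) * (L + e)"
      using K by (simp add: L_def algebra_simps)
    finally have 2: "norm (\<Sum>k=i..<j. (g q (Suc k) - g q k) *\<^sub>R (s q k - s q i))
        \<le> G * c * \<tau> powr \<theta> * ((K1 + K2) * (L + e))"
      using K c by (simp add: mult_left_mono)
    show ?thesis
      using order_trans[OF norm_triangle_ineq add_mono[OF 1 2]] by (simp add: algebra_simps)
  qed
  have drift: "norm (\<Sum>k=i..<j. d k) \<le> K3 * (L + e) * \<tau> powr \<theta>"
  proof -
    have "norm (\<Sum>k=i..<j. d k) \<le> (\<Sum>k=i..<j. K3 * (L + e) * h)"
    proof (intro order_trans[OF norm_sum] sum_mono)
      fix k assume k: "k \<in> {i..<j}"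
      then have "norm (d k) \<le> K3 * (norm (z k) + R) * h"
        using assms by (intro d_bound) auto
      also have "\<dots> \<le> K3 * (L + e) * h"
        unfolding L_def using z_bound(1)[of k] k assms K h_pos
        by (intro mult_left_mono mult_right_mono) auto
      finally show "norm (d k) \<le> K3 * (L + e) * h" .
    qed
    also have "\<dots> = K3 * (L + e) * \<tau>"
      using assms by (simp add: \<tau>_def of_nat_diff algebra_simps)
    also have "\<tau> \<le> \<tau> powr \<theta>"
      using \<tau> \<mu> powr_mono'[of \<theta> 1 \<tau>] by (cases "\<tau> = 0") auto
    finally show ?thesis
      using K e by (simp add: L_def mult_left_mono)
  qed
  have "norm (z j - z i) \<le> (\<Sum>q\<in>(UNIV::'j set). (G * K1 + G * c * (K1 + K2)) * (L + e) * \<tau> powr \<theta>)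
      + K3 * (L + e) * \<tau> powr \<theta>"
    unfolding telescope[OF assms(9) order_trans[OF assms(10,2)]]
    by (intro order_trans[OF norm_triangle_ineq] add_mono drift order_trans[OF norm_sum] sum_mono noise)
  also have "\<dots> = D * (L + e) * \<tau> powr \<theta>"
    by (simp add: D_def J_def c_def algebra_simps)
  finally show ?thesis
    by (simp add: L_def e_def \<tau>_def algebra_simps)
qed

lemma window:
  assumes "m \<le> n" "n \<le> N" "h * (real n - real m) \<le> l" "0 < l" "l \<le> 1" "D * l powr \<mu> \<le> 1 / 2"
  shows "norm (z n - z m) \<le> 2 * D * (norm (z m) + R) * (h * (real n - real m)) powr \<theta>"
proof -
  define P where "P = {(i, j). m \<le> i \<and> i < j \<and> j \<le> n}"
  define q where "q = (\<lambda>(i, j). norm (z j - z i) / (h * (real j - real i)) powr \<theta>)"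
  define E where "E = Max (insert 0 (q ` P))"
  have "P \<subseteq> {..n} \<times> {..n}"
    by (auto simp: P_def)
  then have fin: "finite P"
    by (rule finite_subset) auto
  have E0: "0 \<le> E"
    unfolding E_def using fin by simp
  have E: "norm (z j - z i) \<le> E * (h * (real j - real i)) powr \<theta>" if "m \<le> i" "i \<le> j" "j \<le> n" for i j
  proof (cases "i = j")
    case False
    then have "q (i, j) \<le> E"
      unfolding E_def using fin that by (intro Max_ge) (auto simp: P_def)
    moreover have "0 < (h * (real j - real i)) powr \<theta>"
      using False that h_pos by auto
    ultimately show ?thesis
      by (simp add: q_def field_simps)
  qed simp
  let ?c = "D * (norm (z m) + R) + D * l powr \<mu> * E"
  have "E \<in> insert 0 (q ` P)"
    unfolding E_def using fin by (intro Max_in) auto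
  then consider "E = 0" | i j where "E = q (i, j)" "m \<le> i" "i < j" "j \<le> n"
    by (auto simp: P_def)
  then have "E \<le> ?c"
  proof cases
    case 1
    then show ?thesis
      using D_nonneg K by simp
  next
    case 2
    have "norm (z j - z i) \<le> ?c * (h * (real j - real i)) powr \<theta>"
      using 2(2-4) assms(1-5) E0 E by (intro window_pair[of m n l E]) auto
    moreover have "0 < (h * (real j - real i)) powr \<theta>"
      using 2(2-4) h_pos by auto
    ultimately have "q (i, j) \<le> ?c"
      by (simp add: q_def pos_divide_le_eq)
    then show ?thesis
      using 2(1) by simp
  qed
  also have "\<dots> \<le> D * (norm (z m) + R) + 1 / 2 * E"
    using assms(6) E0 by (intro add_left_mono mult_right_mono)
  finally have "E \<le> 2 * D * (norm (z m) + R)"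
    by simp
  then have "E * (h * (real n - real m)) powr \<theta> \<le> 2 * D * (norm (z m) + R) * (h * (real n - real m)) powr \<theta>"
    by (intro mult_right_mono) auto
  then show ?thesis
    using E[of m n] assms(1) by simp
qed

lemma one_step:
  assumes "m < N"
  shows "norm (z (Suc m) - z m) \<le> D * (1 + T) * (norm (z m) + R) * h powr \<theta>"
proof -
  have "h \<le> T"
    using N_h N h_pos mult_left_mono[of 1 "real N" h] by simp
  then have "h powr (1 - \<theta>) \<le> 1 + T"
    using h_pos T \<mu> powr_mono2[of "1 - \<theta>" h "1 + T"] powr_mono[of "1 - \<theta>" 1 "1 + T"] by simp
  then have "h powr (1 - \<theta>) * h powr \<theta> \<le> (1 + T) * h powr \<theta>"
    by (intro mult_right_mono) auto
  then have hT: "h \<le> (1 + T) * h powr \<theta>"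
    using h_pos by (simp flip: powr_add)
  have *: "norm ((g j (Suc m) - g j m) *\<^sub>R s j m) \<le> (G * h powr \<theta>) * (K1 * norm (z m))" for j
    unfolding norm_scaleR using g_holder[of m "Suc m" j] assms s_bound[of m j] K
    by (intro mult_mono) auto
  have "norm (z (Suc m) - z m) = norm ((\<Sum>j\<in>UNIV. (g j (Suc m) - g j m) *\<^sub>R s j m) + d m)"
    using assms by (simp add: rec)
  also have "\<dots> \<le> (\<Sum>j\<in>(UNIV::'j set). (G * h powr \<theta>) * (K1 * norm (z m))) + K3 * (norm (z m) + R) * h"
    using assms by (intro order_trans[OF norm_triangle_ineq] add_mono order_trans[OF norm_sum] sum_mono * d_bound)
  also have "\<dots> \<le> (J * G * K1) * (norm (z m) + R) * ((1 + T) * h powr \<theta>) + K3 * (norm (z m) + R) * ((1 + T) * h powr \<theta>)"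
  proof (intro add_mono mult_left_mono hT)
    have "(\<Sum>j\<in>(UNIV::'j set). (G * h powr \<theta>) * (K1 * norm (z m))) = (J * G * K1) * norm (z m) * (1 * h powr \<theta>)"
      by (simp add: J_def)
    also have "\<dots> \<le> (J * G * K1) * (norm (z m) + R) * ((1 + T) * h powr \<theta>)"
      using K T by (intro mult_mono mult_left_mono mult_right_mono mult_nonneg_nonneg) (auto simp: J_def)
    finally show "(\<Sum>j\<in>(UNIV::'j set). (G * h powr \<theta>) * (K1 * norm (z m))) \<le> \<dots>" .
  qed (use K in auto)
  also have "\<dots> = (J * G * K1 + K3) * ((norm (z m) + R) * ((1 + T) * h powr \<theta>))"
    by (simp add: algebra_simps)
  also have "\<dots> \<le> D * ((norm (z m) + R) * ((1 + T) * h powr \<theta>))"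
    using K T young_const unfolding D_def J_def
    by (intro mult_right_mono mult_nonneg_nonneg) auto
  finally show ?thesis
    by (simp add: algebra_simps)
qed

lemma holder:
  fixes l :: real
  defines "A \<equiv> 2 * D * (1 + T)"
  defines "W \<equiv> (1 + A * (1 + T)) ^ (nat \<lceil>2 * T / l\<rceil> + 1)"
  assumes z0: "z 0 = 0" and l: "0 < l" "l \<le> 1" "D * l powr \<mu> \<le> 1 / 2"
    and mn: "m \<le> n" "n \<le> N"
  shows "norm (z n - z m) \<le> (A * W + 2 * W * (2 / l) powr \<theta>) * R * (h * (real n - real m)) powr \<theta>"
proof -
  define p where "p = max 1 (nat \<lfloor>l / h\<rfloor>)"
  have p: "1 \<le> p" "l / 2 \<le> h * real p"
  proof -
    show "l / 2 \<le> h * real p"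
    proof (cases "h \<le> l")
      case True
      then have "1 \<le> l / h"
        using h_pos by simp
      then have fl: "1 \<le> \<lfloor>l / h\<rfloor>"
        by simp
      then have "1 \<le> nat \<lfloor>l / h\<rfloor>"
        by linarith
      then have "real p = of_int \<lfloor>l / h\<rfloor>"
        using fl by (simp add: p_def)
      moreover from fl have "l / h \<le> 2 * of_int \<lfloor>l / h\<rfloor>"
        by linarith
      ultimately show ?thesis
        using h_pos by (simp add: field_simps)
    next
      case False
      have "h * 1 \<le> h * real p"
        using h_pos by (intro mult_left_mono) (auto simp: p_def)
      then show ?thesis
        using False l by linarith
    qed
  qed (simp add: p_def)
  have A0: "0 \<le> A"
    unfolding A_def using D_nonneg T by simp
  have local: "norm (z n - z m) \<le> A * (norm (z m) + R) * (h * (real n - real m)) powr \<theta>"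
    if "m \<le> n" "n \<le> N" "n - m \<le> p" for m n
  proof (cases "h * (real n - real m) \<le> l")
    case True
    have "norm (z n - z m) \<le> 2 * D * (norm (z m) + R) * (h * (real n - real m)) powr \<theta>"
      using that True l by (intro window) auto
    also have "\<dots> \<le> A * (norm (z m) + R) * (h * (real n - real m)) powr \<theta>"
      unfolding A_def using D_nonneg T K by (intro mult_right_mono) (auto simp: algebra_simps)
    finally show ?thesis .
  next
    case False
    have "p = 1"
    proof (rule ccontr)
      assume "p \<noteq> 1"
      then have "p = nat \<lfloor>l / h\<rfloor>"
        unfolding p_def by linarith
      then have "real p \<le> l / h"
        using h_pos l(1) by (simp add: of_nat_floor)
      moreover have "real n - real m \<le> real p"
        using that by linarith
      ultimately have "h * (real n - real m) \<le> h * (l / h)"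
        using h_pos by (intro mult_left_mono) auto
      with False h_pos show False by simp
    qed
    moreover have "m \<noteq> n"
      using False l by auto
    ultimately have "n = Suc m"
      using that by simp
    then have "norm (z n - z m) \<le> D * (1 + T) * (norm (z m) + R) * (h * (real n - real m)) powr \<theta>"
      using that one_step[of m] by simp
    also have "\<dots> \<le> A * (norm (z m) + R) * (h * (real n - real m)) powr \<theta>"
      unfolding A_def using D_nonneg T K by (intro mult_right_mono) auto
    finally show ?thesis .
  qed
  let ?a = "1 + A * (1 + T)"
  have a: "1 \<le> ?a"
    using A0 T by simp
  have jump: "norm (z n) + R \<le> ?a * (norm (z m) + R)" if "m \<le> n" "n \<le> N" "n - m \<le> p" for m n
  proof -
    have "h * (real n - real m) \<le> h * real N"
      using that h_pos by (intro mult_left_mono) auto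
    then have "(h * (real n - real m)) powr \<theta> \<le> (1 + T) powr \<theta>"
      using that h_pos \<mu> by (intro powr_mono2) (auto simp: N_h)
    also have "\<dots> \<le> 1 + T"
      using T \<mu> powr_mono[of \<theta> 1 "1 + T"] by simp
    finally have "A * (norm (z m) + R) * (h * (real n - real m)) powr \<theta> \<le> A * (norm (z m) + R) * (1 + T)"
      using A0 K by (intro mult_left_mono) auto
    with local[OF that] have "norm (z n - z m) \<le> A * (norm (z m) + R) * (1 + T)"
      by linarith
    moreover have "norm (z n) \<le> norm (z m) + norm (z n - z m)"
      by (metis add.commute diff_add_cancel norm_triangle_ineq)
    ultimately show ?thesis
      by (simp add: algebra_simps)
  qed
  have grow: "norm (z n) + R \<le> ?a ^ (n div p + 1) * R" if "n \<le> N" for n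
    using that
  proof (induction n rule: less_induct)
    case (less n)
    show ?case
    proof (cases "n < p")
      case True
      then show ?thesis
        using jump[of 0 n] less.prems z0 by simp
    next
      case False
      then have np: "n div p = Suc ((n - p) div p)"
        using p by (simp add: le_div_geq)
      have "norm (z n) + R \<le> ?a * (norm (z (n - p)) + R)"
        using False less.prems p by (intro jump) auto
      also have "\<dots> \<le> ?a * (?a ^ ((n - p) div p + 1) * R)"
        using less.IH[of "n - p"] False less.prems p a by (intro mult_left_mono) auto
      finally show ?thesis
        by (simp add: np algebra_simps)
    qed
  qed
  have W0: "1 \<le> W"
    unfolding W_def using a by (rule one_le_power)
  have sup: "norm (z n) + R \<le> W * R" if "n \<le> N" for n
  proof -
    have "real (n div p) \<le> real n / real p"
      by (rule of_nat_div_le_of_nat)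
    also have "\<dots> = (h * real n) / (h * real p)"
      using h_pos by simp
    also have "\<dots> \<le> T / (l / 2)"
      using mult_left_mono[of "real n" "real N" h] that p h_pos l T by (intro frac_le) (auto simp: N_h)
    also have "\<dots> = 2 * T / l"
      by simp
    finally have "n div p \<le> nat \<lceil>2 * T / l\<rceil>"
      by linarith
    then have "?a ^ (n div p + 1) * R \<le> W * R"
      unfolding W_def using a K by (intro mult_right_mono power_increasing) auto
    with grow[OF that] show ?thesis by linarith
  qed
  have z_sup: "norm (z n) \<le> W * R" if "n \<le> N" for n
    using sup[OF that] K by linarith
  show ?thesis
  proof (cases "n - m \<le> p")
    case True
    have "norm (z n - z m) \<le> A * (norm (z m) + R) * (h * (real n - real m)) powr \<theta>"
      using mn True by (intro local)
    also have "\<dots> \<le> A * (W * R) * (h * (real n - real m)) powr \<theta>"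
      using A0 sup[of m] mn by (intro mult_right_mono mult_left_mono) auto
    also have "\<dots> \<le> (A * W + 2 * W * (2 / l) powr \<theta>) * R * (h * (real n - real m)) powr \<theta>"
      using W0 K by (intro mult_right_mono) (auto simp: algebra_simps)
    finally show ?thesis .
  next
    case False
    define \<tau> where "\<tau> = h * (real n - real m)"
    have "h * real p \<le> \<tau>"
      unfolding \<tau>_def using False h_pos mn by (intro mult_left_mono) (auto simp: of_nat_diff)
    with p have \<tau>: "l / 2 \<le> \<tau>" by linarith
    then have "1 \<le> 2 / l * \<tau>"
      using l by (simp add: field_simps)
    then have "1 \<le> (2 / l * \<tau>) powr \<theta>"
      using \<mu> by (intro ge_one_powr_ge_zero) auto
    then have one: "1 \<le> (2 / l) powr \<theta> * \<tau> powr \<theta>"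
      using l \<tau> powr_mult[of "2 / l" \<tau> \<theta>] by simp
    have "norm (z n - z m) \<le> norm (z n) + norm (z m)"
      by (rule norm_triangle_ineq4)
    also have "\<dots> \<le> 2 * W * R * 1"
      using z_sup[of n] z_sup[of m] mn by simp
    also have "\<dots> \<le> 2 * W * R * ((2 / l) powr \<theta> * \<tau> powr \<theta>)"
      using one W0 K by (intro mult_left_mono) auto
    also have "\<dots> \<le> (A * W + 2 * W * (2 / l) powr \<theta>) * R * \<tau> powr \<theta>"
      using A0 W0 K by (simp add: algebra_simps)
    finally show ?thesis
      by (simp add: \<tau>_def)
  qed
qed

end

lemma young_recursion_holder:
  fixes T \<theta> \<mu> K1 K2 K3 G :: real
  assumes "0 < T" "0 < \<mu>" "\<mu> \<le> \<theta>" "\<theta> < 1" "1 < \<mu> + \<theta>" "0 \<le> K1" "0 \<le> K2" "0 \<le> K3" "0 \<le> G"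
  shows "\<exists>C\<ge>0. \<forall>R h N (z :: nat \<Rightarrow> 'a::real_normed_vector) d (s :: 'j::finite \<Rightarrow> nat \<Rightarrow> 'a) g m n.
    young_recursion T \<theta> \<mu> K1 K2 K3 G R h N z d s g \<longrightarrow> z 0 = 0 \<longrightarrow> m \<le> n \<longrightarrow> n \<le> N \<longrightarrow>
      norm (z n - z m) \<le> C * R * (h * (real n - real m)) powr \<theta>"
proof -
  define D where "D = real CARD('j) * G * K1
    + real CARD('j) * G * (1 / (1 - (2 / 3) powr (\<mu> + \<theta> - 1))) * (K1 + K2) + K3"
  have c: "0 \<le> 1 / (1 - (2 / 3 :: real) powr (\<mu> + \<theta> - 1))"
    using assms(5) by (auto simp: powr_def mult_pos_neg intro!: less_imp_le)
  have D: "0 \<le> D"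
    unfolding D_def using assms c by (intro add_nonneg_nonneg mult_nonneg_nonneg) auto
  define l where "l = (1 / (2 * D + 1)) powr (1 / \<mu>)"
  have l: "0 < l" "l \<le> 1" "D * l powr \<mu> \<le> 1 / 2"
    using D assms(2) by (auto simp: l_def powr_powr powr_le1 field_simps)
  define A where "A = 2 * D * (1 + T)"
  define W where "W = (1 + A * (1 + T)) ^ (nat \<lceil>2 * T / l\<rceil> + 1)"
  have AW: "0 \<le> A" "0 \<le> W"
    using D assms(1) by (auto simp: A_def W_def)
  have "norm (z n - z m) \<le> (A * W + 2 * W * (2 / l) powr \<theta>) * R * (h * (real n - real m)) powr \<theta>"
    if "young_recursion T \<theta> \<mu> K1 K2 K3 G R h N z d s g" "z 0 = 0" "m \<le> n" "n \<le> N"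
    for R h N and z :: "nat \<Rightarrow> 'a" and d and s :: "'j \<Rightarrow> nat \<Rightarrow> 'a" and g m n
  proof -
    interpret r: young_recursion T \<theta> \<mu> K1 K2 K3 G R h N z d s g by fact
    have "r.D = D"
      by (simp add: r.D_def r.J_def D_def)
    then show ?thesis
      using r.holder[of l m n] that l by (simp add: A_def W_def)
  qed
  then show ?thesis
    using AW by (intro exI[of _ "A * W + 2 * W * (2 / l) powr \<theta>"]) auto
qed


section \<open>Weyl derivatives and the pathwise integral\<close>

lemma set_integral_reflect:
  fixes f :: "real \<Rightarrow> real"
  shows "(LBINT u:{a<..<b}. f u) = (LBINT u:{-b<..<-a}. f (- u))"
proof -
  have "indicator {a<..<b} (- u) = (indicator {-b<..<-a} u :: real)" for u
    by (auto simp: indicator_def)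
  then show ?thesis
    unfolding set_lebesgue_integral_def
    by (subst lborel_integral_real_affine[of "-1" _ 0]) auto
qed

lemma set_integrable_reflect:
  fixes f :: "real \<Rightarrow> real"
  shows "set_integrable lborel {a<..<b} f \<longleftrightarrow> set_integrable lborel {-b<..<-a} (\<lambda>u. f (- u))"
proof -
  have "indicator {a<..<b} (- u) = (indicator {-b<..<-a} u :: real)" for u
    by (auto simp: indicator_def)
  then show ?thesis
    unfolding set_integrable_def
    by (subst lborel_integrable_real_affine_iff[of "-1" _ 0, symmetric]) auto
qed

lemma powr_integral_left:
  fixes a b p :: real
  assumes "a < b" "-1 < p"
  shows "set_integrable lborel {a<..<b} (\<lambda>s. (s - a) powr p)"
    and "(LBINT s:{a<..<b}. (s - a) powr p) = (b - a) powr (p + 1) / (p + 1)"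
proof -
  let ?F = "\<lambda>s. (s - a) powr (p + 1) / (p + 1)"
  have F: "DERIV ?F x :> (x - a) powr p" if "ereal a < ereal x" "ereal x < ereal b" for x
    using that assms by (auto intro!: derivative_eq_intros)
  have c: "isCont (\<lambda>s. (s - a) powr p) x" if "ereal a < ereal x" "ereal x < ereal b" for x
    using that by (auto intro!: continuous_intros)
  have "((\<lambda>s. s - a) \<longlongrightarrow> a - a) (at_right a)"
    by (intro tendsto_intros)
  then have "(?F \<longlongrightarrow> (a - a) powr (p + 1) / (p + 1)) (at_right a)"
    using assms by (intro tendsto_divide tendsto_powr2 tendsto_const)
      (auto simp: eventually_at_filter)
  then have A: "((?F \<circ> real_of_ereal) \<longlongrightarrow> 0) (at_right (ereal a))"
    by (simp add: ereal_tendsto_simps)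
  have "(?F \<longlongrightarrow> (b - a) powr (p + 1) / (p + 1)) (at_left b)"
    using assms by (intro tendsto_intros) auto
  then have B: "((?F \<circ> real_of_ereal) \<longlongrightarrow> (b - a) powr (p + 1) / (p + 1)) (at_left (ereal b))"
    by (simp add: ereal_tendsto_simps)
  note * = interval_integral_FTC_nonneg[of "ereal a" "ereal b" ?F "\<lambda>s. (s - a) powr p", OF _ F c _ A B]
  show "set_integrable lborel {a<..<b} (\<lambda>s. (s - a) powr p)"
    using *(1) assms by (simp add: einterval_eq)
  show "(LBINT s:{a<..<b}. (s - a) powr p) = (b - a) powr (p + 1) / (p + 1)"
    using *(2) assms by (simp add: interval_integral_Ioo)
qed

lemma powr_integral_right:
  fixes a b p :: real
  assumes "a < b" "-1 < p"
  shows "set_integrable lborel {a<..<b} (\<lambda>s. (b - s) powr p)"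
    and "(LBINT s:{a<..<b}. (b - s) powr p) = (b - a) powr (p + 1) / (p + 1)"
  using powr_integral_left[of "-b" "-a" p] assms
  by (simp_all add: set_integrable_reflect[of a b] set_integral_reflect[of a b] add.commute)

lemma beta_integral:
  fixes a b p q :: real
  assumes "a < b" "0 < p" "0 < q"
  shows "set_integrable lborel {a<..<b} (\<lambda>s. (s - a) powr (p - 1) * (b - s) powr (q - 1))"
    and "(LBINT s:{a<..<b}. (s - a) powr (p - 1) * (b - s) powr (q - 1)) = Beta p q * (b - a) powr (p + q - 1)"
proof -
  let ?f = "\<lambda>t. indicator {0<..<1} t *\<^sub>R (t powr (p - 1) * (1 - t) powr (q - 1)) :: real"
  have "((\<lambda>t. t powr (p - 1) * (1 - t) powr (q - 1)) has_integral Beta p q) {0<..<1}"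
    using has_integral_Beta_real[OF assms(2,3)] by (simp add: has_integral_Icc_iff_Ioo)
  then have "(?f has_integral Beta p q) UNIV"
    by (subst (asm) has_integral_restrict_UNIV[symmetric])
      (auto elim!: has_integral_cong[THEN iffD1, rotated] simp: indicator_def)
  then have "(\<integral>\<^sup>+t. ennreal (?f t) \<partial>lborel) = ennreal (Beta p q)"
    by (intro nn_integral_has_integral_lborel) auto
  moreover have "?f \<in> borel_measurable lborel"
    by measurable
  ultimately have f: "has_bochner_integral lborel ?f (Beta p q)"
    using assms by (intro has_bochner_integral_nn_integral) (auto simp: Beta_def Gamma_real_pos less_imp_le)
  define c where "c = b - a"
  have c: "0 < c"
    using assms by (simp add: c_def)
  have eq: "c powr (p + q - 2) * ?f (- (a / c) + 1 / c * s)
      = indicator {a<..<b} s *\<^sub>R ((s - a) powr (p - 1) * (b - s) powr (q - 1))" for s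
  proof -
    have t: "- (a / c) + 1 / c * s = (s - a) / c"
      using c by (simp add: diff_divide_distrib)
    show ?thesis
    proof (cases "s \<in> {a<..<b}")
      case True
      have "1 - (s - a) / c = (b - s) / c"
        using c by (simp add: divide_simps c_def)
      moreover have "c powr (p + q - 2) = c powr (p - 1) * c powr (q - 1)"
        by (simp flip: powr_add)
      moreover have "(s - a) / c \<in> {0<..<1}"
        using True c by (simp add: c_def)
      ultimately show ?thesis
        unfolding t using True c by (simp add: powr_divide)
    next
      case False
      have "(s - a) / c \<notin> {0<..<1}"
        using False c by (auto simp: c_def zero_less_divide_iff divide_less_eq_1)
      then show ?thesis
        unfolding t using False by simp
    qed
  qed
  have "integrable lborel (\<lambda>s. ?f (- (a / c) + 1 / c * s))"
    using f c by (intro lborel_integrable_real_affine) (auto simp: has_bochner_integral_iff)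
  from integrable_mult_right[OF this, of "c powr (p + q - 2)"]
  show "set_integrable lborel {a<..<b} (\<lambda>s. (s - a) powr (p - 1) * (b - s) powr (q - 1))"
    unfolding set_integrable_def eq .
  have "Beta p q = (\<integral>t. ?f t \<partial>lborel)"
    using f by (simp add: has_bochner_integral_iff)
  also have "\<dots> = \<bar>1 / c\<bar> *\<^sub>R (\<integral>s. ?f (- (a / c) + 1 / c * s) \<partial>lborel)"
    using c by (intro lborel_integral_real_affine) auto
  finally have "Beta p q * c = (\<integral>s. ?f (- (a / c) + 1 / c * s) \<partial>lborel)"
    using c by (simp add: field_simps)
  then have "c powr (p + q - 2) * (Beta p q * c)
      = (\<integral>s. c powr (p + q - 2) * ?f (- (a / c) + 1 / c * s) \<partial>lborel)"
    by simp
  also have "\<dots> = (LBINT s:{a<..<b}. (s - a) powr (p - 1) * (b - s) powr (q - 1))"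
    unfolding eq set_lebesgue_integral_def ..
  finally show "(LBINT s:{a<..<b}. (s - a) powr (p - 1) * (b - s) powr (q - 1)) = Beta p q * (b - a) powr (p + q - 1)"
    using powr_mult_base[of c "p + q - 2"] c by (simp add: c_def mult_ac)
qed

definition holder_bound :: "real \<Rightarrow> real \<Rightarrow> (real \<Rightarrow> real) \<Rightarrow> bool" where
  "holder_bound F \<nu> f \<longleftrightarrow> (\<forall>s t. \<bar>f t - f s\<bar> \<le> F * \<bar>t - s\<bar> powr \<nu>)"

lemma holder_boundD: "holder_bound F \<nu> f \<Longrightarrow> \<bar>f t - f s\<bar> \<le> F * \<bar>t - s\<bar> powr \<nu>"
  by (simp add: holder_bound_def)

lemma holder_bound_nonneg: "holder_bound F \<nu> f \<Longrightarrow> 0 \<le> F"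
  using holder_boundD[of F \<nu> f 1 0] abs_ge_zero[of "f 1 - f 0"] by simp

lemma holder_bound_isCont:
  assumes "holder_bound F \<nu> f" "0 < \<nu>"
  shows "isCont f x"
proof -
  have "((\<lambda>y. \<bar>y - x\<bar>) \<longlongrightarrow> \<bar>x - x\<bar>) (at x)"
    by (intro tendsto_intros)
  then have "((\<lambda>y. F * \<bar>y - x\<bar> powr \<nu>) \<longlongrightarrow> F * 0 powr \<nu>) (at x)"
    using assms(2) by (intro tendsto_mult tendsto_const tendsto_powr2) auto
  then have "((\<lambda>y. f y - f x) \<longlongrightarrow> 0) (at x)"
    using holder_boundD[OF assms(1)] by (intro Lim_null_comparison[of "\<lambda>y. f y - f x"]) auto
  then show ?thesis
    by (simp add: isCont_def LIM_zero_iff)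
qed

lemma holder_bound_measurable:
  assumes "holder_bound F \<nu> f" "0 < \<nu>"
  shows "f \<in> borel_measurable borel"
  using holder_bound_isCont[OF assms]
  by (intro borel_measurable_continuous_onI continuous_at_imp_continuous_on) auto

lemma set_integral_dominated:
  fixes f k :: "real \<Rightarrow> real"
  assumes "set_integrable lborel A k" "A \<in> sets borel" "f \<in> borel_measurable borel"
    and "\<And>x. x \<in> A \<Longrightarrow> \<bar>f x\<bar> \<le> k x"
  shows "set_integrable lborel A f" "\<bar>LBINT x:A. f x\<bar> \<le> (LBINT x:A. k x)"
proof -
  show f: "set_integrable lborel A f"
    using assms unfolding set_integrable_def
    by (intro Bochner_Integration.integrable_bound[OF assms(1)[unfolded set_integrable_def]])
       (auto simp: indicator_def intro!: AE_I2 order_trans[OF _ abs_ge_self])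
  have "\<bar>LBINT x:A. f x\<bar> \<le> (LBINT x:A. \<bar>f x\<bar>)"
    using set_integral_norm_bound[OF f] by simp
  also have "\<dots> \<le> (LBINT x:A. k x)"
    using assms f by (intro set_integral_mono set_integrable_abs) auto
  finally show "\<bar>LBINT x:A. f x\<bar> \<le> (LBINT x:A. k x)" .
qed

lemma weyl_left_integrand:
  assumes f: "holder_bound F \<nu> f" and "0 < \<alpha>" "\<alpha> < \<nu>" "a < s"
  shows "set_integrable lborel {a<..<s} (\<lambda>u. (f s - f u) / (s - u) powr (\<alpha> + 1))"
    and "\<bar>LBINT u:{a<..<s}. (f s - f u) / (s - u) powr (\<alpha> + 1)\<bar> \<le> F * (s - a) powr (\<nu> - \<alpha>) / (\<nu> - \<alpha>)"
proof -
  have [measurable]: "f \<in> borel_measurable borel"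
    using assms by (intro holder_bound_measurable[OF f]) auto
  have k: "set_integrable lborel {a<..<s} (\<lambda>u. F * (s - u) powr (\<nu> - \<alpha> - 1))"
    using assms by (intro set_integrable_mult_right powr_integral_right) auto
  have b: "\<bar>(f s - f u) / (s - u) powr (\<alpha> + 1)\<bar> \<le> F * (s - u) powr (\<nu> - \<alpha> - 1)"
    if "u \<in> {a<..<s}" for u
  proof -
    have "\<bar>f s - f u\<bar> \<le> F * (s - u) powr \<nu>"
      using holder_boundD[OF f, of s u] that by simp
    then have "\<bar>f s - f u\<bar> / (s - u) powr (\<alpha> + 1) \<le> F * (s - u) powr \<nu> / (s - u) powr (\<alpha> + 1)"
      by (intro divide_right_mono) auto
    also have "\<dots> = F * (s - u) powr (\<nu> - \<alpha> - 1)"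
      using powr_diff[of "s - u" \<nu> "\<alpha> + 1"] by (simp add: diff_diff_eq)
    finally show ?thesis
      by (simp add: abs_divide)
  qed
  note * = set_integral_dominated[OF k _ _ b]
  show "set_integrable lborel {a<..<s} (\<lambda>u. (f s - f u) / (s - u) powr (\<alpha> + 1))"
    by (rule *(1)) auto
  have "\<bar>LBINT u:{a<..<s}. (f s - f u) / (s - u) powr (\<alpha> + 1)\<bar>
      \<le> (LBINT u:{a<..<s}. F * (s - u) powr (\<nu> - \<alpha> - 1))"
    by (rule *(2)) auto
  also have "\<dots> = F * (s - a) powr (\<nu> - \<alpha>) / (\<nu> - \<alpha>)"
    using powr_integral_right(2)[of a s "\<nu> - \<alpha> - 1"] assms by (simp add: set_integral_mult_right)
  finally show "\<bar>LBINT u:{a<..<s}. (f s - f u) / (s - u) powr (\<alpha> + 1)\<bar> \<le> \<dots>" .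
qed

lemma set_integral_tendsto:
  fixes f :: "nat \<Rightarrow> real \<Rightarrow> real"
  assumes "set_integrable lborel A k" "A \<in> sets borel" "\<And>n. f n \<in> borel_measurable borel"
    "f' \<in> borel_measurable borel"
    and "\<And>x. x \<in> A \<Longrightarrow> (\<lambda>n. f n x) \<longlonglongrightarrow> f' x" "\<And>n x. x \<in> A \<Longrightarrow> \<bar>f n x\<bar> \<le> k x"
  shows "(\<lambda>n. LBINT x:A. f n x) \<longlonglongrightarrow> (LBINT x:A. f' x)"
  unfolding set_lebesgue_integral_def
proof (rule integral_dominated_convergence)
  show "integrable lborel (\<lambda>x. indicator A x *\<^sub>R k x)"
    using assms(1) by (simp add: set_integrable_def)
  show "AE x in lborel. (\<lambda>n. indicator A x *\<^sub>R f n x) \<longlonglongrightarrow> indicator A x *\<^sub>R f' x"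
    using assms(5) by (intro AE_I2) (auto simp: indicator_def)
  show "AE x in lborel. norm (indicator A x *\<^sub>R f n x) \<le> indicator A x *\<^sub>R k x" for n
    using assms(6) by (intro AE_I2) (auto simp: indicator_def)
qed (use assms(2-4) in auto)

lemma weyl_left_measurable:
  assumes [measurable]: "f \<in> borel_measurable borel"
  shows "weyl_left \<alpha> a f \<in> borel_measurable borel"
proof -
  have "(\<lambda>(s, u). indicator {a<..<s} u *\<^sub>R ((f s - f u) / (s - u) powr (\<alpha> + 1)))
      \<in> borel_measurable (borel \<Otimes>\<^sub>M lborel)"
    unfolding indicator_def greaterThanLessThan_iff by measurable
  then have "(\<lambda>s. LBINT u:{a<..<s}. (f s - f u) / (s - u) powr (\<alpha> + 1)) \<in> borel_measurable borel"
    unfolding set_lebesgue_integral_def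
    by (rule sigma_finite_measure.borel_measurable_lebesgue_integral[OF sigma_finite_lborel])
  then show ?thesis
    unfolding weyl_left_def by measurable
qed

lemma weyl_left_bound:
  assumes f: "holder_bound F \<nu> f" and "0 < \<alpha>" "\<alpha> < 1" "\<alpha> < \<nu>" "a < s"
  shows "\<bar>weyl_left \<alpha> a f s\<bar>
    \<le> (\<bar>f a\<bar> * (s - a) powr (- \<alpha>) + F * (1 + \<alpha> / (\<nu> - \<alpha>)) * (s - a) powr (\<nu> - \<alpha>)) / Gamma (1 - \<alpha>)"
proof -
  let ?I = "LBINT u:{a<..<s}. (f s - f u) / (s - u) powr (\<alpha> + 1)"
  have G: "0 < Gamma (1 - \<alpha>)"
    using assms by (intro Gamma_real_pos) auto
  have "\<bar>f s\<bar> \<le> \<bar>f a\<bar> + \<bar>f s - f a\<bar>"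
    by linarith
  also have "\<bar>f s - f a\<bar> \<le> F * (s - a) powr \<nu>"
    using holder_boundD[OF f, of s a] assms by simp
  finally have "\<bar>f s\<bar> * (s - a) powr (- \<alpha>) \<le> (\<bar>f a\<bar> + F * (s - a) powr \<nu>) * (s - a) powr (- \<alpha>)"
    by (intro mult_right_mono) auto
  then have 1: "\<bar>f s / (s - a) powr \<alpha>\<bar> \<le> \<bar>f a\<bar> * (s - a) powr (- \<alpha>) + F * (s - a) powr (\<nu> - \<alpha>)"
    using assms by (simp add: algebra_simps powr_minus powr_diff divide_inverse abs_mult)
  have "\<bar>\<alpha> * ?I\<bar> \<le> \<alpha> * (F * (s - a) powr (\<nu> - \<alpha>) / (\<nu> - \<alpha>))"
    unfolding abs_mult using weyl_left_integrand(2)[OF f assms(2,4,5)] assms(2)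
    by (simp only: abs_of_pos mult_left_mono less_imp_le)
  also have "\<dots> = F * (\<alpha> / (\<nu> - \<alpha>)) * (s - a) powr (\<nu> - \<alpha>)"
    by simp
  finally have "\<bar>f s / (s - a) powr \<alpha> + \<alpha> * ?I\<bar> \<le> \<bar>f a\<bar> * (s - a) powr (- \<alpha>)
      + F * (1 + \<alpha> / (\<nu> - \<alpha>)) * (s - a) powr (\<nu> - \<alpha>)"
    using 1 by (auto simp: algebra_simps intro: order_trans[OF abs_triangle_ineq])
  then show ?thesis
    unfolding weyl_left_def using G by (auto simp: abs_divide intro!: divide_right_mono)
qed

lemma weyl_left_tendsto:
  assumes f: "\<And>n. holder_bound F \<nu> (f n)" and f': "holder_bound F \<nu> f'"
    and lim: "\<And>x. (\<lambda>n. f n x) \<longlonglongrightarrow> f' x" and "0 < \<alpha>" "\<alpha> < 1" "\<alpha> < \<nu>" "a < s"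
  shows "(\<lambda>n. weyl_left \<alpha> a (f n) s) \<longlonglongrightarrow> weyl_left \<alpha> a f' s"
proof -
  have [measurable]: "f n \<in> borel_measurable borel" for n
    using assms by (intro holder_bound_measurable[OF f]) auto
  have [measurable]: "f' \<in> borel_measurable borel"
    using assms by (intro holder_bound_measurable[OF f']) auto
  have "set_integrable lborel {a<..<s} (\<lambda>u. F * (s - u) powr (\<nu> - \<alpha> - 1))"
    using assms by (intro set_integrable_mult_right powr_integral_right) auto
  then have "(\<lambda>n. LBINT u:{a<..<s}. (f n s - f n u) / (s - u) powr (\<alpha> + 1))
      \<longlonglongrightarrow> (LBINT u:{a<..<s}. (f' s - f' u) / (s - u) powr (\<alpha> + 1))"
  proof (rule set_integral_tendsto)
    fix n u assume u: "u \<in> {a<..<s}"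
    have "\<bar>f n s - f n u\<bar> \<le> F * (s - u) powr \<nu>"
      using holder_boundD[OF f, of n s u] u by simp
    then have "\<bar>f n s - f n u\<bar> / (s - u) powr (\<alpha> + 1) \<le> F * (s - u) powr \<nu> / (s - u) powr (\<alpha> + 1)"
      by (intro divide_right_mono) auto
    then show "\<bar>(f n s - f n u) / (s - u) powr (\<alpha> + 1)\<bar> \<le> F * (s - u) powr (\<nu> - \<alpha> - 1)"
      using powr_diff[of "s - u" \<nu> "\<alpha> + 1"] by (simp add: abs_divide diff_diff_eq)
    show "(\<lambda>n. (f n s - f n u) / (s - u) powr (\<alpha> + 1)) \<longlonglongrightarrow> (f' s - f' u) / (s - u) powr (\<alpha> + 1)"
      using u by (intro tendsto_intros lim) auto
  qed auto
  moreover have "Gamma (1 - \<alpha>) \<noteq> 0"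
    using Gamma_real_pos[of "1 - \<alpha>"] assms by linarith
  moreover have "(s - a) powr \<alpha> \<noteq> 0"
    using assms by simp
  ultimately show ?thesis
    unfolding weyl_left_def by (intro tendsto_intros lim)
qed

lemma weyl_left_by_parts:
  fixes f f' :: "real \<Rightarrow> real"
  assumes f: "holder_bound F \<nu> f" and deriv: "\<And>x. DERIV f x :> f' x" and cont: "\<And>x. isCont f' x"
    and "0 < \<alpha>" "\<alpha> < 1" "\<alpha> < \<nu>" "a < s"
  shows "weyl_left \<alpha> a f s * Gamma (1 - \<alpha>)
    = f a * (s - a) powr (- \<alpha>) + (LBINT u:{a<..<s}. f' u * (s - u) powr (- \<alpha>))"
proof -
  have "bounded (f' ` {a..s})"
    using cont by (intro compact_imp_bounded compact_continuous_image continuous_at_imp_continuous_on) auto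
  then obtain c where c: "\<And>x. x \<in> {a..s} \<Longrightarrow> \<bar>f' x\<bar> \<le> c"
    by (metis bounded_iff imageI real_norm_def)
  have [measurable]: "f' \<in> borel_measurable borel"
    using cont by (intro borel_measurable_continuous_onI continuous_at_imp_continuous_on) auto
  have int1: "set_integrable lborel {a<..<s} (\<lambda>u. f' u * (s - u) powr (- \<alpha>))"
  proof (rule set_integral_dominated(1))
    show "set_integrable lborel {a<..<s} (\<lambda>u. c * (s - u) powr (- \<alpha>))"
      using assms by (intro set_integrable_mult_right powr_integral_right) auto
    show "\<bar>f' u * (s - u) powr (- \<alpha>)\<bar> \<le> c * (s - u) powr (- \<alpha>)" if "u \<in> {a<..<s}" for u
      using c[of u] that by (auto simp: abs_mult intro!: mult_right_mono)
  qed auto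
  note int2 = weyl_left_integrand(1)[OF f assms(4,6,7)]
  have int3: "set_integrable lborel {a<..<s} (\<lambda>u. \<alpha> * ((f s - f u) / (s - u) powr (\<alpha> + 1)))"
    using int2 by (rule set_integrable_mult_right)
  let ?F = "\<lambda>u. (f s - f u) * (s - u) powr (- \<alpha>)"
  let ?F' = "\<lambda>u. \<alpha> * ((f s - f u) / (s - u) powr (\<alpha> + 1)) - f' u * (s - u) powr (- \<alpha>)"
  have "(LBINT u=a..s. ?F' u) = 0 - (f s - f a) * (s - a) powr (- \<alpha>)"
  proof (rule interval_integral_FTC_integrable)
    fix u assume u: "ereal a < ereal u" "ereal u < ereal s"
    have "DERIV ?F u :> - f' u * (s - u) powr (- \<alpha>) + (f s - f u) * (- (- \<alpha> * (s - u) powr (- \<alpha> - 1)))"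
      using u by (auto intro!: derivative_eq_intros deriv)
    moreover have "(s - u) powr (- \<alpha> - 1) = 1 / (s - u) powr (\<alpha> + 1)"
      by (metis minus_add_distrib powr_minus_divide uminus_add_conv_diff add.commute)
    ultimately show "(?F has_vector_derivative ?F' u) (at u)"
      by (simp add: has_real_derivative_iff_has_vector_derivative[symmetric] algebra_simps)
    have "isCont f u"
      using deriv DERIV_isCont by blast
    then show "isCont ?F' u"
      using u cont by (intro continuous_intros) auto
  next
    show "set_integrable lborel (einterval (ereal a) (ereal s)) ?F'"
      unfolding einterval_eq by (rule set_integral_diff(1)[OF int3 int1])
    have "isCont f a"
      using deriv DERIV_isCont by blast
    then have "isCont ?F a"
      using assms by (intro continuous_intros) auto
    then have "(?F \<longlongrightarrow> (f s - f a) * (s - a) powr (- \<alpha>)) (at_right a)"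
      unfolding isCont_def by (rule filterlim_mono) (simp_all add: at_le)
    then show "((?F \<circ> real_of_ereal) \<longlongrightarrow> (f s - f a) * (s - a) powr (- \<alpha>)) (at_right (ereal a))"
      by (simp add: ereal_tendsto_simps)
    have "((\<lambda>u. s - u) \<longlongrightarrow> s - s) (at_left s)"
      by (intro tendsto_intros)
    then have "((\<lambda>u. F * (s - u) powr (\<nu> - \<alpha>)) \<longlongrightarrow> F * 0 powr (\<nu> - \<alpha>)) (at_left s)"
      using assms by (intro tendsto_mult tendsto_const tendsto_powr2) (auto simp: eventually_at_filter)
    moreover have "\<forall>\<^sub>F u in at_left s. norm (?F u) \<le> F * (s - u) powr (\<nu> - \<alpha>)"
      unfolding eventually_at_filter
    proof (intro always_eventually allI impI)
      fix u assume "u \<in> {..<s}"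
      then have "\<bar>f s - f u\<bar> * (s - u) powr (- \<alpha>) \<le> F * (s - u) powr \<nu> * (s - u) powr (- \<alpha>)"
        using holder_boundD[OF f, of s u] by (intro mult_right_mono) auto
      then show "norm (?F u) \<le> F * (s - u) powr (\<nu> - \<alpha>)"
        by (simp add: abs_mult mult.assoc flip: powr_add)
    qed
    ultimately have "(?F \<longlongrightarrow> 0) (at_left s)"
      using Lim_null_comparison[of ?F "\<lambda>u. F * (s - u) powr (\<nu> - \<alpha>)" "at_left s"] by simp
    then show "((?F \<circ> real_of_ereal) \<longlongrightarrow> 0) (at_left (ereal s))"
      by (simp add: ereal_tendsto_simps)
  qed (use assms in auto)
  then have "(LBINT u:{a<..<s}. ?F' u) = - ((f s - f a) * (s - a) powr (- \<alpha>))"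
    using assms by (simp add: interval_integral_Ioo)
  then have "\<alpha> * (LBINT u:{a<..<s}. (f s - f u) / (s - u) powr (\<alpha> + 1))
      = (LBINT u:{a<..<s}. f' u * (s - u) powr (- \<alpha>)) - (f s - f a) * (s - a) powr (- \<alpha>)"
    unfolding set_integral_diff(2)[OF int3 int1] set_integral_mult_right by linarith
  moreover have "Gamma (1 - \<alpha>) \<noteq> 0"
    using Gamma_real_pos[of "1 - \<alpha>"] assms by linarith
  ultimately show ?thesis
    unfolding weyl_left_def powr_minus_divide[of "s - a"] by (simp add: left_diff_distrib diff_divide_distrib)
qed

lemma fubini_triangle:
  fixes k :: "real \<Rightarrow> real \<Rightarrow> real"
  assumes "a < b" "-1 < p" "-1 < q"
    and [measurable]: "(\<lambda>(s, v). k s v) \<in> borel_measurable (borel \<Otimes>\<^sub>M borel)"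
    and k: "\<And>s v. a < s \<Longrightarrow> s < v \<Longrightarrow> v < b \<Longrightarrow> \<bar>k s v\<bar> \<le> c * (s - a) powr p * (v - s) powr q"
  shows "set_integrable lborel {a<..<b} (\<lambda>s. LBINT v:{s<..<b}. k s v)"
    and "set_integrable lborel {a<..<b} (\<lambda>v. LBINT s:{a<..<v}. k s v)"
    and "(LBINT s:{a<..<b}. LBINT v:{s<..<b}. k s v) = (LBINT v:{a<..<b}. LBINT s:{a<..<v}. k s v)"
proof -
  define h where "h = (\<lambda>(s, v). if a < s \<and> s < v \<and> v < b then k s v else 0)"
  have h_meas [measurable]: "h \<in> borel_measurable (lborel \<Otimes>\<^sub>M lborel)"
    unfolding h_def by measurable
  have c: "0 \<le> c"
  proof -
    let ?s = "(2 * a + b) / 3" and ?v = "(a + 2 * b) / 3"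
    have "a < ?s" "?s < ?v" "?v < b"
      using assms(1) by (auto simp: field_simps)
    moreover from this have "0 < (?s - a) powr p * (?v - ?s) powr q"
      by auto
    moreover from calculation have "0 \<le> c * ((?s - a) powr p * (?v - ?s) powr q)"
      using k[of ?s ?v] by (simp add: mult.assoc)
    ultimately show ?thesis
      by (metis not_le mult_neg_pos)
  qed
  define \<kappa> where "\<kappa> = c * (b - a) powr (q + 1) / (q + 1)"
  have \<kappa>: "0 \<le> \<kappa>"
    using c assms by (simp add: \<kappa>_def)
  have h1: "h (s, v) = indicator {a<..<b} s * (indicator {s<..<b} v *\<^sub>R k s v)" for s v
    by (auto simp: h_def indicator_def)
  have h2: "h (s, v) = indicator {a<..<b} v * (indicator {a<..<v} s *\<^sub>R k s v)" for s v
    by (auto simp: h_def indicator_def)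
  have k_meas: "k s \<in> borel_measurable borel" for s
    by measurable
  have inner: "set_integrable lborel {s<..<b} (k s)"
    and inner_abs: "(LBINT v:{s<..<b}. \<bar>k s v\<bar>) \<le> \<kappa> * (s - a) powr p"
    if "a < s" "s < b" for s
  proof -
    have 1: "set_integrable lborel {s<..<b} (\<lambda>v. c * (s - a) powr p * (v - s) powr q)"
      using that assms by (intro set_integrable_mult_right powr_integral_left) auto
    note 2 = set_integral_dominated[OF 1, of "k s"] 
    show "set_integrable lborel {s<..<b} (k s)"
      using k[of s] that k_meas by (intro 2) auto
    have "(LBINT v:{s<..<b}. \<bar>k s v\<bar>) \<le> (LBINT v:{s<..<b}. c * (s - a) powr p * (v - s) powr q)"
      using k[of s] that k_meas 1 
      by (intro set_integral_mono set_integrable_abs set_integral_dominated[OF 1, of "k s"]) auto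
    also have "\<dots> = c * (s - a) powr p * ((b - s) powr (q + 1) / (q + 1))"
      using that assms by (simp add: powr_integral_left)
    also have "\<dots> \<le> c * (s - a) powr p * ((b - a) powr (q + 1) / (q + 1))"
      using that assms c by (intro mult_left_mono divide_right_mono powr_mono2) auto
    finally show "(LBINT v:{s<..<b}. \<bar>k s v\<bar>) \<le> \<kappa> * (s - a) powr p"
      by (simp add: \<kappa>_def mult_ac)
  qed
  have h: "integrable (lborel \<Otimes>\<^sub>M lborel) h"
  proof (rule lborel_pair.Fubini_integrable)
    have "set_integrable lborel {a<..<b} (\<lambda>s. \<kappa> * (s - a) powr p)"
      using assms by (intro set_integrable_mult_right powr_integral_left) auto
    then show "integrable lborel (\<lambda>s. \<integral>v. norm (h (s, v)) \<partial>lborel)"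
      unfolding set_integrable_def
    proof (rule Bochner_Integration.integrable_bound)
      show "(\<lambda>s. \<integral>v. norm (h (s, v)) \<partial>lborel) \<in> borel_measurable lborel"
        by measurable
      show "AE s in lborel. norm (\<integral>v. norm (h (s, v)) \<partial>lborel)
          \<le> norm (indicat_real {a<..<b} s *\<^sub>R (\<kappa> * (s - a) powr p))"
      proof (rule AE_I2)
        fix s
        have "(\<integral>v. norm (h (s, v)) \<partial>lborel) = indicator {a<..<b} s * (LBINT v:{s<..<b}. \<bar>k s v\<bar>)"
          unfolding h1 set_lebesgue_integral_def by (simp add: abs_mult mult.assoc)
        moreover have "0 \<le> (\<integral>v. norm (h (s, v)) \<partial>lborel)"
          by simp
        ultimately show "norm (\<integral>v. norm (h (s, v)) \<partial>lborel)
          \<le> norm (indicat_real {a<..<b} s *\<^sub>R (\<kappa> * (s - a) powr p))"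
          using inner_abs[of s] \<kappa> by (auto simp: indicator_def abs_mult split: if_splits)
      qed
    qed
    show "AE s in lborel. integrable lborel (\<lambda>v. h (s, v))"
    proof (rule AE_I2)
      fix s
      show "integrable lborel (\<lambda>v. h (s, v))"
        unfolding h1 using inner[of s]
        by (cases "s \<in> {a<..<b}") (auto simp: set_integrable_def)
    qed
  qed simp
  have s_eq: "(\<integral>v. h (s, v) \<partial>lborel) = indicator {a<..<b} s *\<^sub>R (LBINT v:{s<..<b}. k s v)" for s
    unfolding h1 set_lebesgue_integral_def by simp
  have v_eq: "(\<integral>s. h (s, v) \<partial>lborel) = indicator {a<..<b} v *\<^sub>R (LBINT s:{a<..<v}. k s v)" for v
    unfolding h2 set_lebesgue_integral_def by simp
  show "set_integrable lborel {a<..<b} (\<lambda>s. LBINT v:{s<..<b}. k s v)"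
    using lborel_pair.integrable_fst'[OF h] unfolding s_eq set_integrable_def .
  have h': "integrable (lborel \<Otimes>\<^sub>M lborel) (\<lambda>(s, v). h (s, v))"
    using h by simp
  show "set_integrable lborel {a<..<b} (\<lambda>v. LBINT s:{a<..<v}. k s v)"
    using lborel_pair.integrable_snd[OF h'] unfolding v_eq set_integrable_def .
  show "(LBINT s:{a<..<b}. LBINT v:{s<..<b}. k s v) = (LBINT v:{a<..<b}. LBINT s:{a<..<v}. k s v)"
    using lborel_pair.Fubini_integral[OF h'] 
    unfolding s_eq v_eq set_lebesgue_integral_def[of lborel "{a<..<b}"] by simp
qed

lemma weyl_right_reflect:
  assumes "a < s" "s < b"
  shows "weyl_right \<gamma> b (shift_right a b g) s = weyl_left \<gamma> (- b) (\<lambda>x. g (- x) - g b) (- s)"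
proof -
  have "(LBINT u:{s<..<b}. (shift_right a b g s - shift_right a b g u) / (u - s) powr (\<gamma> + 1))
      = (LBINT u:{-b<..<-s}. (shift_right a b g s - shift_right a b g (- u)) / (- u - s) powr (\<gamma> + 1))"
    by (rule set_integral_reflect)
  also have "\<dots> = (LBINT u:{-b<..<-s}. ((g s - g b) - (g (- u) - g b)) / (- s - u) powr (\<gamma> + 1))"
  proof (intro set_lebesgue_integral_cong allI impI)
    fix u assume "u \<in> {-b<..<-s}"
    then have "a < - u" "- u < b"
      using assms by auto
    moreover have eq: "- u - s = - s - u"
      by simp
    ultimately show "(shift_right a b g s - shift_right a b g (- u)) / (- u - s) powr (\<gamma> + 1)
        = ((g s - g b) - (g (- u) - g b)) / (- s - u) powr (\<gamma> + 1)"
      unfolding eq using assms by (simp add: shift_right_def)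
  qed auto
  finally show ?thesis
    unfolding weyl_right_def weyl_left_def using assms by (simp add: shift_right_def)
qed

text \<open>The right-sided derivative of order \<open>1 - \<alpha>\<close> of \<open>g - g b\<close>, reflected to a left-sided one.\<close>

abbreviation weyl_mirror :: "real \<Rightarrow> real \<Rightarrow> (real \<Rightarrow> real) \<Rightarrow> real \<Rightarrow> real" where
  "weyl_mirror \<alpha> b g s \<equiv> weyl_left (1 - \<alpha>) (- b) (\<lambda>x. g (- x) - g b) (- s)"

lemma pathwise_integral_reflect:
  "pathwise_integral \<alpha> a b f g
    = - (LBINT s:{a<..<b}. weyl_left \<alpha> a f s * weyl_mirror \<alpha> b g s)"
  unfolding pathwise_integral_def
  by (intro arg_cong[where f = uminus] set_lebesgue_integral_cong) (auto simp: weyl_right_reflect)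

lemma holder_bound_reflect:
  assumes "holder_bound G \<theta> g"
  shows "holder_bound G \<theta> (\<lambda>x. g (- x) - c)"
  unfolding holder_bound_def
proof (intro allI)
  fix s t
  show "\<bar>(g (- t) - c) - (g (- s) - c)\<bar> \<le> G * \<bar>t - s\<bar> powr \<theta>"
    using holder_boundD[OF assms, of "- t" "- s"] by (simp add: abs_minus_commute)
qed

lemma set_integral_minus:
  fixes f :: "real \<Rightarrow> real"
  shows "(LBINT x:A. - f x) = - (LBINT x:A. f x)"
  unfolding set_lebesgue_integral_def by simp

lemma bounded_on_interval:
  fixes f :: "real \<Rightarrow> real"
  assumes "\<And>x. isCont f x"
  obtains c where "0 \<le> c" "\<And>x. x \<in> {a..b} \<Longrightarrow> \<bar>f x\<bar> \<le> c"
proof -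
  have "bounded (f ` {a..b})"
    using assms by (intro compact_imp_bounded compact_continuous_image continuous_at_imp_continuous_on) auto
  then obtain c where "\<And>x. x \<in> {a..b} \<Longrightarrow> \<bar>f x\<bar> \<le> c"
    by (metis bounded_iff imageI real_norm_def)
  then show ?thesis
    using that[of "max 0 c"] by (metis max.cobounded1 max.coboundedI2)
qed

lemma set_integral_deriv:
  fixes g g' :: "real \<Rightarrow> real"
  assumes "a \<le> b" "\<And>x. DERIV g x :> g' x" "\<And>x. isCont g' x"
  shows "(LBINT x:{a<..<b}. g' x) = g b - g a"
proof -
  have "(LBINT x=a..b. g' x) = g b - g a"
  proof (rule interval_integral_FTC_finite)
    show "continuous_on {min a b..max a b} g'"
      using assms(3) by (intro continuous_at_imp_continuous_on) auto
    show "(g has_vector_derivative g' x) (at x within {min a b..max a b})" for x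
      by (rule has_vector_derivative_at_within)
         (rule assms(2)[of x, unfolded has_real_derivative_iff_has_vector_derivative])
  qed
  then show ?thesis
    using assms(1) by (simp add: interval_integral_Ioo)
qed

lemma weyl_right_bound:
  assumes g: "holder_bound G \<theta> g" and "0 < \<alpha>" "\<alpha> < 1" "1 - \<alpha> < \<theta>" "a < s" "s < b"
  shows "\<bar>weyl_mirror \<alpha> b g s\<bar>
    \<le> G * (1 + (1 - \<alpha>) / (\<theta> - (1 - \<alpha>))) * (b - a) powr (\<theta> - (1 - \<alpha>)) / Gamma \<alpha>"
proof -
  have G: "0 \<le> G" "0 < Gamma \<alpha>"
    using holder_bound_nonneg[OF g] assms by (auto intro: Gamma_real_pos)
  have "\<bar>weyl_mirror \<alpha> b g s\<bar>
      \<le> G * (1 + (1 - \<alpha>) / (\<theta> - (1 - \<alpha>))) * (b - s) powr (\<theta> - (1 - \<alpha>)) / Gamma \<alpha>"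
    using weyl_left_bound[OF holder_bound_reflect[OF g, of "g b"], of "1 - \<alpha>" "- b" "- s"] assms by simp
  also have "\<dots> \<le> G * (1 + (1 - \<alpha>) / (\<theta> - (1 - \<alpha>))) * (b - a) powr (\<theta> - (1 - \<alpha>)) / Gamma \<alpha>"
    using G assms by (intro divide_right_mono mult_left_mono powr_mono2 mult_nonneg_nonneg) auto
  finally show ?thesis .
qed

lemma weyl_right_by_parts:
  assumes g: "holder_bound G \<theta> g" and deriv: "\<And>x. DERIV g x :> g' x" and cont: "\<And>x. isCont g' x"
    and "0 < \<alpha>" "\<alpha> < 1" "1 - \<alpha> < \<theta>" "s < b"
  shows "weyl_mirror \<alpha> b g s * Gamma \<alpha>
    = - (LBINT v:{s<..<b}. g' v * (v - s) powr (\<alpha> - 1))"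
proof -
  have "weyl_mirror \<alpha> b g s * Gamma (1 - (1 - \<alpha>))
      = (g (- (- b)) - g b) * (- s - - b) powr (- (1 - \<alpha>))
        + (LBINT u:{-b<..<-s}. - g' (- u) * (- s - u) powr (- (1 - \<alpha>)))"
  proof (rule weyl_left_by_parts[OF holder_bound_reflect[OF g]])
    show "((\<lambda>x. g (- x) - g b) has_real_derivative - g' (- x)) (at x)" for x
      by (auto intro!: derivative_eq_intros DERIV_chain'[OF _ deriv])
    show "isCont (\<lambda>x. - g' (- x)) x" for x
      by (intro continuous_intros isCont_o2[OF _ cont])
  qed (use assms in auto)
  also have "(LBINT u:{-b<..<-s}. - g' (- u) * (- s - u) powr (- (1 - \<alpha>)))
      = - (LBINT v:{s<..<b}. g' v * (v - s) powr (\<alpha> - 1))"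
    unfolding set_integral_reflect[of s b] set_integral_minus[symmetric]
    by (simp add: minus_diff_commute)
  finally show ?thesis
    by simp
qed

lemma abel_weyl_right:
  assumes g: "holder_bound G \<theta> g" and deriv: "\<And>x. DERIV g x :> g' x" and cont: "\<And>x. isCont g' x"
    and "0 < \<alpha>" "\<alpha> < 1" "1 - \<alpha> < \<theta>" "u < b"
  shows "(LBINT s:{u<..<b}. (s - u) powr (- \<alpha>) * (weyl_mirror \<alpha> b g s * Gamma \<alpha>))
    = - (Gamma \<alpha> * Gamma (1 - \<alpha>) * (g b - g u))"
proof -
  have [measurable]: "g' \<in> borel_measurable borel"
    using cont by (intro borel_measurable_continuous_onI continuous_at_imp_continuous_on) auto
  obtain c where c: "0 \<le> c" "\<And>x. x \<in> {u..b} \<Longrightarrow> \<bar>g' x\<bar> \<le> c"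
    using bounded_on_interval[OF cont] by metis
  let ?k = "\<lambda>s v. (s - u) powr (- \<alpha>) * (g' v * (v - s) powr (\<alpha> - 1))"
  have "(LBINT s:{u<..<b}. (s - u) powr (- \<alpha>) * (weyl_mirror \<alpha> b g s * Gamma \<alpha>))
      = (LBINT s:{u<..<b}. - (LBINT v:{s<..<b}. ?k s v))"
    using assms
    by (intro set_lebesgue_integral_cong allI impI)
      (auto simp: weyl_right_by_parts[OF g deriv cont])
  also have "\<dots> = - (LBINT s:{u<..<b}. LBINT v:{s<..<b}. ?k s v)"
    by (rule set_integral_minus)
  also have "(LBINT s:{u<..<b}. LBINT v:{s<..<b}. ?k s v) = (LBINT v:{u<..<b}. LBINT s:{u<..<v}. ?k s v)"
  proof (rule fubini_triangle)
    show "(\<lambda>(s, v). ?k s v) \<in> borel_measurable (borel \<Otimes>\<^sub>M borel)"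
      by measurable
    fix s v assume "u < s" "s < v" "v < b"
    then show "\<bar>?k s v\<bar> \<le> c * (s - u) powr (- \<alpha>) * (v - s) powr (\<alpha> - 1)"
      using c(2)[of v] by (auto simp: abs_mult mult_ac intro!: mult_left_mono)
  qed (use assms in auto)
  also have "\<dots> = (LBINT v:{u<..<b}. Gamma \<alpha> * Gamma (1 - \<alpha>) * g' v)"
  proof (intro set_lebesgue_integral_cong allI impI)
    fix v assume "v \<in> {u<..<b}"
    then have "(LBINT s:{u<..<v}. (s - u) powr (- \<alpha>) * (v - s) powr (\<alpha> - 1)) = Gamma \<alpha> * Gamma (1 - \<alpha>)"
      using beta_integral(2)[of u v "1 - \<alpha>" \<alpha>] assms by (simp add: Beta_def mult.commute)
    moreover have "(LBINT s:{u<..<v}. ?k s v) = g' v * (LBINT s:{u<..<v}. (s - u) powr (- \<alpha>) * (v - s) powr (\<alpha> - 1))"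
      by (subst set_integral_mult_right[symmetric]) (simp add: mult_ac)
    ultimately show "(LBINT s:{u<..<v}. ?k s v) = Gamma \<alpha> * Gamma (1 - \<alpha>) * g' v"
      by simp
  qed auto
  also have "\<dots> = Gamma \<alpha> * Gamma (1 - \<alpha>) * (g b - g u)"
    using set_integral_deriv[of u b g g'] assms by simp
  finally show ?thesis .
qed

text \<open>
  A \<open>C\<^sup>1\<close> integrand is the superposition \<open>f a + (\<integral>u. f' u * indicator {u<..<b})\<close>, and the left-sided
  derivative of such an indicator is that of the constant 1 started at \<open>u\<close>.
\<close>

lemma pathwise_integral_C1:
  assumes f: "holder_bound F \<nu> f" and f_deriv: "\<And>x. DERIV f x :> f' x" and f_cont: "\<And>x. isCont f' x"
    and g: "holder_bound G \<theta> g" and g_deriv: "\<And>x. DERIV g x :> g' x" and g_cont: "\<And>x. isCont g' x"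
    and \<alpha>: "0 < \<alpha>" "\<alpha> < 1" "\<alpha> < \<nu>" "1 - \<alpha> < \<theta>" and ab: "a < b"
  shows "pathwise_integral \<alpha> a b f g = f a * (g b - g a) + (LBINT u:{a<..<b}. f' u * (g b - g u))"
proof -
  define D where "D = (\<lambda>s. weyl_mirror \<alpha> b g s * Gamma \<alpha>)"
  define c\<^sub>D where "c\<^sub>D = G * (1 + (1 - \<alpha>) / (\<theta> - (1 - \<alpha>))) * (b - a) powr (\<theta> - (1 - \<alpha>))"
  have \<Gamma>: "0 < Gamma \<alpha>" "0 < Gamma (1 - \<alpha>)"
    using \<alpha> by (auto intro: Gamma_real_pos)
  have [measurable]: "f' \<in> borel_measurable borel"
    using f_cont by (intro borel_measurable_continuous_onI continuous_at_imp_continuous_on) auto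
  have [measurable]: "g \<in> borel_measurable borel"
    using \<alpha> by (intro holder_bound_measurable[OF g]) auto
  have [measurable]: "D \<in> borel_measurable borel"
    unfolding D_def by (intro borel_measurable_times measurable_compose[OF _ weyl_left_measurable]) auto
  have D: "\<bar>D s\<bar> \<le> c\<^sub>D" if "a < s" "s < b" for s
    using weyl_right_bound[OF g \<alpha>(1,2,4) that] \<Gamma>
    unfolding D_def c\<^sub>D_def abs_mult by (simp add: pos_le_divide_eq)
  obtain c where c: "0 \<le> c" "\<And>x. x \<in> {a..b} \<Longrightarrow> \<bar>f' x\<bar> \<le> c"
    using bounded_on_interval[OF f_cont] by metis
  let ?k = "\<lambda>u s. f' u * ((s - u) powr (- \<alpha>) * D s)"
  have k_bound: "\<bar>?k u s\<bar> \<le> c * c\<^sub>D * (u - a) powr 0 * (s - u) powr (- \<alpha>)" if "a < u" "u < s" "s < b" for u s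
  proof -
    have "\<bar>f' u\<bar> * \<bar>D s\<bar> \<le> c * c\<^sub>D"
      using c D[of s] that by (intro mult_mono) auto
    then have "\<bar>f' u\<bar> * \<bar>D s\<bar> * (s - u) powr (- \<alpha>) \<le> c * c\<^sub>D * (s - u) powr (- \<alpha>)"
      by (intro mult_right_mono) auto
    then show ?thesis
      using that by (simp add: abs_mult mult_ac)
  qed
  have k_meas: "(\<lambda>(u, s). ?k u s) \<in> borel_measurable (borel \<Otimes>\<^sub>M borel)"
    by measurable
  note fubini = fubini_triangle[of a b 0 "- \<alpha>" ?k, OF ab _ _ k_meas k_bound]
  have int1: "set_integrable lborel {a<..<b} (\<lambda>s. (s - a) powr (- \<alpha>) * D s)"
  proof (rule set_integral_dominated(1))
    show "set_integrable lborel {a<..<b} (\<lambda>s. c\<^sub>D * (s - a) powr (- \<alpha>))"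
      using ab \<alpha> by (intro set_integrable_mult_right powr_integral_left) auto
    show "\<bar>(s - a) powr (- \<alpha>) * D s\<bar> \<le> c\<^sub>D * (s - a) powr (- \<alpha>)" if "s \<in> {a<..<b}" for s
      using D[of s] that by (auto simp: abs_mult mult.commute[of c\<^sub>D] intro!: mult_left_mono)
  qed auto
  have int2: "set_integrable lborel {a<..<b} (\<lambda>s. LBINT u:{a<..<s}. ?k u s)"
    using \<alpha> by (intro fubini(2)) auto
  have "Gamma \<alpha> * Gamma (1 - \<alpha>) * pathwise_integral \<alpha> a b f g
      = - (LBINT s:{a<..<b}. (weyl_left \<alpha> a f s * Gamma (1 - \<alpha>)) * D s)"
    unfolding pathwise_integral_reflect D_def
    by (simp add: mult_ac flip: set_integral_mult_right)
  also have "(LBINT s:{a<..<b}. (weyl_left \<alpha> a f s * Gamma (1 - \<alpha>)) * D s)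
      = (LBINT s:{a<..<b}. f a * ((s - a) powr (- \<alpha>) * D s) + (LBINT u:{a<..<s}. ?k u s))"
  proof (intro set_lebesgue_integral_cong allI impI)
    fix s assume "s \<in> {a<..<b}"
    then have "(weyl_left \<alpha> a f s * Gamma (1 - \<alpha>)) * D s
        = f a * ((s - a) powr (- \<alpha>) * D s) + (LBINT u:{a<..<s}. f' u * (s - u) powr (- \<alpha>)) * D s"
      using weyl_left_by_parts[OF f f_deriv f_cont \<alpha>(1-3), of a s] by (simp add: algebra_simps)
    also have "(LBINT u:{a<..<s}. f' u * (s - u) powr (- \<alpha>)) * D s = (LBINT u:{a<..<s}. ?k u s)"
      by (simp add: mult.assoc flip: set_integral_mult_left)
    finally show "(weyl_left \<alpha> a f s * Gamma (1 - \<alpha>)) * D s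
        = f a * ((s - a) powr (- \<alpha>) * D s) + (LBINT u:{a<..<s}. ?k u s)" .
  qed auto
  also have "\<dots> = f a * (LBINT s:{a<..<b}. (s - a) powr (- \<alpha>) * D s)
      + (LBINT s:{a<..<b}. LBINT u:{a<..<s}. ?k u s)"
    using set_integral_add(2)[OF set_integrable_mult_right[OF int1] int2, of "f a"] by simp
  also have "(LBINT s:{a<..<b}. (s - a) powr (- \<alpha>) * D s) = - (Gamma \<alpha> * Gamma (1 - \<alpha>) * (g b - g a))"
    unfolding D_def by (rule abel_weyl_right[OF g g_deriv g_cont \<alpha>(1,2,4) ab])
  also have "(LBINT s:{a<..<b}. LBINT u:{a<..<s}. ?k u s) = (LBINT u:{a<..<b}. LBINT s:{u<..<b}. ?k u s)"
    using \<alpha> by (intro fubini(3)[symmetric]) auto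
  also have "\<dots> = (LBINT u:{a<..<b}. - (Gamma \<alpha> * Gamma (1 - \<alpha>)) * (f' u * (g b - g u)))"
  proof (intro set_lebesgue_integral_cong allI impI)
    fix u assume "u \<in> {a<..<b}"
    then show "(LBINT s:{u<..<b}. ?k u s) = - (Gamma \<alpha> * Gamma (1 - \<alpha>)) * (f' u * (g b - g u))"
      using abel_weyl_right[OF g g_deriv g_cont \<alpha>(1,2,4), of u b] unfolding D_def by simp
  qed auto
  also have "\<dots> = - (Gamma \<alpha> * Gamma (1 - \<alpha>)) * (LBINT u:{a<..<b}. f' u * (g b - g u))"
    by (rule set_integral_mult_right)
  finally have "Gamma \<alpha> * Gamma (1 - \<alpha>) * pathwise_integral \<alpha> a b f g
      = Gamma \<alpha> * Gamma (1 - \<alpha>) * (f a * (g b - g a) + (LBINT u:{a<..<b}. f' u * (g b - g u)))"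
    by (simp add: algebra_simps)
  then show ?thesis
    using \<Gamma> by (simp del: mult_cancel_left add: mult_cancel_left[of "Gamma \<alpha> * Gamma (1 - \<alpha>)"])
qed

lemma mollify:
  assumes f: "holder_bound F \<nu> f" and "0 < \<nu>"
  obtains fn fn' :: "nat \<Rightarrow> real \<Rightarrow> real"
  where "\<And>n. holder_bound F \<nu> (fn n)" "\<And>n x. DERIV (fn n) x :> fn' n x" "\<And>n x. isCont (fn' n) x"
    "\<And>x. (\<lambda>n. fn n x) \<longlonglongrightarrow> f x"
proof -
  have cont: "isCont f x" for x
    by (rule holder_bound_isCont[OF assms])
  obtain P where P: "\<And>x. (P has_vector_derivative f x) (at x)"
    using einterval_antiderivative[of "-\<infinity>" "\<infinity>" f] cont by auto
  then have P: "DERIV P x :> f x" for x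
    by (simp add: has_real_derivative_iff_has_vector_derivative)
  define h where "h = (\<lambda>n. inverse (real (Suc n)))"
  have h: "0 < h n" for n
    by (simp add: h_def)
  define fn where "fn = (\<lambda>n x. (P (x + h n) - P x) / h n)"
  define fn' where "fn' = (\<lambda>n x. (f (x + h n) - f x) / h n)"
  have mean: "\<exists>\<xi>. x < \<xi> \<and> \<xi> < x + h n \<and> fn n x = f \<xi>" for n x
  proof -
    obtain \<xi> where "x < \<xi>" "\<xi> < x + h n" "P (x + h n) - P x = (x + h n - x) * f \<xi>"
      using MVT2[of x "x + h n" P f] P h by auto
    then show ?thesis
      using h[of n] by (auto simp: fn_def intro!: exI[of _ \<xi>])
  qed
  show ?thesis
  proof
    show "holder_bound F \<nu> (fn n)" for n
      unfolding holder_bound_def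
    proof (intro allI)
      fix s t
      define Q where "Q = (\<lambda>x. P (x + (t - s)) - P x)"
      have "DERIV Q x :> f (x + (t - s)) - f x" for x
        unfolding Q_def by (auto intro!: derivative_eq_intros DERIV_chain'[OF _ P])
      then obtain \<xi> where "Q (s + h n) - Q s = (s + h n - s) * (f (\<xi> + (t - s)) - f \<xi>)"
        using MVT2[of s "s + h n" Q "\<lambda>x. f (x + (t - s)) - f x"] h by auto
      moreover have "fn n t - fn n s = (Q (s + h n) - Q s) / h n"
        unfolding fn_def Q_def diff_divide_distrib[symmetric] by (simp add: algebra_simps)
      ultimately have "fn n t - fn n s = f (\<xi> + (t - s)) - f \<xi>"
        using h[of n] by simp
      then show "\<bar>fn n t - fn n s\<bar> \<le> F * \<bar>t - s\<bar> powr \<nu>"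
        using holder_boundD[OF f, of "\<xi> + (t - s)" \<xi>] by simp
    qed
    show "DERIV (fn n) x :> fn' n x" for n x
      unfolding fn_def fn'_def using h[of n]
      by (auto intro!: derivative_eq_intros DERIV_chain'[OF _ P])
    show "isCont (fn' n) x" for n x
      unfolding fn'_def using h[of n]
      by (intro continuous_intros isCont_o2[OF _ cont] cont) auto
    show "(\<lambda>n. fn n x) \<longlonglongrightarrow> f x" for x
    proof -
      have "\<bar>fn n x - f x\<bar> \<le> F * h n powr \<nu>" for n
      proof -
        obtain \<xi> where \<xi>: "x < \<xi>" "\<xi> < x + h n" "fn n x = f \<xi>"
          using mean by blast
        then have "\<bar>fn n x - f x\<bar> \<le> F * \<bar>\<xi> - x\<bar> powr \<nu>"
          using holder_boundD[OF f, of \<xi> x] by simp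
        also have "\<dots> \<le> F * h n powr \<nu>"
          using \<xi> assms(2) holder_bound_nonneg[OF f] by (intro mult_left_mono powr_mono2) auto
        finally show ?thesis .
      qed
      moreover have "(\<lambda>n. F * h n powr \<nu>) \<longlonglongrightarrow> F * 0 powr \<nu>"
        unfolding h_def using assms(2)
        by (intro tendsto_mult tendsto_const tendsto_powr2 LIMSEQ_inverse_real_of_nat) auto
      ultimately have "(\<lambda>n. fn n x - f x) \<longlonglongrightarrow> 0"
        using Lim_null_comparison[of "\<lambda>n. fn n x - f x" "\<lambda>n. F * h n powr \<nu>" sequentially] by simp
      then show ?thesis
        by (simp add: LIM_zero_iff)
    qed
  qed
qed

lemma pathwise_integral_tendsto:
  assumes fn: "\<And>n. holder_bound F \<nu> (fn n)" and f: "holder_bound F \<nu> f" and f_lim: "\<And>x. (\<lambda>n. fn n x) \<longlonglongrightarrow> f x"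
    and gn: "\<And>n. holder_bound G \<theta> (gn n)" and g: "holder_bound G \<theta> g" and g_lim: "\<And>x. (\<lambda>n. gn n x) \<longlonglongrightarrow> g x"
    and \<alpha>: "0 < \<alpha>" "\<alpha> < 1" "\<alpha> < \<nu>" "1 - \<alpha> < \<theta>" and ab: "a < b"
  shows "(\<lambda>n. pathwise_integral \<alpha> a b (fn n) (gn n)) \<longlonglongrightarrow> pathwise_integral \<alpha> a b f g"
proof -
  obtain A where A: "\<And>n. \<bar>fn n a\<bar> \<le> A"
    using convergent_imp_Bseq[OF convergentI[OF f_lim[of a]]] by (metis Bseq_def real_norm_def)
  define c where "c = F * (1 + \<alpha> / (\<nu> - \<alpha>)) * (b - a) powr (\<nu> - \<alpha>)"
  define e where "e = G * (1 + (1 - \<alpha>) / (\<theta> - (1 - \<alpha>))) * (b - a) powr (\<theta> - (1 - \<alpha>)) / Gamma \<alpha>"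
  have \<Gamma>: "0 < Gamma \<alpha>" "0 < Gamma (1 - \<alpha>)"
    using \<alpha> by (auto intro: Gamma_real_pos)
  have F0: "0 \<le> F"
    by (rule holder_bound_nonneg[OF f])
  have left_meas: "weyl_left \<alpha> a h \<in> borel_measurable borel" if "holder_bound F \<nu> h" for h
    using \<alpha> by (intro weyl_left_measurable holder_bound_measurable[OF that]) auto
  have right_meas: "(\<lambda>s. weyl_mirror \<alpha> b h s) \<in> borel_measurable borel"
    if "holder_bound G \<theta> h" for h
  proof -
    have [measurable]: "h \<in> borel_measurable borel"
      using \<alpha> by (intro holder_bound_measurable[OF that]) auto
    show ?thesis
      by (intro measurable_compose[OF _ weyl_left_measurable]) auto
  qed
  have int: "set_integrable lborel {a<..<b} (\<lambda>s. (A * (s - a) powr (- \<alpha>) + c) / Gamma (1 - \<alpha>) * e)"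
  proof -
    have "set_integrable lborel {a<..<b} (\<lambda>s. c * (s - a) powr 0)"
      using ab by (intro set_integrable_mult_right powr_integral_left) auto
    then have "set_integrable lborel {a<..<b} (\<lambda>s. c)"
      by (rule set_integrable_cong[THEN iffD1, rotated -1]) auto
    then show ?thesis
      using ab \<alpha>
      by (intro set_integrable_mult_left set_integrable_divide set_integral_add(1) set_integrable_mult_right
          powr_integral_left) auto
  qed
  show ?thesis
    unfolding pathwise_integral_reflect
  proof (intro tendsto_minus set_integral_tendsto[OF int])
    fix s assume s: "s \<in> {a<..<b}"
    show "(\<lambda>n. weyl_left \<alpha> a (fn n) s * weyl_mirror \<alpha> b (gn n) s)
        \<longlonglongrightarrow> weyl_left \<alpha> a f s * weyl_mirror \<alpha> b g s"
    proof (intro tendsto_mult)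
      show "(\<lambda>n. weyl_left \<alpha> a (fn n) s) \<longlonglongrightarrow> weyl_left \<alpha> a f s"
        using s by (intro weyl_left_tendsto[OF fn f f_lim \<alpha>(1-3)]) auto
      show "(\<lambda>n. weyl_mirror \<alpha> b (gn n) s)
          \<longlonglongrightarrow> weyl_mirror \<alpha> b g s"
        using s \<alpha> by (intro weyl_left_tendsto[OF holder_bound_reflect[OF gn] holder_bound_reflect[OF g]]
            tendsto_diff g_lim) auto
    qed
  next
    fix n s assume s: "s \<in> {a<..<b}"
    have "\<bar>weyl_left \<alpha> a (fn n) s\<bar> \<le> (\<bar>fn n a\<bar> * (s - a) powr (- \<alpha>)
        + F * (1 + \<alpha> / (\<nu> - \<alpha>)) * (s - a) powr (\<nu> - \<alpha>)) / Gamma (1 - \<alpha>)"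
      using s by (intro weyl_left_bound[OF fn \<alpha>(1-3)]) auto
    also have "\<dots> \<le> (A * (s - a) powr (- \<alpha>) + c) / Gamma (1 - \<alpha>)"
      unfolding c_def using \<Gamma> A s F0 \<alpha>
      by (intro divide_right_mono add_mono mult_left_mono mult_right_mono powr_mono2 mult_nonneg_nonneg) auto
    finally have 1: "\<bar>weyl_left \<alpha> a (fn n) s\<bar> \<le> (A * (s - a) powr (- \<alpha>) + c) / Gamma (1 - \<alpha>)" .
    have 2: "\<bar>weyl_mirror \<alpha> b (gn n) s\<bar> \<le> e"
      unfolding e_def using s by (intro weyl_right_bound[OF gn \<alpha>(1,2,4)]) auto
    show "\<bar>weyl_left \<alpha> a (fn n) s * weyl_mirror \<alpha> b (gn n) s\<bar>
        \<le> (A * (s - a) powr (- \<alpha>) + c) / Gamma (1 - \<alpha>) * e"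
      unfolding abs_mult using order_trans[OF abs_ge_zero 1] by (intro mult_mono 1 2) auto
  qed (auto intro!: borel_measurable_times left_meas right_meas fn gn f g)
qed

lemma young_additive:
  assumes f: "holder_bound F \<nu> f" and g: "holder_bound G \<theta> g"
    and \<alpha>: "0 < \<alpha>" "\<alpha> < 1" "\<alpha> < \<nu>" "1 - \<alpha> < \<theta>" and abc: "a < b" "b < c"
  shows "pathwise_integral \<alpha> a c f g = pathwise_integral \<alpha> a b f g + pathwise_integral \<alpha> b c f g"
proof -
  have "0 < \<nu>" "0 < \<theta>"
    using \<alpha> by auto
  obtain fn fn' where fn: "\<And>n. holder_bound F \<nu> (fn n)" "\<And>n x. DERIV (fn n) x :> fn' n x"
    "\<And>n x. isCont (fn' n) x" "\<And>x. (\<lambda>n. fn n x) \<longlonglongrightarrow> f x"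
    using mollify[OF f \<open>0 < \<nu>\<close>] by metis
  obtain gn gn' where gn: "\<And>n. holder_bound G \<theta> (gn n)" "\<And>n x. DERIV (gn n) x :> gn' n x"
    "\<And>n x. isCont (gn' n) x" "\<And>x. (\<lambda>n. gn n x) \<longlonglongrightarrow> g x"
    using mollify[OF g \<open>0 < \<theta>\<close>] by metis
  note lim = pathwise_integral_tendsto[OF fn(1) f fn(4) gn(1) g gn(4) \<alpha>]
  have "pathwise_integral \<alpha> a c (fn n) (gn n)
      = pathwise_integral \<alpha> a b (fn n) (gn n) + pathwise_integral \<alpha> b c (fn n) (gn n)" for n
  proof -
    note C1 = pathwise_integral_C1[OF fn(1-3) gn(1-3) \<alpha>, of _ _ n n]
    have cont: "isCont (\<lambda>u. fn' n u * (gn n c - gn n u)) x" for x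
      using DERIV_isCont[OF gn(2)] by (intro continuous_intros fn(3)) auto
    have "(LBINT u=a..b. fn' n u * (gn n c - gn n u)) + (LBINT u=b..c. fn' n u * (gn n c - gn n u))
        = (LBINT u=a..c. fn' n u * (gn n c - gn n u))"
      using abc by (intro interval_integral_sum) (auto simp: min_def max_def intro!: interval_integrable_isCont cont)
    then have split: "(LBINT u:{a<..<c}. fn' n u * (gn n c - gn n u))
        = (LBINT u:{a<..<b}. fn' n u * (gn n c - gn n u)) + (LBINT u:{b<..<c}. fn' n u * (gn n c - gn n u))"
      using abc by (simp add: interval_integral_Ioo)
    have int: "set_integrable lborel {a<..<b} h" if "\<And>x. isCont h x" for h :: "real \<Rightarrow> real"
      using interval_integrable_isCont[of a b h] that abc
      by (simp add: interval_lebesgue_integrable_def einterval_eq)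
    have i1: "set_integrable lborel {a<..<b} (\<lambda>u. fn' n u * (gn n b - gn n u))"
      using DERIV_isCont[OF gn(2)] by (intro int continuous_intros fn(3)) auto
    have i2: "set_integrable lborel {a<..<b} (\<lambda>u. (gn n c - gn n b) * fn' n u)"
      by (intro int continuous_intros fn(3))
    have "(LBINT u:{a<..<b}. fn' n u * (gn n c - gn n u))
        = (LBINT u:{a<..<b}. fn' n u * (gn n b - gn n u) + (gn n c - gn n b) * fn' n u)"
      by (simp add: algebra_simps)
    also have "\<dots> = (LBINT u:{a<..<b}. fn' n u * (gn n b - gn n u)) + (gn n c - gn n b) * (fn n b - fn n a)"
      using set_integral_deriv[of a b "fn n" "fn' n"] abc fn(2,3) set_integral_add(2)[OF i1 i2] by simp
    finally have shift: "(LBINT u:{a<..<b}. fn' n u * (gn n c - gn n u)) = \<dots>" .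
    show ?thesis
      unfolding C1[OF order_less_trans[OF abc]] C1[OF abc(1)] C1[OF abc(2)] split shift
      by (simp add: algebra_simps)
  qed
  then have "(\<lambda>n. pathwise_integral \<alpha> a c (fn n) (gn n))
      \<longlonglongrightarrow> pathwise_integral \<alpha> a b f g + pathwise_integral \<alpha> b c f g"
    using abc by (auto intro!: tendsto_add lim)
  then show ?thesis
    using lim[of a c] abc by (intro LIMSEQ_unique) auto
qed

lemma pathwise_integral_bound:
  assumes f: "holder_bound F \<nu> f" and g: "holder_bound G \<theta> g"
    and \<alpha>: "0 < \<alpha>" "\<alpha> < 1" "\<alpha> < \<nu>" "1 - \<alpha> < \<theta>" and ab: "a < b" and "f a = 0"
  shows "\<bar>pathwise_integral \<alpha> a b f g\<bar>
    \<le> (1 + \<alpha> / (\<nu> - \<alpha>)) * (1 + (1 - \<alpha>) / (\<theta> - (1 - \<alpha>))) / (Gamma \<alpha> * Gamma (1 - \<alpha>)) * F * G * (b - a) powr (\<nu> + \<theta>)"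
proof -
  define c where "c = F * (1 + \<alpha> / (\<nu> - \<alpha>)) * (b - a) powr (\<nu> - \<alpha>) / Gamma (1 - \<alpha>)"
  define e where "e = G * (1 + (1 - \<alpha>) / (\<theta> - (1 - \<alpha>))) * (b - a) powr (\<theta> - (1 - \<alpha>)) / Gamma \<alpha>"
  have \<Gamma>: "0 < Gamma \<alpha>" "0 < Gamma (1 - \<alpha>)"
    using \<alpha> by (auto intro: Gamma_real_pos)
  have F0: "0 \<le> F"
    by (rule holder_bound_nonneg[OF f])
  have [measurable]: "weyl_left \<alpha> a f \<in> borel_measurable borel"
    using \<alpha> by (intro weyl_left_measurable holder_bound_measurable[OF f]) auto
  have [measurable]: "g \<in> borel_measurable borel"
    using \<alpha> by (intro holder_bound_measurable[OF g]) auto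
  have [measurable]: "(\<lambda>s. weyl_mirror \<alpha> b g s) \<in> borel_measurable borel"
    by (intro measurable_compose[OF _ weyl_left_measurable]) auto
  have "\<bar>LBINT s:{a<..<b}. weyl_left \<alpha> a f s * weyl_mirror \<alpha> b g s\<bar>
      \<le> (LBINT s:{a<..<b}. c * e * (s - a) powr 0)"
  proof (rule set_integral_dominated(2))
    show "set_integrable lborel {a<..<b} (\<lambda>s. c * e * (s - a) powr 0)"
      using ab by (intro set_integrable_mult_right powr_integral_left) auto
    fix s assume s: "s \<in> {a<..<b}"
    have "\<bar>weyl_left \<alpha> a f s\<bar> \<le> F * (1 + \<alpha> / (\<nu> - \<alpha>)) * (s - a) powr (\<nu> - \<alpha>) / Gamma (1 - \<alpha>)"
      using s weyl_left_bound[OF f \<alpha>(1-3), of a s] assms by auto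
    also have "\<dots> \<le> c"
      unfolding c_def using \<Gamma> s F0 \<alpha>
      by (intro divide_right_mono mult_left_mono powr_mono2 mult_nonneg_nonneg) auto
    finally have 1: "\<bar>weyl_left \<alpha> a f s\<bar> \<le> c" .
    have 2: "\<bar>weyl_mirror \<alpha> b g s\<bar> \<le> e"
      unfolding e_def using s by (intro weyl_right_bound[OF g \<alpha>(1,2,4)]) auto
    show "\<bar>weyl_left \<alpha> a f s * weyl_mirror \<alpha> b g s\<bar> \<le> c * e * (s - a) powr 0"
      using s order_trans[OF abs_ge_zero 1] by (auto simp: abs_mult intro!: mult_mono 1 2)
  qed auto
  also have "\<dots> = c * e * (b - a)"
    using powr_integral_left(2)[of a b 0] ab by simp
  also have "\<dots> = (1 + \<alpha> / (\<nu> - \<alpha>)) * (1 + (1 - \<alpha>) / (\<theta> - (1 - \<alpha>))) / (Gamma \<alpha> * Gamma (1 - \<alpha>)) * F * G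
      * ((b - a) powr (\<nu> - \<alpha>) * (b - a) powr (\<theta> - (1 - \<alpha>)) * (b - a) powr 1)"
    using ab by (simp add: c_def e_def mult_ac)
  also have "(b - a) powr (\<nu> - \<alpha>) * (b - a) powr (\<theta> - (1 - \<alpha>)) * (b - a) powr 1 = (b - a) powr (\<nu> + \<theta>)"
    unfolding powr_add[symmetric] by simp
  finally show ?thesis
    unfolding pathwise_integral_reflect by simp
qed

lemma young_bound:
  assumes f: "holder_bound F \<nu> f" and g: "holder_bound G \<theta> g"
    and \<alpha>: "0 < \<alpha>" "\<alpha> < 1" "\<alpha> < \<nu>" "1 - \<alpha> < \<theta>" and ab: "a < b"
  shows "\<bar>pathwise_integral \<alpha> a b f g - f a * (g b - g a)\<bar>
    \<le> (1 + \<alpha> / (\<nu> - \<alpha>)) * (1 + (1 - \<alpha>) / (\<theta> - (1 - \<alpha>))) / (Gamma \<alpha> * Gamma (1 - \<alpha>)) * F * G * (b - a) powr (\<nu> + \<theta>)"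
proof -
  have "0 < \<nu>" "0 < \<theta>"
    using \<alpha> by auto
  obtain fn fn' where fn: "\<And>n. holder_bound F \<nu> (fn n)" "\<And>n x. DERIV (fn n) x :> fn' n x"
    "\<And>n x. isCont (fn' n) x" "\<And>x. (\<lambda>n. fn n x) \<longlonglongrightarrow> f x"
    using mollify[OF f \<open>0 < \<nu>\<close>] by metis
  obtain gn gn' where gn: "\<And>n. holder_bound G \<theta> (gn n)" "\<And>n x. DERIV (gn n) x :> gn' n x"
    "\<And>n x. isCont (gn' n) x" "\<And>x. (\<lambda>n. gn n x) \<longlonglongrightarrow> g x"
    using mollify[OF g \<open>0 < \<theta>\<close>] by metis
  have hn: "holder_bound F \<nu> (\<lambda>x. fn n x - fn n a)" "((\<lambda>x. fn n x - fn n a) has_real_derivative fn' n x) (at x)" for n x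
    using fn(1)[of n] fn(2)[of n x] by (auto simp: holder_bound_def intro!: derivative_eq_intros)
  have "pathwise_integral \<alpha> a b (fn n) (gn n) - fn n a * (gn n b - gn n a)
      = pathwise_integral \<alpha> a b (\<lambda>x. fn n x - fn n a) (gn n)" for n
    unfolding pathwise_integral_C1[OF fn(1-3) gn(1-3) \<alpha> ab] pathwise_integral_C1[OF hn fn(3) gn(1-3) \<alpha> ab]
    by simp
  then have bound: "\<bar>pathwise_integral \<alpha> a b (fn n) (gn n) - fn n a * (gn n b - gn n a)\<bar>
    \<le> (1 + \<alpha> / (\<nu> - \<alpha>)) * (1 + (1 - \<alpha>) / (\<theta> - (1 - \<alpha>))) / (Gamma \<alpha> * Gamma (1 - \<alpha>)) * F * G * (b - a) powr (\<nu> + \<theta>)" for n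
    using pathwise_integral_bound[OF hn(1) gn(1) \<alpha> ab, of n n] by simp
  have "(\<lambda>n. \<bar>pathwise_integral \<alpha> a b (fn n) (gn n) - fn n a * (gn n b - gn n a)\<bar>)
      \<longlonglongrightarrow> \<bar>pathwise_integral \<alpha> a b f g - f a * (g b - g a)\<bar>"
    by (intro tendsto_intros pathwise_integral_tendsto[OF fn(1) f fn(4) gn(1) g gn(4) \<alpha> ab] fn(4) gn(4))
  then show ?thesis
    using bound by (intro LIMSEQ_le_const2) auto
qed


section \<open>Hoelder continuity of fractional Brownian motion\<close>

lemma half_power_powr: "((1 / 2 :: real) ^ n) powr a = (2 powr (- a)) ^ n"
proof -
  have "(1 / 2 :: real) ^ n = 2 powr (- real n)"
    by (simp add: powr_minus powr_realpow power_one_over inverse_eq_divide)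
  moreover have "(2 powr (- a)) ^ n = (2 powr (- a)) powr real n"
    by (simp add: powr_realpow)
  ultimately show ?thesis
    by (simp add: powr_powr mult.commute)
qed

lemma dyadic_holder:
  fixes g :: "real \<Rightarrow> real"
  assumes T: "0 < T" and \<theta>: "0 < \<theta>" and cont: "continuous_on {0..T} g" and C: "0 \<le> C"
    and incr: "\<And>n k. k < 2 ^ n \<Longrightarrow>
      \<bar>g (T * real (Suc k) / 2 ^ n) - g (T * real k / 2 ^ n)\<bar> \<le> C * (2 powr (- \<theta>)) ^ n"
  shows "\<exists>K\<ge>0. \<forall>s\<in>{0..T}. \<forall>t\<in>{0..T}. \<bar>g t - g s\<bar> \<le> K * \<bar>t - s\<bar> powr \<theta>"
proof -
  define r :: real where "r = 2 powr (- \<theta>)"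
  have r: "0 < r" "r < 1"
    using \<theta> by (auto simp: r_def powr_less_one)
  define k where "k = (\<lambda>n t. nat \<lfloor>2 ^ n * t / T\<rfloor>)"
  define d where "d = (\<lambda>n t. T * real (k n t) / 2 ^ n)"
  have k_real: "real (k n t) = of_int \<lfloor>2 ^ n * t / T\<rfloor>" if "0 \<le> t" for n t
    using that T by (simp add: k_def)
  have k_le: "real (k n t) \<le> 2 ^ n * t / T" "2 ^ n * t / T < real (k n t) + 1" if "0 \<le> t" for n t
    using k_real[OF that, of n] floor_correct[of "2 ^ n * t / T"] by auto
  have k_max: "k n t \<le> 2 ^ n" if "0 \<le> t" "t \<le> T" for n t
  proof -
    have "2 ^ n * t / T \<le> 2 ^ n"
      using that T by (simp add: field_simps)
    then have "real (k n t) \<le> 2 ^ n"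
      using k_le(1)[OF that(1), of n] by linarith
    then show ?thesis
      by (metis of_nat_le_iff of_nat_numeral of_nat_power)
  qed
  have d_in: "d n t \<in> {0..T}" if "0 \<le> t" "t \<le> T" for n t
  proof -
    have "real (k n t) \<le> 2 ^ n"
      using k_max[OF that, of n] by (metis of_nat_le_iff of_nat_numeral of_nat_power)
    then show ?thesis
      using T by (simp add: d_def field_simps)
  qed
  have step: "\<bar>g (d (Suc n) t) - g (d n t)\<bar> \<le> C * r ^ Suc n" if t: "0 \<le> t" "t \<le> T" for n t
  proof -
    have "2 * real (k n t) \<le> 2 ^ Suc n * t / T" "2 ^ Suc n * t / T < 2 * real (k n t) + 2"
      using k_le[OF t(1), of n] by auto
    then have "2 * real (k n t) < real (k (Suc n) t) + 1" "real (k (Suc n) t) < 2 * real (k n t) + 2"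
      using k_le[OF t(1), of "Suc n"] by linarith+
    then have "k (Suc n) t = 2 * k n t \<or> k (Suc n) t = Suc (2 * k n t)"
      by linarith
    then show ?thesis
    proof
      assume "k (Suc n) t = 2 * k n t"
      then have "d (Suc n) t = d n t"
        by (simp add: d_def)
      then show ?thesis
        using C r by simp
    next
      assume *: "k (Suc n) t = Suc (2 * k n t)"
      then have "2 * k n t < 2 ^ Suc n"
        using k_max[OF t, of "Suc n"] by linarith
      from incr[OF this] show ?thesis
        by (simp add: d_def * r_def)
    qed
  qed
  have chain: "\<bar>g (d (n + m) t) - g (d n t)\<bar> \<le> C / (1 - r) * (r ^ n - r ^ (n + m))"
    if t: "0 \<le> t" "t \<le> T" for n m t
  proof (induction m)
    case (Suc m)
    have "\<bar>g (d (n + Suc m) t) - g (d n t)\<bar>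
        \<le> \<bar>g (d (Suc (n + m)) t) - g (d (n + m) t)\<bar> + \<bar>g (d (n + m) t) - g (d n t)\<bar>"
      by simp
    also have "\<dots> \<le> C * r ^ Suc (n + m) + C / (1 - r) * (r ^ n - r ^ (n + m))"
      by (intro add_mono step t Suc.IH)
    also have "C * r ^ Suc (n + m) \<le> C * r ^ (n + m)"
      using r C by (intro mult_left_mono power_decreasing) auto
    also have "C * r ^ (n + m) = C / (1 - r) * (r ^ (n + m) - r ^ (n + Suc m))"
      using r by (simp add: field_simps)
    finally show ?case
      by (simp add: algebra_simps)
  qed simp
  have d_lim: "(\<lambda>m. d (n + m) t) \<longlonglongrightarrow> t" if t: "0 \<le> t" "t \<le> T" for n t
  proof -
    have "\<bar>d m t - t\<bar> \<le> T * (1 / 2) ^ m" for m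
    proof -
      have "t = T * (2 ^ m * t / T) / 2 ^ m"
        using T by simp
      then have "d m t - t = T * (real (k m t) - 2 ^ m * t / T) / 2 ^ m"
        unfolding d_def by (metis diff_divide_distrib right_diff_distrib)
      moreover have "\<bar>real (k m t) - 2 ^ m * t / T\<bar> \<le> 1"
        using k_le[OF t(1), of m] by linarith
      ultimately show ?thesis
        using T by (auto simp: abs_mult abs_divide power_divide intro!: divide_right_mono)
    qed
    moreover have "(\<lambda>m. T * (1 / 2) ^ m) \<longlonglongrightarrow> T * 0"
      by (intro tendsto_intros LIMSEQ_power_zero) auto
    ultimately have "(\<lambda>m. d m t - t) \<longlonglongrightarrow> 0"
      using Lim_null_comparison[of "\<lambda>m. d m t - t" "\<lambda>m. T * (1 / 2) ^ m" sequentially] by simp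
    then have "(\<lambda>m. d m t) \<longlonglongrightarrow> t"
      by (simp add: LIM_zero_iff)
    then show ?thesis
      by (subst add.commute) (rule LIMSEQ_ignore_initial_segment)
  qed
  have approx: "\<bar>g t - g (d n t)\<bar> \<le> C / (1 - r) * r ^ n" if t: "0 \<le> t" "t \<le> T" for n t
  proof -
    have "(\<lambda>m. g (d (n + m) t)) \<longlonglongrightarrow> g t"
      using continuous_on_tendsto_compose[OF cont d_lim[OF t, of n]] t d_in[OF t] by auto
    then have "(\<lambda>m. \<bar>g (d (n + m) t) - g (d n t)\<bar>) \<longlonglongrightarrow> \<bar>g t - g (d n t)\<bar>"
      by (intro tendsto_intros)
    moreover have "\<bar>g (d (n + m) t) - g (d n t)\<bar> \<le> C / (1 - r) * r ^ n" for m
    proof -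
      have "C / (1 - r) * (r ^ n - r ^ (n + m)) \<le> C / (1 - r) * r ^ n"
        using r C by (intro mult_left_mono) auto
      with chain[OF t, of n m] show ?thesis by linarith
    qed
    ultimately show ?thesis
      by (intro LIMSEQ_le_const2) auto
  qed
  define K where "K = (2 * C / (1 - r) + C) * (2 / T) powr \<theta>"
  have ordered: "\<bar>g t - g s\<bar> \<le> K * \<bar>t - s\<bar> powr \<theta>" if st: "0 \<le> s" "s < t" "t \<le> T" for s t
  proof -
    obtain m0 where "(1 / 2) ^ m0 < (t - s) / T"
      using real_arch_pow_inv[of "(t - s) / T" "1 / 2"] st T by auto
    then have ex: "\<exists>m. (1 / 2) ^ m < (t - s) / T"
      by blast
    define m where "m = (LEAST m. (1 / 2) ^ m < (t - s) / T)"
    have m: "(1 / 2) ^ m < (t - s) / T"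
      unfolding m_def by (rule LeastI_ex[OF ex])
    have "m \<noteq> 0"
    proof
      assume "m = 0"
      with m T have "T < t - s" by (simp add: field_simps)
      with st show False by simp
    qed
    then obtain n where n: "m = Suc n"
      using not0_implies_Suc by blast
    then have "\<not> (1 / 2) ^ n < (t - s) / T"
      using not_less_Least[of n "\<lambda>m. (1 / 2) ^ m < (t - s) / T"] unfolding m_def by auto
    then have upper: "2 ^ n * (t - s) / T \<le> 1"
      by (simp add: not_less power_divide field_simps)
    have k_mono: "k n s \<le> k n t"
      unfolding k_def using st T by (intro nat_mono floor_mono divide_right_mono mult_left_mono) auto
    have "2 ^ n * t / T \<le> 2 ^ n * s / T + 1"
      using upper by (simp add: diff_divide_distrib right_diff_distrib)
    then have "real (k n t) < real (k n s) + 2"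
      using k_le[of t n] k_le[of s n] st by linarith
    then have "k n t = k n s \<or> k n t = Suc (k n s)"
      using k_mono by linarith
    then have mid: "\<bar>g (d n t) - g (d n s)\<bar> \<le> C * r ^ n"
    proof
      assume "k n t = k n s"
      then show ?thesis
        using C r by (simp add: d_def)
    next
      assume *: "k n t = Suc (k n s)"
      then have "k n s < 2 ^ n"
        using k_max[of t n] st by linarith
      from incr[OF this] show ?thesis
        by (simp add: d_def * r_def)
    qed
    have "\<bar>g t - g s\<bar> \<le> \<bar>g t - g (d n t)\<bar> + \<bar>g (d n t) - g (d n s)\<bar> + \<bar>g s - g (d n s)\<bar>"
      by linarith
    also have "\<dots> \<le> C / (1 - r) * r ^ n + C * r ^ n + C / (1 - r) * r ^ n"
      using st by (intro add_mono approx mid) auto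
    also have "\<dots> = (2 * C / (1 - r) + C) * r ^ n"
      by (simp add: algebra_simps)
    also have "\<dots> \<le> (2 * C / (1 - r) + C) * ((2 / T) powr \<theta> * \<bar>t - s\<bar> powr \<theta>)"
    proof (intro mult_left_mono)
      have "r ^ n = ((1 / 2) ^ n) powr \<theta>"
        by (simp add: r_def half_power_powr)
      also have "\<dots> \<le> (2 / T * (t - s)) powr \<theta>"
        using m \<theta> unfolding n by (intro powr_mono2) (auto simp: field_simps)
      also have "\<dots> = (2 / T) powr \<theta> * \<bar>t - s\<bar> powr \<theta>"
        using st by (simp add: powr_mult flip: powr_mult)
      finally show "r ^ n \<le> (2 / T) powr \<theta> * \<bar>t - s\<bar> powr \<theta>" .
    qed (use C r in auto)
    finally show ?thesis
      by (simp add: K_def mult.assoc)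
  qed
  have "\<bar>g t - g s\<bar> \<le> K * \<bar>t - s\<bar> powr \<theta>" if "s \<in> {0..T}" "t \<in> {0..T}" for s t
    using ordered[of s t] ordered[of t s] that
    by (cases s t rule: linorder_cases) (auto simp: abs_minus_commute)
  moreover have "0 \<le> K"
    using C r by (auto simp: K_def)
  ultimately show ?thesis
    by blast
qed

lemma gaussian_rv_moment:
  assumes M: "prob_space M" and Z: "gaussian_rv M Z" and mean: "(LINT w|M. Z w) = 0"
    and var: "(LINT w|M. (Z w)\<^sup>2) = v"
  shows "has_bochner_integral M (\<lambda>w. Z w ^ (2 * p)) (v ^ p * (fact (2 * p) / (2 ^ p * fact p)))"
proof -
  interpret prob_space M by fact
  have [measurable]: "Z \<in> borel_measurable M"
    using Z by (simp add: gaussian_rv_def)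
  obtain \<mu> where "(AE w in M. Z w = \<mu>) \<or> (\<exists>s>0. distributed M lborel Z (normal_density \<mu> s))"
    using Z by (auto simp: gaussian_rv_def)
  then show ?thesis
  proof
    assume ae: "AE w in M. Z w = \<mu>"
    have "(LINT w|M. Z w) = (LINT w|M. \<mu>)"
      using ae by (intro integral_cong_AE) auto
    then have "\<mu> = 0"
      using mean by (simp add: prob_space)
    have "(LINT w|M. (Z w)\<^sup>2) = (LINT w|M. 0)"
      using ae \<open>\<mu> = 0\<close> by (intro integral_cong_AE) auto
    then have "v = 0"
      using var by simp
    have "has_bochner_integral M (\<lambda>w. 0 ^ (2 * p)) (v ^ p * (fact (2 * p) / (2 ^ p * fact p)))"
      using \<open>v = 0\<close> by (cases p) (auto simp: has_bochner_integral_iff prob_space)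
    then show ?thesis
      using ae \<open>\<mu> = 0\<close> by (subst has_bochner_integral_cong_AE[of _ _ "\<lambda>w. 0 ^ (2 * p)"]) auto
  next
    assume "\<exists>s>0. distributed M lborel Z (normal_density \<mu> s)"
    then obtain s where s: "0 < s" and D: "distributed M lborel Z (normal_density \<mu> s)"
      by blast
    have "\<mu> = 0"
      using normal_distributed_expectation[OF s D] mean by simp
    have even: "has_bochner_integral M (\<lambda>w. Z w ^ (2 * q)) (fact (2 * q) / ((2 / s\<^sup>2) ^ q * fact q))" for q
    proof -
      note * = normal_moment_even[OF s, of \<mu> q]
      have "integrable M (\<lambda>w. (Z w - \<mu>) ^ (2 * q))"
        using * by (subst distributed_integrable[OF D, symmetric]) (auto simp: has_bochner_integral_iff)
      moreover have "(LINT w|M. (Z w - \<mu>) ^ (2 * q)) = fact (2 * q) / ((2 / s\<^sup>2) ^ q * fact q)"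
        using * by (subst distributed_integral[OF D, symmetric]) (auto simp: has_bochner_integral_iff)
      ultimately show ?thesis
        using \<open>\<mu> = 0\<close> by (simp add: has_bochner_integral_iff)
    qed
    have "v = s\<^sup>2"
      using even[of 1] var s by (simp add: has_bochner_integral_iff)
    then show ?thesis
      using even[of p] by (simp add: power_divide mult.commute mult.left_commute)
  qed
qed

lemma gaussian_rv_square_integrable:
  assumes M: "prob_space M" and Z: "gaussian_rv M Z"
  shows "integrable M (\<lambda>w. (Z w)\<^sup>2)" "integrable M Z"
proof -
  interpret prob_space M by fact
  have [measurable]: "Z \<in> borel_measurable M"
    using Z by (simp add: gaussian_rv_def)
  obtain \<mu> where "(AE w in M. Z w = \<mu>) \<or> (\<exists>s>0. distributed M lborel Z (normal_density \<mu> s))"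
    using Z by (auto simp: gaussian_rv_def)
  then show sq: "integrable M (\<lambda>w. (Z w)\<^sup>2)"
  proof
    assume "AE w in M. Z w = \<mu>"
    then show ?thesis
      by (intro integrable_const_bound[of _ "\<mu>\<^sup>2"]) auto
  next
    assume "\<exists>s>0. distributed M lborel Z (normal_density \<mu> s)"
    then obtain s where s: "0 < s" and D: "distributed M lborel Z (normal_density \<mu> s)"
      by blast
    have "integrable M (\<lambda>w. (Z w - \<mu>) ^ k)" for k
      using integrable_normal_moment[OF s, of \<mu> k] by (subst distributed_integrable[OF D, symmetric]) auto
    from this[of 2] this[of 1] have "integrable M (\<lambda>w. (Z w - \<mu>)\<^sup>2 + 2 * \<mu> * (Z w - \<mu>) + \<mu>\<^sup>2)"
      by auto
    then show ?thesis
      by (rule Bochner_Integration.integrable_cong[THEN iffD1, rotated -1])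
        (auto simp: power2_eq_square algebra_simps)
  qed
  show "integrable M Z"
    using square_integrable_imp_integrable[OF _ sq] by simp
qed

lemma fbm_increment_moment:
  assumes M: "prob_space M" and B: "fractional_brownian_motion M H I B"
    and st: "s \<in> I" "t \<in> I"
  shows "(\<lambda>w. B t w - B s w) \<in> borel_measurable M"
    and "has_bochner_integral M (\<lambda>w. (B t w - B s w) ^ (2 * p))
      ((\<bar>t - s\<bar> powr (2 * H)) ^ p * (fact (2 * p) / (2 ^ p * fact p)))"
proof -
  interpret prob_space M by fact
  have gp: "gaussian_rv M (\<lambda>w. \<Sum>t\<in>J. c t * B t w)" if "finite J" "J \<subseteq> I" for J c
    using B that by (auto simp: fractional_brownian_motion_def gaussian_process_def)
  have single: "gaussian_rv M (B u)" if "u \<in> I" for u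
    using gp[of "{u}" "\<lambda>_. 1"] that by simp
  have incr: "gaussian_rv M (\<lambda>w. B t w - B s w)"
  proof (cases "s = t")
    case True
    then show ?thesis
      using gp[of "{}"] by simp
  next
    case False
    then show ?thesis
      using gp[of "{s, t}" "\<lambda>u. if u = t then 1 else - 1"] st by simp
  qed
  then show "(\<lambda>w. B t w - B s w) \<in> borel_measurable M"
    by (simp add: gaussian_rv_def)
  have [measurable]: "B s \<in> borel_measurable M" "B t \<in> borel_measurable M"
    using single st by (auto simp: gaussian_rv_def)
  note sq = gaussian_rv_square_integrable[OF M single]
  have prod: "integrable M (\<lambda>w. B t w * B s w)"
  proof (rule Bochner_Integration.integrable_bound)
    show "integrable M (\<lambda>w. (B t w)\<^sup>2 + (B s w)\<^sup>2)"
      using sq(1) st by auto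
    have "\<bar>x * y\<bar> \<le> x\<^sup>2 + y\<^sup>2" for x y :: real
    proof -
      have "2 * \<bar>x * y\<bar> \<le> x\<^sup>2 + y\<^sup>2"
        using sum_squares_bound[of "\<bar>x\<bar>" "\<bar>y\<bar>"] by (simp add: abs_mult mult_ac)
      then show ?thesis
        using abs_ge_zero[of "x * y"] by linarith
    qed
    then show "AE w in M. norm (B t w * B s w) \<le> norm ((B t w)\<^sup>2 + (B s w)\<^sup>2)"
      by (intro AE_I2) simp
  qed measurable
  have cov: "(LINT w|M. B t w * B s w) = (t powr (2 * H) + s powr (2 * H) - \<bar>t - s\<bar> powr (2 * H)) / 2"
    if "s \<in> I" "t \<in> I" for s t
    using B that by (auto simp: fractional_brownian_motion_def)
  have var: "(LINT w|M. (B t w)\<^sup>2) = t powr (2 * H)" if "t \<in> I" for t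
    using cov[OF that that] by (simp add: power2_eq_square)
  have "(LINT w|M. (B t w - B s w)\<^sup>2) = (LINT w|M. (B t w)\<^sup>2 + (B s w)\<^sup>2 - 2 * (B t w * B s w))"
    by (intro Bochner_Integration.integral_cong) (auto simp: power2_eq_square algebra_simps)
  also have "\<dots> = (LINT w|M. (B t w)\<^sup>2) + (LINT w|M. (B s w)\<^sup>2) - 2 * (LINT w|M. B t w * B s w)"
    using sq(1) st prod by simp
  also have "\<dots> = \<bar>t - s\<bar> powr (2 * H)"
    using cov[OF st] var st by simp
  finally have v: "(LINT w|M. (B t w - B s w)\<^sup>2) = \<bar>t - s\<bar> powr (2 * H)" .
  have "(LINT w|M. B u w) = 0" if "u \<in> I" for u
    using B that by (auto simp: fractional_brownian_motion_def)
  then have "(LINT w|M. B t w - B s w) = 0"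
    using sq(2) st by simp
  then show "has_bochner_integral M (\<lambda>w. (B t w - B s w) ^ (2 * p))
      ((\<bar>t - s\<bar> powr (2 * H)) ^ p * (fact (2 * p) / (2 ^ p * fact p)))"
    by (rule gaussian_rv_moment[OF M incr _ v])
qed

lemma fbm_holder:
  assumes M: "prob_space M" and B: "fractional_brownian_motion M H {0..T} B"
    and T: "0 < T" and \<theta>: "0 < \<theta>" "\<theta> < H"
  shows "AE w in M. \<exists>K\<ge>0. \<forall>s\<in>{0..T}. \<forall>t\<in>{0..T}. \<bar>B t w - B s w\<bar> \<le> K * \<bar>t - s\<bar> powr \<theta>"
proof -
  interpret prob_space M by fact
  define r :: real where "r = 2 powr (- \<theta>)"
  have r: "0 < r"
    by (simp add: r_def)
  define x where "x = (\<lambda>n k. T * real k / 2 ^ n)"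
  define Z where "Z = (\<lambda>n k w. B (x n (Suc k)) w - B (x n k) w)"
  have x_in: "x n k \<in> {0..T}" if "k \<le> 2 ^ n" for n k
  proof -
    have "real k \<le> 2 ^ n"
      using that by (metis of_nat_le_iff of_nat_numeral of_nat_power)
    then show ?thesis
      using T by (simp add: x_def field_simps)
  qed
  obtain p :: nat where "1 / (2 * (H - \<theta>)) < real p"
    using reals_Archimedean2 by blast
  then have p: "1 - 2 * H * real p + 2 * \<theta> * real p < 0"
    using \<theta> by (simp add: field_simps)
  have Z_meas: "Z n k \<in> borel_measurable M" if "k < 2 ^ n" for n k
    unfolding Z_def using that by (intro fbm_increment_moment(1)[OF M B] x_in) auto
  define c where "c = (T powr (2 * H)) ^ p * (fact (2 * p) / (2 ^ p * fact p))"
  have tail: "prob {w \<in> space M. r ^ n \<le> \<bar>Z n k w\<bar>}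
      \<le> c * ((2 powr (- (2 * H))) ^ p / r ^ (2 * p)) ^ n" if "k < 2 ^ n" for n k
  proof -
    have dist: "\<bar>x n (Suc k) - x n k\<bar> = T * (1 / 2) ^ n"
      using T by (simp add: x_def power_divide field_simps)
    have "has_bochner_integral M (\<lambda>w. (Z n k w) ^ (2 * p))
        ((\<bar>x n (Suc k) - x n k\<bar> powr (2 * H)) ^ p * (fact (2 * p) / (2 ^ p * fact p)))"
      unfolding Z_def using that by (intro fbm_increment_moment(2)[OF M B] x_in) auto
    also have "(\<bar>x n (Suc k) - x n k\<bar> powr (2 * H)) ^ p * (fact (2 * p) / (2 ^ p * fact p))
        = c * ((2 powr (- (2 * H))) ^ p) ^ n"
      unfolding dist powr_mult half_power_powr power_mult_distrib c_def
      by (simp add: mult_ac flip: power_mult)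
    finally have moment: "has_bochner_integral M (\<lambda>w. (Z n k w) ^ (2 * p)) (c * ((2 powr (- (2 * H))) ^ p) ^ n)" .
    have [measurable]: "Z n k \<in> borel_measurable M"
      by (rule Z_meas[OF that])
    have "prob {w \<in> space M. r ^ n \<le> \<bar>Z n k w\<bar>} \<le> prob {w \<in> space M. (r ^ n) ^ (2 * p) \<le> (Z n k w) ^ (2 * p)}"
    proof (rule finite_measure_mono)
      show "{w \<in> space M. r ^ n \<le> \<bar>Z n k w\<bar>} \<subseteq> {w \<in> space M. (r ^ n) ^ (2 * p) \<le> (Z n k w) ^ (2 * p)}"
      proof safe
        fix w assume "r ^ n \<le> \<bar>Z n k w\<bar>"
        then have "(r ^ n) ^ (2 * p) \<le> \<bar>Z n k w\<bar> ^ (2 * p)"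
          using r by (intro power_mono) auto
        then show "(r ^ n) ^ (2 * p) \<le> (Z n k w) ^ (2 * p)"
          by (simp add: power_even_abs)
      qed
    qed measurable
    also have "\<dots> \<le> (LINT w|M. (Z n k w) ^ (2 * p)) / (r ^ n) ^ (2 * p)"
      using moment r
      by (intro integral_Markov_inequality_measure[where A = "{}"]) (auto simp: has_bochner_integral_iff)
    also have "\<dots> = c * ((2 powr (- (2 * H))) ^ p / r ^ (2 * p)) ^ n"
      using moment by (simp add: has_bochner_integral_iff power_divide mult.commute flip: power_mult)
    finally show ?thesis .
  qed
  define A where "A = (\<lambda>n. \<Union>k<2^n. {w \<in> space M. r ^ n \<le> \<bar>Z n k w\<bar>})"
  have Ak_sets: "{w \<in> space M. r ^ n \<le> \<bar>Z n k w\<bar>} \<in> events" if "k < 2 ^ n" for n k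
    using Z_meas[OF that] by measurable
  then have A_sets: "A n \<in> events" for n
    unfolding A_def by (intro sets.finite_UN) auto
  define q where "q = 2 * ((2 powr (- (2 * H))) ^ p / r ^ (2 * p))"
  have "q = 2 powr (1 - 2 * H * real p + 2 * \<theta> * real p)"
  proof -
    have "(2 powr (- (2 * H))) ^ p = 2 powr (- 2 * H * real p)"
      by (simp add: powr_powr flip: powr_realpow)
    moreover have "r ^ (2 * p) = 2 powr (- 2 * \<theta> * real p)"
      by (simp add: r_def powr_powr mult_ac flip: powr_realpow)
    ultimately have "q = 2 powr 1 * (2 powr (- 2 * H * real p) / 2 powr (- 2 * \<theta> * real p))"
      by (simp add: q_def)
    then show ?thesis
      unfolding powr_add[symmetric] powr_diff[symmetric] by (simp add: algebra_simps)
  qed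
  then have q: "0 < q" "q < 1"
    using p by (auto simp: powr_less_one)
  have A_prob: "prob (A n) \<le> c * q ^ n" for n
  proof -
    have "prob (A n) \<le> (\<Sum>k<2^n. prob {w \<in> space M. r ^ n \<le> \<bar>Z n k w\<bar>})"
      unfolding A_def using Ak_sets by (intro finite_measure_subadditive_finite) auto
    also have "\<dots> \<le> (\<Sum>k<(2::nat)^n. c * ((2 powr (- (2 * H))) ^ p / r ^ (2 * p)) ^ n)"
      by (intro sum_mono tail) auto
    also have "\<dots> = c * q ^ n"
      unfolding q_def power_mult_distrib by simp
    finally show ?thesis .
  qed
  have "summable (\<lambda>n. prob (A n))"
  proof (rule summable_comparison_test_ev)
    show "\<forall>\<^sub>F n in sequentially. norm (prob (A n)) \<le> c * q ^ n"
      using A_prob by (intro always_eventually) auto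
    show "summable (\<lambda>n. c * q ^ n)"
      using q by (intro summable_mult summable_geometric) auto
  qed
  then have "AE w in M. \<forall>\<^sub>F n in sequentially. w \<in> space M - A n"
    by (intro borel_cantelli_AE1 A_sets) (auto simp: less_top[symmetric])
  moreover have "AE w in M. continuous_on {0..T} (\<lambda>t. B t w)"
    using B by (simp add: fractional_brownian_motion_def)
  ultimately show ?thesis
  proof eventually_elim
    case (elim w)
    then obtain n0 where n0: "\<And>n. n0 \<le> n \<Longrightarrow> w \<in> space M - A n"
      by (auto simp: eventually_sequentially)
    define S where "S = (\<Sum>n<n0. \<Sum>k<2^n. \<bar>Z n k w\<bar> / r ^ n)"
    have S: "0 \<le> S"
      unfolding S_def using r by (intro sum_nonneg) auto
    have incr: "\<bar>Z n k w\<bar> \<le> (1 + S) * r ^ n" if k: "k < 2 ^ n" for n k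
    proof (cases "n0 \<le> n")
      case True
      then have "\<bar>Z n k w\<bar> < r ^ n"
        using n0[OF True] k by (auto simp: A_def not_le)
      also have "\<dots> \<le> (1 + S) * r ^ n"
        using S r by simp
      finally show ?thesis by simp
    next
      case False
      have "\<bar>Z n k w\<bar> / r ^ n \<le> (\<Sum>k<2^n. \<bar>Z n k w\<bar> / r ^ n)"
        using k r by (intro member_le_sum) auto
      also have "\<dots> \<le> S"
        unfolding S_def using False r by (intro member_le_sum[of n] sum_nonneg) auto
      finally have "\<bar>Z n k w\<bar> \<le> S * r ^ n"
        using r by (simp add: pos_divide_le_eq)
      also have "\<dots> \<le> (1 + S) * r ^ n"
        using r by (intro mult_right_mono) auto
      finally show ?thesis .
    qed
    show ?case
      using dyadic_holder[OF T \<theta>(1) elim(2), of "1 + S"] S incr by (simp add: Z_def x_def r_def)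
  qed
qed


section \<open>The Euler scheme\<close>

lemma powr_le_powr_bound:
  fixes x T p q :: real
  assumes "0 \<le> x" "x \<le> T" "p \<le> q"
  shows "x powr q \<le> T powr (q - p) * x powr p"
proof -
  have "x powr q = x powr (q - p) * x powr p"
    by (simp flip: powr_add)
  also have "\<dots> \<le> T powr (q - p) * x powr p"
    using assms by (intro mult_right_mono powr_mono2) auto
  finally show ?thesis .
qed

lemma grid_cover:
  assumes "0 < T" "0 < N" "s \<in> {0..T}"
  shows "\<exists>n<N. s \<in> {grid T N n..grid T N (Suc n)}"
proof -
  define h where "h = T / real N"
  have h: "0 < h" "real N * h = T"
    using assms by (auto simp: h_def)
  show ?thesis
  proof (cases "s = T")
    case True
    have "real (N - 1) * h \<le> real N * h"
      using h by (intro mult_right_mono) auto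
    then show ?thesis
      using True assms h by (intro exI[of _ "N - 1"]) (auto simp: grid_def h_def[symmetric])
  next
    case False
    define n where "n = nat \<lfloor>s / h\<rfloor>"
    have "0 \<le> s / h"
      using assms h by simp
    then have n: "real n \<le> s / h" "s / h < real (Suc n)"
      unfolding n_def by linarith+
    then have "real n * h \<le> s" "s < real (Suc n) * h"
      using h by (simp_all add: pos_le_divide_eq pos_divide_less_eq)
    moreover from this have "real n * h < real N * h"
      using False assms h by auto
    then have "n < N"
      using mult_right_less_imp_less[of "real n" h "real N"] h(1) by simp
    ultimately show ?thesis
      by (intro exI[of _ n]) (auto simp: grid_def h_def[symmetric])
  qed
qed

lemma euler_difference_holder:
  fixes x :: "real \<Rightarrow> 'a::real_normed_vector"
    and S :: "'j::finite \<Rightarrow> real \<Rightarrow> 'a \<Rightarrow> 'a" and b :: "real \<Rightarrow> 'a \<Rightarrow> 'a"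
    and B :: "'j \<Rightarrow> real \<Rightarrow> real"
  assumes T: "0 < T" and \<theta>: "1 / 2 < \<theta>" "\<theta> < 1" and \<kappa>: "0 < \<kappa>" "\<kappa> \<le> 1" "1 < \<theta> + \<kappa> * \<theta>"
    and \<beta>: "\<theta> \<le> \<beta>" and \<gamma>: "2 * \<theta> - 1 \<le> \<gamma>"
    and nonneg: "0 \<le> K" "0 \<le> L" "0 \<le> C\<^sub>b" "0 \<le> G" "0 \<le> A" "0 \<le> E"
    and S_lip: "\<And>j t y z. t \<in> {0..T} \<Longrightarrow> norm (S j t y - S j t z) \<le> K * norm (y - z)"
    and S_time: "\<And>j s t y. s \<in> {0..T} \<Longrightarrow> t \<in> {0..T} \<Longrightarrow> norm (S j t y - S j s y) \<le> K * \<bar>t - s\<bar> powr \<beta>"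
    and S_four: "\<And>j s t y y' z z'. s \<in> {0..T} \<Longrightarrow> t \<in> {0..T} \<Longrightarrow>
      norm (S j t y - S j t y' - S j s z + S j s z')
        \<le> K * norm (y - y' - z + z') + K * norm (z - z') * (norm (y' - z') powr \<kappa> + \<bar>t - s\<bar> powr \<beta>)"
    and b_lip: "\<And>t y z. t \<in> {0..T} \<Longrightarrow> norm (b t y - b t z) \<le> L * norm (y - z)"
    and b_time: "\<And>s t y. s \<in> {0..T} \<Longrightarrow> t \<in> {0..T} \<Longrightarrow> norm (b t y - b s y) \<le> C\<^sub>b * \<bar>t - s\<bar> powr \<gamma>"
    and B_holder: "\<And>j s t. s \<in> {0..T} \<Longrightarrow> t \<in> {0..T} \<Longrightarrow> \<bar>B j t - B j s\<bar> \<le> G * \<bar>t - s\<bar> powr \<theta>"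
    and x_holder: "\<And>s t. s \<in> {0..T} \<Longrightarrow> t \<in> {0..T} \<Longrightarrow> norm (x t - x s) \<le> A * \<bar>t - s\<bar> powr \<theta>"
    and x_expansion: "\<And>u s. u \<in> {0..T} \<Longrightarrow> s \<in> {0..T} \<Longrightarrow> u \<le> s \<Longrightarrow>
      norm (x s - x u - (\<Sum>j\<in>UNIV. (B j s - B j u) *\<^sub>R S j u (x u)) - (s - u) *\<^sub>R b u (x u))
        \<le> E * (s - u) powr (2 * \<theta>)"
  shows "\<exists>C\<ge>0. \<forall>N>0. \<forall>Y. Y 0 = x 0 \<longrightarrow>
    (\<forall>n<N. \<forall>t\<in>{grid T N n..grid T N (Suc n)}. Y t = Y (grid T N n)
        + (t - grid T N n) *\<^sub>R b (grid T N n) (Y (grid T N n))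
        + (\<Sum>j\<in>UNIV. (B j t - B j (grid T N n)) *\<^sub>R S j (grid T N n) (Y (grid T N n)))) \<longrightarrow>
    (\<forall>s\<in>{0..T}. \<forall>t\<in>{0..T}.
      norm ((x t - Y t) - (x s - Y s)) \<le> C * (T / real N) powr (2 * \<theta> - 1) * \<bar>t - s\<bar> powr \<theta>)"
proof -
  define \<mu> where "\<mu> = \<kappa> * \<theta>"
  have \<mu>: "0 < \<mu>" "\<mu> \<le> \<theta>" "1 < \<mu> + \<theta>"
    using \<kappa> \<theta> by (auto simp: \<mu>_def)
  define K2 where "K2 = K * (A powr \<kappa> + T powr (\<beta> - \<mu>))"
  have K2: "0 \<le> K2"
    using nonneg by (simp add: K2_def)
  have EL: "0 \<le> E + L"
    using nonneg by simp
  obtain C0 where C0: "0 \<le> C0" and "\<forall>R h N (z :: nat \<Rightarrow> 'a) d (s :: 'j \<Rightarrow> nat \<Rightarrow> 'a) g m n.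
      young_recursion T \<theta> \<mu> K K2 (E + L) G R h N z d s g \<longrightarrow> z 0 = 0 \<longrightarrow> m \<le> n \<longrightarrow> n \<le> N \<longrightarrow>
        norm (z n - z m) \<le> C0 * R * (h * (real n - real m)) powr \<theta>"
    using young_recursion_holder[OF T \<mu>(1,2) \<theta>(2) \<mu>(3) nonneg(1) K2 EL nonneg(4), where 'a = 'a and 'j = 'j]
    by blast
  note C0_bound = this(2)[rule_format]
  define c\<^sub>x where "c\<^sub>x = A * T powr (1 - \<theta>) + C0 * T powr \<theta>"
  define c\<^sub>S where "c\<^sub>S = K * (T powr (\<beta> - (2 * \<theta> - 1)) + c\<^sub>x)"
  define c\<^sub>b where "c\<^sub>b = C\<^sub>b * T powr (\<gamma> - (2 * \<theta> - 1)) + L * c\<^sub>x"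
  define C1 where "C1 = E * T powr (1 - \<theta>) + real CARD('j) * G * c\<^sub>S + c\<^sub>b * T powr (1 - \<theta>)"
  have c_nonneg: "0 \<le> c\<^sub>x" "0 \<le> c\<^sub>S" "0 \<le> c\<^sub>b" "0 \<le> C1"
    using nonneg C0 by (auto simp: c\<^sub>x_def c\<^sub>S_def c\<^sub>b_def C1_def)
  have main: "norm ((x t - Y t) - (x s - Y s)) \<le> (2 * C1 + C0) * (T / real N) powr (2 * \<theta> - 1) * \<bar>t - s\<bar> powr \<theta>"
    if N: "0 < N" and Y0: "Y 0 = x 0" and Y: "\<forall>n<N. \<forall>t\<in>{grid T N n..grid T N (Suc n)}. Y t = Y (grid T N n)
        + (t - grid T N n) *\<^sub>R b (grid T N n) (Y (grid T N n))
        + (\<Sum>j\<in>UNIV. (B j t - B j (grid T N n)) *\<^sub>R S j (grid T N n) (Y (grid T N n)))"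
      and st: "s \<in> {0..T}" "t \<in> {0..T}" for N Y s t
  proof -
    define h where "h = T / real N"
    have h: "0 < h" "real N * h = T"
      using T N by (auto simp: h_def)
    have hT: "h \<le> T"
      using h N mult_right_mono[of 1 "real N" h] by simp
    define R where "R = h powr (2 * \<theta> - 1)"
    have R: "0 \<le> R"
      by (simp add: R_def)
    define \<tau> where "\<tau> = grid T N"
    have \<tau>_eq: "\<tau> n = real n * h" for n
      by (simp add: \<tau>_def grid_def h_def)
    have \<tau>_in: "\<tau> n \<in> {0..T}" if "n \<le> N" for n
      using mult_right_mono[of "real n" "real N" h] that h by (simp add: \<tau>_eq)
    define e where "e = (\<lambda>t. x t - Y t)"
    have Y_step: "Y t = Y (\<tau> n) + (t - \<tau> n) *\<^sub>R b (\<tau> n) (Y (\<tau> n))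
        + (\<Sum>j\<in>UNIV. (B j t - B j (\<tau> n)) *\<^sub>R S j (\<tau> n) (Y (\<tau> n)))"
      if "n < N" "t \<in> {\<tau> n..\<tau> (Suc n)}" for n t
      using that by (rule Y[rule_format, folded \<tau>_def])
    define rem where "rem = (\<lambda>u s. x s - x u - (\<Sum>j\<in>UNIV. (B j s - B j u) *\<^sub>R S j u (x u)) - (s - u) *\<^sub>R b u (x u))"
    define sd where "sd = (\<lambda>j n. S j (\<tau> n) (x (\<tau> n)) - S j (\<tau> n) (Y (\<tau> n)))"
    define d where "d = (\<lambda>n. rem (\<tau> n) (\<tau> (Suc n)) + h *\<^sub>R (b (\<tau> n) (x (\<tau> n)) - b (\<tau> n) (Y (\<tau> n))))"
    have "young_recursion T \<theta> \<mu> K K2 (E + L) G R h N (\<lambda>n. e (\<tau> n)) d sd (\<lambda>j n. B j (\<tau> n))"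
    proof
      show "e (\<tau> (Suc n)) = e (\<tau> n) + (\<Sum>j\<in>UNIV. (B j (\<tau> (Suc n)) - B j (\<tau> n)) *\<^sub>R sd j n) + d n" if "n < N" for n
      proof -
        have 1: "Y (\<tau> (Suc n)) = Y (\<tau> n) + h *\<^sub>R b (\<tau> n) (Y (\<tau> n))
            + (\<Sum>j\<in>UNIV. (B j (\<tau> (Suc n)) - B j (\<tau> n)) *\<^sub>R S j (\<tau> n) (Y (\<tau> n)))"
          using Y_step[of n "\<tau> (Suc n)"] that h by (simp add: \<tau>_eq algebra_simps)
        have 2: "\<tau> (Suc n) - \<tau> n = h"
          by (simp add: \<tau>_eq algebra_simps)
        show ?thesis
          unfolding e_def d_def rem_def sd_def 1 2 by (simp add: scaleR_diff_right sum_subtractf)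
      qed
      show "norm (sd j n) \<le> K * norm (e (\<tau> n))" if "n \<le> N" for j n
        unfolding sd_def e_def using S_lip[OF \<tau>_in[OF that]] by simp
      show "norm (sd j n - sd j m) \<le> K * norm (e (\<tau> n) - e (\<tau> m))
          + K2 * norm (e (\<tau> m)) * (h * (real n - real m)) powr \<mu>" if "m \<le> n" "n \<le> N" for j m n
      proof -
        let ?t = "h * (real n - real m)"
        have t1: "\<tau> n - \<tau> m = ?t"
          by (simp add: \<tau>_eq algebra_simps)
        have "?t \<le> T"
          unfolding t1[symmetric] using \<tau>_in[of m] \<tau>_in[of n] that by simp
        with t1 have t: "\<tau> n - \<tau> m = ?t" "0 \<le> ?t" "?t \<le> T"
          using that h by simp_all
        have increments: "norm (x (\<tau> n) - x (\<tau> m)) powr \<kappa> + \<bar>\<tau> n - \<tau> m\<bar> powr \<beta>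
            \<le> A powr \<kappa> * ?t powr \<mu> + T powr (\<beta> - \<mu>) * ?t powr \<mu>"
        proof (rule add_mono)
          have "norm (x (\<tau> n) - x (\<tau> m)) powr \<kappa> \<le> (A * ?t powr \<theta>) powr \<kappa>"
            using x_holder[OF \<tau>_in[of m] \<tau>_in[of n]] that t \<kappa> by (intro powr_mono2) auto
          also have "\<dots> = A powr \<kappa> * ?t powr \<mu>"
            by (simp add: powr_mult powr_powr \<mu>_def mult.commute)
          finally show "norm (x (\<tau> n) - x (\<tau> m)) powr \<kappa> \<le> A powr \<kappa> * ?t powr \<mu>" .
          show "\<bar>\<tau> n - \<tau> m\<bar> powr \<beta> \<le> T powr (\<beta> - \<mu>) * ?t powr \<mu>"
            using t \<mu> \<beta> by (simp add: powr_le_powr_bound)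
        qed
        have "norm (sd j n - sd j m) = norm (S j (\<tau> n) (Y (\<tau> n)) - S j (\<tau> n) (x (\<tau> n))
            - S j (\<tau> m) (Y (\<tau> m)) + S j (\<tau> m) (x (\<tau> m)))"
          unfolding sd_def by (subst norm_minus_cancel[symmetric]) (simp add: algebra_simps)
        also have "\<dots> \<le> K * norm (Y (\<tau> n) - x (\<tau> n) - Y (\<tau> m) + x (\<tau> m))
            + K * norm (Y (\<tau> m) - x (\<tau> m)) * (norm (x (\<tau> n) - x (\<tau> m)) powr \<kappa> + \<bar>\<tau> n - \<tau> m\<bar> powr \<beta>)"
          using that by (intro S_four \<tau>_in) auto
        also have "norm (Y (\<tau> n) - x (\<tau> n) - Y (\<tau> m) + x (\<tau> m)) = norm (e (\<tau> n) - e (\<tau> m))"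
          unfolding e_def by (subst norm_minus_cancel[symmetric]) (simp add: algebra_simps)
        also have "norm (Y (\<tau> m) - x (\<tau> m)) = norm (e (\<tau> m))"
          unfolding e_def by (rule norm_minus_commute)
        also have "K * norm (e (\<tau> n) - e (\<tau> m)) + K * norm (e (\<tau> m)) * (norm (x (\<tau> n) - x (\<tau> m)) powr \<kappa> + \<bar>\<tau> n - \<tau> m\<bar> powr \<beta>)
            \<le> K * norm (e (\<tau> n) - e (\<tau> m)) + K * norm (e (\<tau> m)) * (A powr \<kappa> * ?t powr \<mu> + T powr (\<beta> - \<mu>) * ?t powr \<mu>)"
          using nonneg by (intro add_left_mono mult_left_mono increments) auto
        finally show ?thesis
          by (simp add: K2_def algebra_simps)
      qed
      show "norm (d n) \<le> (E + L) * (norm (e (\<tau> n)) + R) * h" if "n < N" for n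
      proof -
        have 2: "\<tau> (Suc n) - \<tau> n = h"
          by (simp add: \<tau>_eq algebra_simps)
        have "norm (rem (\<tau> n) (\<tau> (Suc n))) \<le> E * h powr (2 * \<theta>)"
          using x_expansion[OF \<tau>_in[of n] \<tau>_in[of "Suc n"]] that h unfolding rem_def 2 by (simp add: \<tau>_eq)
        also have "h powr (2 * \<theta>) = R * h"
          using h powr_mult_base[of h "2 * \<theta> - 1"] by (simp add: R_def mult.commute)
        finally have "norm (rem (\<tau> n) (\<tau> (Suc n))) \<le> E * (R * h)" .
        moreover have "norm (h *\<^sub>R (b (\<tau> n) (x (\<tau> n)) - b (\<tau> n) (Y (\<tau> n)))) \<le> h * (L * norm (e (\<tau> n)))"
          using b_lip[OF \<tau>_in[of n], of "x (\<tau> n)" "Y (\<tau> n)"] that h by (simp add: e_def mult_left_mono)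
        ultimately have "norm (d n) \<le> E * (R * h) + h * (L * norm (e (\<tau> n)))"
          unfolding d_def by (intro order_trans[OF norm_triangle_ineq] add_mono)
        also have "\<dots> \<le> (E + L) * (norm (e (\<tau> n)) + R) * h"
          using nonneg h R by (simp add: algebra_simps)
        finally show ?thesis .
      qed
      show "\<bar>B j (\<tau> n) - B j (\<tau> m)\<bar> \<le> G * (h * (real n - real m)) powr \<theta>" if "m \<le> n" "n \<le> N" for j m n
      proof -
        have "\<bar>\<tau> n - \<tau> m\<bar> = h * (real n - real m)"
          using that h by (simp add: \<tau>_eq abs_mult algebra_simps flip: left_diff_distrib)
        then show ?thesis
          using B_holder[OF \<tau>_in[of m] \<tau>_in[of n], of j] that by simp
      qed
    qed (use T N h_def \<mu> \<theta> nonneg K2 R in auto)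
    from C0_bound[OF this] have grid_bound:
      "norm (e (\<tau> n) - e (\<tau> m)) \<le> C0 * R * (\<tau> n - \<tau> m) powr \<theta>" if "m \<le> n" "n \<le> N" for m n
      using that Y0 by (simp add: e_def \<tau>_eq algebra_simps)
    have grid_sup: "norm (e (\<tau> n)) \<le> C0 * T powr \<theta> * R" if "n \<le> N" for n
    proof -
      have "norm (e (\<tau> n)) \<le> C0 * R * \<tau> n powr \<theta>"
        using grid_bound[of 0 n] that Y0 by (simp add: e_def \<tau>_eq)
      also have "\<dots> \<le> C0 * R * T powr \<theta>"
        using \<tau>_in[OF that] C0 R \<theta> by (intro mult_left_mono powr_mono2) auto
      finally show ?thesis
        by (simp add: mult_ac)
    qed
    have h_powr: "r powr p \<le> T powr (p - (2 * \<theta> - 1)) * R" if "2 * \<theta> - 1 \<le> p" "0 \<le> r" "r \<le> h" for p r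
    proof -
      have "r powr p \<le> h powr p"
        using that \<theta> by (intro powr_mono2) auto
      also have "\<dots> \<le> T powr (p - (2 * \<theta> - 1)) * R"
        unfolding R_def using that h hT by (intro powr_le_powr_bound) auto
      finally show ?thesis .
    qed
    have cell: "norm (e s - e u) \<le> C1 * R * (s - u) powr \<theta>"
      if n: "n < N" and u: "\<tau> n \<le> u" "u \<le> s" "s \<le> \<tau> (Suc n)" for n u s
    proof -
      have in_T: "u \<in> {0..T}" "s \<in> {0..T}" "\<tau> n \<in> {0..T}"
        using \<tau>_in[of n] \<tau>_in[of "Suc n"] n u by auto
      have len: "0 \<le> u - \<tau> n" "u - \<tau> n \<le> h" "0 \<le> s - u" "s - u \<le> h"
        using u by (auto simp: \<tau>_eq algebra_simps)
      have x_dist: "norm (x u - Y (\<tau> n)) \<le> c\<^sub>x * R"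
      proof -
        have "norm (x u - Y (\<tau> n)) \<le> norm (x u - x (\<tau> n)) + norm (e (\<tau> n))"
          unfolding e_def by (rule norm_triangle_sub[of "x u - Y (\<tau> n)" "x (\<tau> n) - Y (\<tau> n)", simplified, THEN order_trans]) simp
        also have "norm (x u - x (\<tau> n)) \<le> A * (u - \<tau> n) powr \<theta>"
          using x_holder[OF in_T(3,1)] len by simp
        also have "(u - \<tau> n) powr \<theta> \<le> T powr (\<theta> - (2 * \<theta> - 1)) * R"
          using len \<theta> by (intro h_powr) auto
        also have "norm (e (\<tau> n)) \<le> C0 * T powr \<theta> * R"
          using n by (intro grid_sup) auto
        finally show ?thesis
          using nonneg by (simp add: c\<^sub>x_def algebra_simps mult_right_mono)
      qed
      have S_dist: "norm (S j u (x u) - S j (\<tau> n) (Y (\<tau> n))) \<le> c\<^sub>S * R" for j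
      proof -
        have "norm (S j u (x u) - S j (\<tau> n) (Y (\<tau> n)))
            \<le> norm (S j u (x u) - S j (\<tau> n) (x u)) + norm (S j (\<tau> n) (x u) - S j (\<tau> n) (Y (\<tau> n)))"
          by (rule norm_diff_triangle_le[OF order_refl order_refl])
        also have "\<dots> \<le> K * \<bar>u - \<tau> n\<bar> powr \<beta> + K * norm (x u - Y (\<tau> n))"
          using in_T by (intro add_mono S_time S_lip) auto
        also have "\<dots> \<le> K * (T powr (\<beta> - (2 * \<theta> - 1)) * R) + K * (c\<^sub>x * R)"
          using len nonneg \<theta> \<beta> h_powr[of \<beta> "u - \<tau> n"] by (intro add_mono mult_left_mono x_dist) auto
        finally show ?thesis
          by (simp add: c\<^sub>S_def algebra_simps)
      qed
      have b_dist: "norm (b u (x u) - b (\<tau> n) (Y (\<tau> n))) \<le> c\<^sub>b * R"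
      proof -
        have "norm (b u (x u) - b (\<tau> n) (Y (\<tau> n)))
            \<le> norm (b u (x u) - b (\<tau> n) (x u)) + norm (b (\<tau> n) (x u) - b (\<tau> n) (Y (\<tau> n)))"
          by (rule norm_diff_triangle_le[OF order_refl order_refl])
        also have "\<dots> \<le> C\<^sub>b * \<bar>u - \<tau> n\<bar> powr \<gamma> + L * norm (x u - Y (\<tau> n))"
          using in_T by (intro add_mono b_time b_lip) auto
        also have "\<dots> \<le> C\<^sub>b * (T powr (\<gamma> - (2 * \<theta> - 1)) * R) + L * (c\<^sub>x * R)"
          using len nonneg \<gamma> h_powr[of \<gamma> "u - \<tau> n"] by (intro add_mono mult_left_mono x_dist) auto
        finally show ?thesis
          by (simp add: c\<^sub>b_def algebra_simps)
      qed
      have Y_diff: "Y s - Y u = (s - u) *\<^sub>R b (\<tau> n) (Y (\<tau> n))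
          + (\<Sum>j\<in>UNIV. (B j s - B j u) *\<^sub>R S j (\<tau> n) (Y (\<tau> n)))"
        using Y_step[OF n, of s] Y_step[OF n, of u] u
        by (simp add: scaleR_diff_left sum_subtractf)
      have e_diff: "e s - e u = rem u s
          + (\<Sum>j\<in>UNIV. (B j s - B j u) *\<^sub>R (S j u (x u) - S j (\<tau> n) (Y (\<tau> n))))
          + (s - u) *\<^sub>R (b u (x u) - b (\<tau> n) (Y (\<tau> n)))"
      proof -
        have "e s - e u = (x s - x u) - (Y s - Y u)"
          by (simp add: e_def)
        then show ?thesis
          unfolding Y_diff rem_def by (simp add: scaleR_diff_right sum_subtractf)
      qed
      have 1: "norm (rem u s) \<le> E * T powr (1 - \<theta>) * R * (s - u) powr \<theta>"
      proof -
        have "norm (rem u s) \<le> E * (s - u) powr (2 * \<theta>)"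
          unfolding rem_def using in_T u by (intro x_expansion) auto
        also have "(s - u) powr (2 * \<theta>) = (s - u) powr \<theta> * (s - u) powr \<theta>"
          by (simp flip: powr_add)
        also have "\<dots> \<le> (T powr (\<theta> - (2 * \<theta> - 1)) * R) * (s - u) powr \<theta>"
          using len \<theta> by (intro mult_right_mono h_powr) auto
        finally show ?thesis
          using nonneg by (simp add: mult_right_mono mult_ac)
      qed
      have 2: "norm (\<Sum>j\<in>UNIV. (B j s - B j u) *\<^sub>R (S j u (x u) - S j (\<tau> n) (Y (\<tau> n))))
          \<le> real CARD('j) * G * c\<^sub>S * R * (s - u) powr \<theta>"
      proof -
        have "norm (\<Sum>j\<in>UNIV. (B j s - B j u) *\<^sub>R (S j u (x u) - S j (\<tau> n) (Y (\<tau> n))))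
            \<le> (\<Sum>j\<in>(UNIV::'j set). G * (s - u) powr \<theta> * (c\<^sub>S * R))"
          using B_holder[OF in_T(1,2)] len nonneg
          by (intro order_trans[OF norm_sum] sum_mono) (auto intro!: mult_mono S_dist)
        then show ?thesis
          by (simp add: mult_ac)
      qed
      have 3: "norm ((s - u) *\<^sub>R (b u (x u) - b (\<tau> n) (Y (\<tau> n)))) \<le> c\<^sub>b * T powr (1 - \<theta>) * R * (s - u) powr \<theta>"
      proof -
        have "norm ((s - u) *\<^sub>R (b u (x u) - b (\<tau> n) (Y (\<tau> n)))) \<le> (s - u) * (c\<^sub>b * R)"
          using len b_dist by (simp add: mult_left_mono)
        also have "s - u \<le> T powr (1 - \<theta>) * (s - u) powr \<theta>"
          using powr_le_powr_bound[of "s - u" T \<theta> 1] len hT \<theta> by simp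
        finally show ?thesis
          using c_nonneg R by (simp add: mult_right_mono mult_ac)
      qed
      have "norm (e s - e u) \<le> E * T powr (1 - \<theta>) * R * (s - u) powr \<theta>
          + real CARD('j) * G * c\<^sub>S * R * (s - u) powr \<theta> + c\<^sub>b * T powr (1 - \<theta>) * R * (s - u) powr \<theta>"
        unfolding e_diff by (intro order_trans[OF norm_triangle_ineq] add_mono 1 2 3)
      then show ?thesis
        by (simp add: C1_def algebra_simps)
    qed
    have ordered: "norm (e t - e s) \<le> (2 * C1 + C0) * R * (t - s) powr \<theta>"
      if st: "s \<in> {0..T}" "t \<in> {0..T}" "s \<le> t" for s t
    proof -
      obtain m n where m: "m < N" "\<tau> m \<le> s" "s \<le> \<tau> (Suc m)" and n: "n < N" "\<tau> n \<le> t" "t \<le> \<tau> (Suc n)"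
        using grid_cover[OF T N st(1)] grid_cover[OF T N st(2)] by (auto simp: \<tau>_def)
      consider "\<tau> m \<le> s" "t \<le> \<tau> (Suc m)" | "Suc m \<le> n" "\<tau> (Suc m) < t"
      proof (cases "t \<le> \<tau> (Suc m)")
        case False
        then have "\<tau> (Suc m) < \<tau> (Suc n)"
          using n by simp
        then have "Suc m \<le> n"
          using h by (simp add: \<tau>_eq)
        with False that show ?thesis by simp
      qed (use m that in auto)
      then show ?thesis
      proof cases
        case 1
        then have "norm (e t - e s) \<le> C1 * R * (t - s) powr \<theta>"
          using m st by (intro cell) auto
        also have "\<dots> \<le> (2 * C1 + C0) * R * (t - s) powr \<theta>"
          using c_nonneg C0 R by (intro mult_right_mono) auto
        finally show ?thesis .
      next
        case 2
        have mono: "\<tau> (Suc m) \<le> \<tau> n"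
          using 2 h mult_right_mono[of "real (Suc m)" "real n" h] by (simp add: \<tau>_eq)
        have "norm (e t - e s) \<le> norm (e t - e (\<tau> n)) + (norm (e (\<tau> n) - e (\<tau> (Suc m))) + norm (e (\<tau> (Suc m)) - e s))"
          by (intro norm_diff_triangle_le[OF order_refl] norm_diff_triangle_le[OF order_refl order_refl])
        also have "\<dots> \<le> C1 * R * (t - \<tau> n) powr \<theta> + (C0 * R * (\<tau> n - \<tau> (Suc m)) powr \<theta> + C1 * R * (\<tau> (Suc m) - s) powr \<theta>)"
          using m n 2 by (intro add_mono cell grid_bound) auto
        also have "\<dots> \<le> C1 * R * (t - s) powr \<theta> + (C0 * R * (t - s) powr \<theta> + C1 * R * (t - s) powr \<theta>)"
          using m n mono c_nonneg C0 R \<theta> by (intro add_mono mult_left_mono powr_mono2) auto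
        finally show ?thesis
          by (simp add: algebra_simps)
      qed
    qed
    have "norm (e t - e s) \<le> (2 * C1 + C0) * R * \<bar>t - s\<bar> powr \<theta>"
      using ordered[OF st] ordered[OF st(2,1)]
      by (cases "s \<le> t") (auto simp: norm_minus_commute abs_minus_commute)
    then show ?thesis
      by (simp add: e_def R_def h_def)
  qed
  show ?thesis
  proof (intro exI[of _ "2 * C1 + C0"] conjI allI impI ballI)
    show "0 \<le> 2 * C1 + C0"
      using c_nonneg C0 by simp
  qed (rule main; assumption)
qed

lemma norm_le_vnorm: "norm x \<le> vnorm x"
  unfolding vnorm_def by (rule norm_le_l1_cart)

lemma vnorm_le_norm: "vnorm (x :: real ^ 'd) \<le> real CARD('d) * norm x"
  unfolding vnorm_def using sum_bounded_above[of UNIV "\<lambda>i. \<bar>x $ i\<bar>" "norm x"]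
  by (simp add: component_le_norm_cart)

lemma vnorm_nonneg: "0 \<le> vnorm x"
  unfolding vnorm_def by (rule sum_nonneg) simp

lemma mnorm_nonneg: "0 \<le> mnorm A"
  unfolding mnorm_def by (intro sum_nonneg) simp

lemma norm_le_mnorm: "norm A \<le> mnorm A"
proof -
  have "norm A \<le> (\<Sum>i\<in>UNIV. norm (A $ i))"
    unfolding norm_vec_def[of A] by (rule L2_set_le_sum) simp
  also have "\<dots> \<le> mnorm A"
    unfolding mnorm_def by (intro sum_mono norm_le_l1_cart)
  finally show ?thesis .
qed

lemma norm_column_le: "norm (column j A) \<le> norm (A :: real ^ 'm ^ 'd)"
  unfolding norm_vec_def[of "column j A"] norm_vec_def[of A]
  by (intro L2_set_mono) (auto simp: column_def component_le_norm_cart)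

lemma frechet_derivative_partial:
  assumes "f differentiable at y"
  shows "frechet_derivative f (at y) v = (\<Sum>i\<in>UNIV. v $ i *\<^sub>R partial_deriv i f y)"
proof -
  have lin: "linear (frechet_derivative f (at y))"
    using assms by (rule linear_frechet_derivative)
  have "v = (\<Sum>i\<in>UNIV. v $ i *\<^sub>R axis i 1)"
    using basis_expansion[of v] by (simp add: scalar_mult_eq_scaleR)
  then have "frechet_derivative f (at y) v = frechet_derivative f (at y) (\<Sum>i\<in>UNIV. v $ i *\<^sub>R axis i 1)"
    by simp
  also have "\<dots> = (\<Sum>i\<in>UNIV. v $ i *\<^sub>R partial_deriv i f y)"
    by (simp add: linear_sum[OF lin] linear_cmul[OF lin] partial_deriv_def)
  finally show ?thesis .
qed

text \<open>
  Only \<open>y' - z'\<close> is raised to the power \<open>\<kappa>\<close>. Taking the exact solution for \<open>y'\<close> and \<open>z'\<close> avoids any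
  uniform Hoelder bound on the Euler approximations.
\<close>

lemma cond_A_four_point:
  assumes A: "cond_A T K \<beta> \<kappa> \<sigma>" and st: "s \<in> {0..T}" "t \<in> {0..T}"
  shows "norm (\<sigma> t y - \<sigma> t y' - \<sigma> s z + \<sigma> s z')
    \<le> K * vnorm (y - y' - z + z') + K * vnorm (z - z') * (vnorm (y' - z') powr \<kappa> + \<bar>t - s\<bar> powr \<beta>)"
proof -
  define v where "v = z - z'"
  have "norm (\<sigma> t y - \<sigma> t (y' + v)) \<le> K * vnorm (y - (y' + v))"
    using A st norm_le_mnorm order_trans unfolding cond_A_def by blast
  then have 1: "norm (\<sigma> t y - \<sigma> t (y' + v)) \<le> K * vnorm (y - y' - z + z')"
    by (simp add: v_def algebra_simps)
  define \<phi> where "\<phi> = (\<lambda>l. \<sigma> t (y' + l *\<^sub>R v) - \<sigma> s (z' + l *\<^sub>R v))"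
  define \<phi>' where "\<phi>' = (\<lambda>l. frechet_derivative (\<sigma> t) (at (y' + l *\<^sub>R v)) v - frechet_derivative (\<sigma> s) (at (z' + l *\<^sub>R v)) v)"
  have diff: "\<sigma> r differentiable at x" if "r \<in> {0..T}" for r x
    using A that by (simp add: cond_A_def)
  have line: "((\<lambda>l. \<sigma> r (x + l *\<^sub>R v)) has_derivative (\<lambda>h. h *\<^sub>R frechet_derivative (\<sigma> r) (at (x + l *\<^sub>R v)) v)) (at l)"
    if "r \<in> {0..T}" for r x l
  proof -
    have "(\<sigma> r has_derivative frechet_derivative (\<sigma> r) (at (x + l *\<^sub>R v))) (at (x + l *\<^sub>R v))"
      using diff[OF that] by (simp add: frechet_derivative_works)
    moreover have "((\<lambda>l. x + l *\<^sub>R v) has_derivative (\<lambda>h. h *\<^sub>R v)) (at l)"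
      by (auto intro!: derivative_eq_intros)
    ultimately have "((\<lambda>l. \<sigma> r (x + l *\<^sub>R v)) has_derivative (\<lambda>h. frechet_derivative (\<sigma> r) (at (x + l *\<^sub>R v)) (h *\<^sub>R v))) (at l)"
      by (rule has_derivative_compose[rotated])
    then show ?thesis
      by (simp add: linear_cmul[OF linear_frechet_derivative[OF diff[OF that]]])
  qed
  have \<phi>_deriv: "(\<phi> has_derivative (\<lambda>h. h *\<^sub>R \<phi>' l)) (at l)" for l
    unfolding \<phi>_def \<phi>'_def scaleR_diff_right using st by (intro has_derivative_diff line)
  have "\<exists>l\<in>{0<..<1}. norm (\<phi> 1 - \<phi> 0) \<le> norm ((1 - 0) *\<^sub>R \<phi>' l)"
    by (rule mvt_general)
      (auto intro!: \<phi>_deriv continuous_at_imp_continuous_on has_derivative_continuous[OF \<phi>_deriv])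
  then obtain l where l: "norm (\<phi> 1 - \<phi> 0) \<le> norm (\<phi>' l)"
    by auto
  define p where "p = y' + l *\<^sub>R v"
  define q where "q = z' + l *\<^sub>R v"
  have partial: "norm (partial_deriv i (\<sigma> t) p - partial_deriv i (\<sigma> s) q)
      \<le> K * (vnorm (y' - z') powr \<kappa> + \<bar>t - s\<bar> powr \<beta>)" for i
  proof -
    have "norm (partial_deriv i (\<sigma> t) p - partial_deriv i (\<sigma> t) q) \<le> K * vnorm (p - q) powr \<kappa>"
      using A st norm_le_mnorm order_trans unfolding cond_A_def by blast
    moreover have "norm (partial_deriv i (\<sigma> t) q - partial_deriv i (\<sigma> s) q) \<le> K * \<bar>t - s\<bar> powr \<beta>"
    proof -
      have "mnorm (\<sigma> t q - \<sigma> s q) + mnorm (partial_deriv i (\<sigma> t) q - partial_deriv i (\<sigma> s) q) \<le> K * \<bar>t - s\<bar> powr \<beta>"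
        using A st unfolding cond_A_def by blast
      then show ?thesis
        using mnorm_nonneg[of "\<sigma> t q - \<sigma> s q"]
          norm_le_mnorm[of "partial_deriv i (\<sigma> t) q - partial_deriv i (\<sigma> s) q"] by linarith
    qed
    moreover have "p - q = y' - z'"
      by (simp add: p_def q_def)
    ultimately show ?thesis
      using norm_diff_triangle_le[of "partial_deriv i (\<sigma> t) p" "partial_deriv i (\<sigma> t) q" _ "partial_deriv i (\<sigma> s) q"]
      by (simp add: algebra_simps)
  qed
  have "\<phi>' l = (\<Sum>i\<in>UNIV. v $ i *\<^sub>R (partial_deriv i (\<sigma> t) p - partial_deriv i (\<sigma> s) q))"
    unfolding \<phi>'_def p_def[symmetric] q_def[symmetric] frechet_derivative_partial[OF diff[OF st(1)]]
      frechet_derivative_partial[OF diff[OF st(2)]]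
    by (simp add: scaleR_diff_right sum_subtractf)
  then have "norm (\<phi>' l) \<le> (\<Sum>i\<in>UNIV. \<bar>v $ i\<bar> * (K * (vnorm (y' - z') powr \<kappa> + \<bar>t - s\<bar> powr \<beta>)))"
    using partial by (auto intro!: order_trans[OF norm_sum] sum_mono mult_left_mono)
  also have "\<dots> = K * vnorm (z - z') * (vnorm (y' - z') powr \<kappa> + \<bar>t - s\<bar> powr \<beta>)"
    unfolding vnorm_def[of "z - z'"] v_def by (simp add: mult_ac sum_distrib_left sum_distrib_right)
  finally have "norm (\<phi> 1 - \<phi> 0) \<le> K * vnorm (z - z') * (vnorm (y' - z') powr \<kappa> + \<bar>t - s\<bar> powr \<beta>)"
    using l by linarith
  moreover have eq: "\<sigma> t y - \<sigma> t y' - \<sigma> s z + \<sigma> s z' = (\<sigma> t y - \<sigma> t (y' + v)) + (\<phi> 1 - \<phi> 0)"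
    by (simp add: \<phi>_def v_def)
  ultimately show ?thesis
    unfolding eq using 1 norm_triangle_ineq[of "\<sigma> t y - \<sigma> t (y' + v)" "\<phi> 1 - \<phi> 0"] by linarith
qed

lemma weyl_left_cong:
  assumes "a < s" "\<And>u. a < u \<Longrightarrow> u \<le> s \<Longrightarrow> f u = f' u"
  shows "weyl_left \<alpha> a f s = weyl_left \<alpha> a f' s"
proof -
  have "(LBINT u:{a<..<s}. (f s - f u) / (s - u) powr (\<alpha> + 1)) = (LBINT u:{a<..<s}. (f' s - f' u) / (s - u) powr (\<alpha> + 1))"
    using assms by (intro set_lebesgue_integral_cong) auto
  then show ?thesis
    unfolding weyl_left_def using assms by simp
qed

lemma pathwise_integral_cong:
  assumes "\<And>u. a < u \<Longrightarrow> u < b \<Longrightarrow> f u = f' u" "\<And>u. a < u \<Longrightarrow> u \<le> b \<Longrightarrow> g u = g' u"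
  shows "pathwise_integral \<alpha> a b f g = pathwise_integral \<alpha> a b f' g'"
  unfolding pathwise_integral_reflect
proof (intro arg_cong[where f = uminus] set_lebesgue_integral_cong allI impI)
  fix s assume s: "s \<in> {a<..<b}"
  have "weyl_left \<alpha> a f s = weyl_left \<alpha> a f' s"
    using s assms(1) by (intro weyl_left_cong) auto
  moreover have "weyl_mirror \<alpha> b g s = weyl_mirror \<alpha> b g' s"
    using s assms(2) by (intro weyl_left_cong) auto
  ultimately show "weyl_left \<alpha> a f s * weyl_mirror \<alpha> b g s
      = weyl_left \<alpha> a f' s * weyl_mirror \<alpha> b g' s"
    by simp
qed auto

lemma holder_bound_clamp:
  assumes "0 \<le> T" "0 \<le> F" "0 \<le> \<nu>" "\<And>s t. s \<in> {0..T} \<Longrightarrow> t \<in> {0..T} \<Longrightarrow> \<bar>f t - f s\<bar> \<le> F * \<bar>t - s\<bar> powr \<nu>"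
  shows "holder_bound F \<nu> (\<lambda>s. f (max 0 (min T s)))"
  unfolding holder_bound_def
proof (intro allI)
  fix s t :: real
  have "\<bar>f (max 0 (min T t)) - f (max 0 (min T s))\<bar> \<le> F * \<bar>max 0 (min T t) - max 0 (min T s)\<bar> powr \<nu>"
    using assms(1) by (intro assms(4)) auto
  also have "\<dots> \<le> F * \<bar>t - s\<bar> powr \<nu>"
    using assms(1-3) by (intro mult_left_mono powr_mono2) auto
  finally show "\<bar>f (max 0 (min T t)) - f (max 0 (min T s))\<bar> \<le> F * \<bar>t - s\<bar> powr \<nu>" .
qed

lemma pathwise_integral_increment:
  assumes T: "0 < T" and \<alpha>: "0 < \<alpha>" "\<alpha> < 1" "\<alpha> < \<theta>" "1 - \<alpha> < \<theta>" and nonneg: "0 \<le> F" "0 \<le> G"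
  defines "c \<equiv> (1 + \<alpha> / (\<theta> - \<alpha>)) * (1 + (1 - \<alpha>) / (\<theta> - (1 - \<alpha>))) / (Gamma \<alpha> * Gamma (1 - \<alpha>))"
  assumes f: "\<And>s t. s \<in> {0..T} \<Longrightarrow> t \<in> {0..T} \<Longrightarrow> \<bar>f t - f s\<bar> \<le> F * \<bar>t - s\<bar> powr \<theta>"
    and g: "\<And>s t. s \<in> {0..T} \<Longrightarrow> t \<in> {0..T} \<Longrightarrow> \<bar>g t - g s\<bar> \<le> G * \<bar>t - s\<bar> powr \<theta>"
    and us: "0 \<le> u" "u < s" "s \<le> T"
  shows "\<bar>pathwise_integral \<alpha> 0 s f g - pathwise_integral \<alpha> 0 u f g - f u * (g s - g u)\<bar>
    \<le> c * F * G * (s - u) powr (2 * \<theta>)"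
proof -
  define f' where "f' = (\<lambda>s. f (max 0 (min T s)))"
  define g' where "g' = (\<lambda>s. g (max 0 (min T s)))"
  have f': "holder_bound F \<theta> f'" and g': "holder_bound G \<theta> g'"
    unfolding f'_def g'_def using T \<alpha> nonneg f g by (intro holder_bound_clamp; simp)+
  have eq: "pathwise_integral \<alpha> 0 r f g = pathwise_integral \<alpha> 0 r f' g'" if "r \<le> T" for r
    using that by (intro pathwise_integral_cong) (auto simp: f'_def g'_def min_absorb2 max_absorb2)
  have "pathwise_integral \<alpha> 0 s f' g' - pathwise_integral \<alpha> 0 u f' g' = pathwise_integral \<alpha> u s f' g'"
  proof (cases "u = 0")
    case True
    then show ?thesis
      by (simp add: pathwise_integral_def set_lebesgue_integral_def)
  next
    case False
    then show ?thesis
      using young_additive[OF f' g' \<alpha>, of 0 u s] us by simp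
  qed
  moreover have "\<bar>pathwise_integral \<alpha> u s f' g' - f' u * (g' s - g' u)\<bar> \<le> c * F * G * (s - u) powr (\<theta> + \<theta>)"
    unfolding c_def by (rule young_bound[OF f' g' \<alpha> us(2)])
  moreover have "f' u = f u" "g' s = g s" "g' u = g u"
    using us by (auto simp: f'_def g'_def min_def max_def)
  ultimately show ?thesis
    using us by (simp add: eq)
qed

lemma set_integral_increment:
  fixes h :: "real \<Rightarrow> real"
  assumes h: "set_integrable lborel {0..s} h" and us: "0 \<le> u" "u \<le> s"
    and bound: "\<And>r. r \<in> {u<..s} \<Longrightarrow> \<bar>h r - c\<bar> \<le> e"
  shows "\<bar>(LBINT r:{0..s}. h r) - (LBINT r:{0..u}. h r) - c * (s - u)\<bar> \<le> e * (s - u)"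
proof -
  have 1: "set_integrable lborel {0..u} h" "set_integrable lborel {u<..s} h"
    using us by (auto intro: set_integrable_subset[OF h])
  have "{0..s} = {0..u} \<union> {u<..s}" "{0..u} \<inter> {u<..s} = {}"
    using us by auto
  then have split: "(LBINT r:{0..s}. h r) = (LBINT r:{0..u}. h r) + (LBINT r:{u<..s}. h r)"
    using set_integral_Un[OF _ 1] by simp
  have const: "set_integrable lborel {u<..s} (\<lambda>r. k)" "(LBINT r:{u<..s}. k) = k * (s - u)" for k
    using us by (simp_all add: set_integrable_def set_integral_const)
  have "h r \<le> c + e" "c - e \<le> h r" if "r \<in> {u<..s}" for r
    using bound[OF that] by (auto simp: abs_le_iff)
  then have "(LBINT r:{u<..s}. h r) \<le> (LBINT r:{u<..s}. c + e)"
    "(LBINT r:{u<..s}. c - e) \<le> (LBINT r:{u<..s}. h r)"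
    by (auto intro!: set_integral_mono 1 const(1))
  then show ?thesis
    unfolding split const by (simp add: algebra_simps abs_le_iff)
qed

lemma solution_expansion:
  fixes x :: "real \<Rightarrow> real ^ 'd" and \<sigma> :: "real \<Rightarrow> real ^ 'd \<Rightarrow> real ^ 'm ^ 'd"
    and b :: "real \<Rightarrow> real ^ 'd \<Rightarrow> real ^ 'd" and B :: "'m \<Rightarrow> real \<Rightarrow> real"
  assumes T: "0 < T" and \<alpha>: "0 < \<alpha>" "\<alpha> < 1" "\<alpha> < \<theta>" "1 - \<alpha> < \<theta>" and nonneg: "0 \<le> F" "0 \<le> F\<^sub>b" "0 \<le> G"
    and \<sigma>_holder: "\<And>i j s t. s \<in> {0..T} \<Longrightarrow> t \<in> {0..T} \<Longrightarrow> \<bar>\<sigma> t (x t) $ i $ j - \<sigma> s (x s) $ i $ j\<bar> \<le> F * \<bar>t - s\<bar> powr \<theta>"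
    and b_holder: "\<And>i s t. s \<in> {0..T} \<Longrightarrow> t \<in> {0..T} \<Longrightarrow> \<bar>b t (x t) $ i - b s (x s) $ i\<bar> \<le> F\<^sub>b * \<bar>t - s\<bar> powr (2 * \<theta> - 1)"
    and B_holder: "\<And>j s t. s \<in> {0..T} \<Longrightarrow> t \<in> {0..T} \<Longrightarrow> \<bar>B j t - B j s\<bar> \<le> G * \<bar>t - s\<bar> powr \<theta>"
    and b_int: "\<And>t i. t \<in> {0..T} \<Longrightarrow> set_integrable lborel {0..t} (\<lambda>s. b s (x s) $ i)"
    and sol: "\<And>t i. t \<in> {0..T} \<Longrightarrow> x t $ i = x\<^sub>0 $ i
      + (\<Sum>j\<in>UNIV. pathwise_integral \<alpha> 0 t (\<lambda>s. \<sigma> s (x s) $ i $ j) (B j)) + (LBINT s:{0..t}. b s (x s) $ i)"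
  shows "\<exists>E\<ge>0. \<forall>u\<in>{0..T}. \<forall>s\<in>{0..T}. u \<le> s \<longrightarrow>
    norm (x s - x u - (\<Sum>j\<in>UNIV. (B j s - B j u) *\<^sub>R column j (\<sigma> u (x u))) - (s - u) *\<^sub>R b u (x u))
      \<le> E * (s - u) powr (2 * \<theta>)"
proof -
  define c where "c = (1 + \<alpha> / (\<theta> - \<alpha>)) * (1 + (1 - \<alpha>) / (\<theta> - (1 - \<alpha>))) / (Gamma \<alpha> * Gamma (1 - \<alpha>))"
  have c: "0 \<le> c"
    unfolding c_def using \<alpha> Gamma_real_pos[of \<alpha>] Gamma_real_pos[of "1 - \<alpha>"]
    by (intro divide_nonneg_nonneg mult_nonneg_nonneg add_nonneg_nonneg) auto
  define E where "E = real CARD('m) * (c * F * G) + F\<^sub>b"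
  have E: "0 \<le> E"
    using c nonneg by (simp add: E_def)
  let ?rem = "\<lambda>u s. x s - x u - (\<Sum>j\<in>UNIV. (B j s - B j u) *\<^sub>R column j (\<sigma> u (x u))) - (s - u) *\<^sub>R b u (x u)"
  have comp: "\<bar>?rem u s $ i\<bar> \<le> E * (s - u) powr (2 * \<theta>)" if us: "u \<in> {0..T}" "s \<in> {0..T}" "u < s" for u s i
  proof -
    let ?P = "\<lambda>j. pathwise_integral \<alpha> 0 s (\<lambda>s. \<sigma> s (x s) $ i $ j) (B j)
      - pathwise_integral \<alpha> 0 u (\<lambda>s. \<sigma> s (x s) $ i $ j) (B j) - \<sigma> u (x u) $ i $ j * (B j s - B j u)"
    let ?Q = "(LBINT r:{0..s}. b r (x r) $ i) - (LBINT r:{0..u}. b r (x r) $ i) - b u (x u) $ i * (s - u)"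
    have "?rem u s $ i = x s $ i - x u $ i - (\<Sum>j\<in>UNIV. \<sigma> u (x u) $ i $ j * (B j s - B j u)) - b u (x u) $ i * (s - u)"
      by (simp add: column_def mult.commute)
    also have "\<dots> = (\<Sum>j\<in>UNIV. ?P j) + ?Q"
      unfolding sol[OF us(1)] sol[OF us(2)] by (simp add: sum_subtractf)
    finally have "\<bar>?rem u s $ i\<bar> \<le> (\<Sum>j\<in>UNIV. \<bar>?P j\<bar>) + \<bar>?Q\<bar>"
      by (simp only:) (rule order_trans[OF abs_triangle_ineq add_right_mono[OF sum_abs]])
    moreover have "(\<Sum>j\<in>UNIV. \<bar>?P j\<bar>) \<le> (\<Sum>j\<in>(UNIV :: 'm set). c * F * G * (s - u) powr (2 * \<theta>))"
      unfolding c_def using us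
      by (intro sum_mono pathwise_integral_increment[OF T \<alpha> nonneg(1,3)] \<sigma>_holder B_holder) auto
    moreover have "\<bar>?Q\<bar> \<le> F\<^sub>b * (s - u) powr (2 * \<theta> - 1) * (s - u)"
    proof (rule set_integral_increment)
      show "set_integrable lborel {0..s} (\<lambda>r. b r (x r) $ i)"
        by (rule b_int[OF us(2)])
      fix r assume r: "r \<in> {u<..s}"
      then have "\<bar>b r (x r) $ i - b u (x u) $ i\<bar> \<le> F\<^sub>b * \<bar>r - u\<bar> powr (2 * \<theta> - 1)"
        using us by (intro b_holder) auto
      also have "\<dots> \<le> F\<^sub>b * (s - u) powr (2 * \<theta> - 1)"
        using r nonneg \<alpha> by (intro mult_left_mono powr_mono2) auto
      finally show "\<bar>b r (x r) $ i - b u (x u) $ i\<bar> \<le> F\<^sub>b * (s - u) powr (2 * \<theta> - 1)" .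
    qed (use us in auto)
    moreover have "(s - u) powr (2 * \<theta> - 1) * (s - u) = (s - u) powr (2 * \<theta>)"
      using us powr_mult_base[of "s - u" "2 * \<theta> - 1"] by (simp add: mult.commute)
    ultimately show ?thesis
      by (simp add: E_def algebra_simps)
  qed
  have "norm (?rem u s) \<le> real CARD('d) * E * (s - u) powr (2 * \<theta>)" if "u \<in> {0..T}" "s \<in> {0..T}" "u \<le> s" for u s
  proof (cases "u = s")
    case False
    have "norm (?rem u s) \<le> (\<Sum>i\<in>UNIV. \<bar>?rem u s $ i\<bar>)"
      by (rule norm_le_l1_cart)
    also have "\<dots> \<le> (\<Sum>i\<in>(UNIV :: 'd set). E * (s - u) powr (2 * \<theta>))"
      using that False by (intro sum_mono comp) auto
    finally show ?thesis
      by simp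
  qed simp
  then show ?thesis
    using E by (intro exI[of _ "real CARD('d) * E"]) auto
qed

lemma euler_error_le:
  fixes x y :: "real \<Rightarrow> real ^ 'd"
  assumes T: "0 < T" and \<alpha>: "\<alpha> < \<theta>" "0 < \<theta>" and D: "0 \<le> D" and zero: "x 0 = y 0"
    and holder: "\<And>s t. s \<in> {0..T} \<Longrightarrow> t \<in> {0..T} \<Longrightarrow> norm ((x t - y t) - (x s - y s)) \<le> D * \<bar>t - s\<bar> powr \<theta>"
  shows "euler_error \<alpha> T N x y \<le> ennreal (real CARD('d) * D * (T powr \<theta> + T powr (\<theta> - \<alpha>) / (\<theta> - \<alpha>)))"
  unfolding euler_error_def
proof (rule SUP_least)
  fix s assume s: "s \<in> {0..T}"
  let ?n = "real CARD('d)"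
  have v: "vnorm (x s - y s - x u + y u) \<le> ?n * D * (s - u) powr \<theta>" if "0 \<le> u" "u \<le> s" for u
  proof -
    have eq: "x s - y s - x u + y u = (x s - y s) - (x u - y u)"
      by simp
    have "vnorm ((x s - y s) - (x u - y u)) \<le> ?n * norm ((x s - y s) - (x u - y u))"
      by (rule vnorm_le_norm)
    also have "\<dots> \<le> ?n * (D * \<bar>s - u\<bar> powr \<theta>)"
      using that s by (intro mult_left_mono holder) auto
    finally show ?thesis
      unfolding eq using that by (simp add: mult.assoc)
  qed
  have "vnorm (x s - y s) \<le> ?n * D * s powr \<theta>"
    using v[of 0] s zero by simp
  also have "\<dots> \<le> ?n * D * T powr \<theta>"
    using s D \<alpha> by (intro mult_left_mono powr_mono2) auto
  finally have 1: "ennreal (vnorm (x s - y s)) \<le> ennreal (?n * D * T powr \<theta>)"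
    by (rule ennreal_leI)
  have floor: "grid_floor T N s \<le> s"
  proof -
    have "finite {grid T N n | n. n \<le> N \<and> grid T N n \<le> s}"
      by (rule finite_subset[of _ "grid T N ` {..N}"]) auto
    moreover have "grid T N 0 \<in> {grid T N n | n. n \<le> N \<and> grid T N n \<le> s}"
      using s by (auto simp: grid_def intro!: exI[of _ 0])
    ultimately have "grid_floor T N s \<in> {grid T N n | n. n \<le> N \<and> grid T N n \<le> s}"
      unfolding grid_floor_def by (intro Max_in) auto
    then show ?thesis
      by auto
  qed
  have 2: "(\<integral>\<^sup>+u\<in>{0..grid_floor T N s}. ennreal (vnorm (x s - y s - x u + y u) * (s - u) powr (- \<alpha> - 1)) \<partial>lborel)
      \<le> ennreal (?n * D * (T powr (\<theta> - \<alpha>) / (\<theta> - \<alpha>)))"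
  proof (cases "s = 0")
    case False
    then have s0: "0 < s"
      using s by simp
    have int: "set_integrable lborel {0<..<s} (\<lambda>u. ?n * D * (s - u) powr (\<theta> - \<alpha> - 1))"
      using s0 \<alpha> by (intro set_integrable_mult_right powr_integral_right) auto
    have "(\<integral>\<^sup>+u\<in>{0..grid_floor T N s}. ennreal (vnorm (x s - y s - x u + y u) * (s - u) powr (- \<alpha> - 1)) \<partial>lborel)
        \<le> (\<integral>\<^sup>+u. ennreal (indicator {0<..<s} u *\<^sub>R (?n * D * (s - u) powr (\<theta> - \<alpha> - 1))) \<partial>lborel)"
    proof (rule nn_integral_mono_AE)
      have "AE u in lborel. u \<noteq> (0::real)" "AE u in lborel. u \<noteq> s"
        by (rule AE_lborel_singleton)+
      then show "AE u in lborel. ennreal (vnorm (x s - y s - x u + y u) * (s - u) powr (- \<alpha> - 1)) * indicator {0..grid_floor T N s} u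
          \<le> ennreal (indicator {0<..<s} u *\<^sub>R (?n * D * (s - u) powr (\<theta> - \<alpha> - 1)))"
      proof eventually_elim
        case (elim u)
        show ?case
        proof (cases "u \<in> {0..grid_floor T N s}")
          case True
          then have u: "0 < u" "u < s"
            using elim floor by auto
          have "vnorm (x s - y s - x u + y u) * (s - u) powr (- \<alpha> - 1)
              \<le> ?n * D * (s - u) powr \<theta> * (s - u) powr (- \<alpha> - 1)"
            using u v by (intro mult_right_mono) auto
          also have "\<dots> = ?n * D * (s - u) powr (\<theta> - \<alpha> - 1)"
            unfolding mult.assoc powr_add[symmetric] by (simp add: algebra_simps)
          finally show ?thesis
            using True u by (simp add: ennreal_leI)
        qed simp
      qed
    qed
    also have "\<dots> = ennreal (LBINT u:{0<..<s}. ?n * D * (s - u) powr (\<theta> - \<alpha> - 1))"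
      unfolding set_lebesgue_integral_def
      by (rule nn_integral_eq_integral[OF int[unfolded set_integrable_def]]) (use D in auto)
    also have "(LBINT u:{0<..<s}. ?n * D * (s - u) powr (\<theta> - \<alpha> - 1)) = ?n * D * (s powr (\<theta> - \<alpha>) / (\<theta> - \<alpha>))"
      using powr_integral_right(2)[of 0 s "\<theta> - \<alpha> - 1"] s0 \<alpha> by simp
    also have "ennreal \<dots> \<le> ennreal (?n * D * (T powr (\<theta> - \<alpha>) / (\<theta> - \<alpha>)))"
      using s s0 \<alpha> D by (intro ennreal_leI mult_left_mono divide_right_mono powr_mono2) auto
    finally show ?thesis .
  next
    case True
    have "(\<integral>\<^sup>+u\<in>{0..grid_floor T N s}. ennreal (vnorm (x s - y s - x u + y u) * (s - u) powr (- \<alpha> - 1)) \<partial>lborel)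
        = (\<integral>\<^sup>+(u::real). 0 \<partial>lborel)"
    proof (rule nn_integral_cong_AE)
      have "AE u in lborel. u \<noteq> (0::real)"
        by (rule AE_lborel_singleton)
      then show "AE u in lborel. ennreal (vnorm (x s - y s - x u + y u) * (s - u) powr (- \<alpha> - 1))
          * indicator {0..grid_floor T N s} u = 0"
        by eventually_elim (use floor True in auto)
    qed
    then show ?thesis by simp
  qed
  have "ennreal (?n * D * T powr \<theta>) + ennreal (?n * D * (T powr (\<theta> - \<alpha>) / (\<theta> - \<alpha>)))
      = ennreal (?n * D * (T powr \<theta> + T powr (\<theta> - \<alpha>) / (\<theta> - \<alpha>)))"
    using D \<alpha> by (subst ennreal_plus[symmetric]) (auto simp: algebra_simps)
  then show "ennreal (vnorm (x s - y s))
      + (\<integral>\<^sup>+u\<in>{0..grid_floor T N s}. ennreal (vnorm (x s - y s - x u + y u) * (s - u) powr (- \<alpha> - 1)) \<partial>lborel)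
      \<le> ennreal (?n * D * (T powr \<theta> + T powr (\<theta> - \<alpha>) / (\<theta> - \<alpha>)))"
    using add_mono[OF 1 2] by simp
qed

lemma euler_rate_pathwise:
  fixes x :: "real \<Rightarrow> real ^ 'd" and \<sigma> :: "real \<Rightarrow> real ^ 'd \<Rightarrow> real ^ 'm ^ 'd"
    and b :: "real \<Rightarrow> real ^ 'd \<Rightarrow> real ^ 'd" and B :: "'m \<Rightarrow> real \<Rightarrow> real"
  assumes T: "0 < T" and \<alpha>: "0 < \<alpha>" "\<alpha> < 1" "\<alpha> < \<theta>" "1 - \<alpha> < \<theta>" and \<theta>: "\<theta> < 1"
    and \<kappa>: "0 < \<kappa>" "\<kappa> \<le> 1" "1 < \<theta> + \<kappa> * \<theta>" and \<beta>: "\<theta> \<le> \<beta>" and \<gamma>: "2 * \<theta> - 1 \<le> \<gamma>"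
    and pos: "0 < K" "0 < L" "0 < C\<^sub>b"
    and A: "cond_A T K \<beta> \<kappa> \<sigma>" and b_cond: "cond_B T L b" and D: "cond_D1 T C\<^sub>b \<gamma> b"
    and B: "\<And>j. \<exists>G\<ge>0. \<forall>s\<in>{0..T}. \<forall>t\<in>{0..T}. \<bar>B j t - B j s\<bar> \<le> G * \<bar>t - s\<bar> powr \<theta>"
    and x: "holder_on \<theta> {0..T} x"
    and b_int: "\<And>t i. t \<in> {0..T} \<Longrightarrow> set_integrable lborel {0..t} (\<lambda>s. b s (x s) $ i)"
    and sol: "\<And>t i. t \<in> {0..T} \<Longrightarrow> x t $ i = x\<^sub>0 $ i
      + (\<Sum>j\<in>UNIV. pathwise_integral \<alpha> 0 t (\<lambda>s. \<sigma> s (x s) $ i $ j) (B j)) + (LBINT s:{0..t}. b s (x s) $ i)"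
  shows "\<exists>C. \<forall>N>0. \<forall>Y. euler_approximation T N b \<sigma> B x\<^sub>0 Y \<longrightarrow>
    euler_error \<alpha> T N x Y \<le> ennreal (C * (T / real N) powr (2 * \<theta> - 1))"
proof -
  define n where "n = real CARD('d)"
  have n: "1 \<le> n"
    by (simp add: n_def Suc_le_eq)
  have half: "1 / 2 < \<theta>"
    using \<alpha> by linarith
  obtain G\<^sub>j where Gj: "\<And>j. 0 \<le> G\<^sub>j j" "\<And>j s t. s \<in> {0..T} \<Longrightarrow> t \<in> {0..T} \<Longrightarrow> \<bar>B j t - B j s\<bar> \<le> G\<^sub>j j * \<bar>t - s\<bar> powr \<theta>"
    using B by metis
  define G where "G = (\<Sum>j\<in>UNIV. G\<^sub>j j)"
  have G: "0 \<le> G"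
    unfolding G_def using Gj(1) by (intro sum_nonneg) auto
  have B_holder: "\<bar>B j t - B j s\<bar> \<le> G * \<bar>t - s\<bar> powr \<theta>" if "s \<in> {0..T}" "t \<in> {0..T}" for j s t
  proof -
    have "G\<^sub>j j \<le> G"
      unfolding G_def using Gj(1) by (intro member_le_sum) auto
    then show ?thesis
      using Gj(2)[OF that, of j] by (meson mult_right_mono order_trans powr_ge_zero)
  qed
  obtain A\<^sub>0 where A0: "\<And>s t. s \<in> {0..T} \<Longrightarrow> t \<in> {0..T} \<Longrightarrow> vnorm (x t - x s) \<le> A\<^sub>0 * \<bar>t - s\<bar> powr \<theta>"
    using x unfolding holder_on_def by blast
  define A\<^sub>x where "A\<^sub>x = max 0 A\<^sub>0"
  have Ax: "0 \<le> A\<^sub>x"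
    by (simp add: A\<^sub>x_def)
  have x_vholder: "vnorm (x t - x s) \<le> A\<^sub>x * \<bar>t - s\<bar> powr \<theta>" if "s \<in> {0..T}" "t \<in> {0..T}" for s t
    using A0[OF that] mult_right_mono[of A\<^sub>0 A\<^sub>x "\<bar>t - s\<bar> powr \<theta>"] by (simp add: A\<^sub>x_def)
  have x_holder: "norm (x t - x s) \<le> A\<^sub>x * \<bar>t - s\<bar> powr \<theta>" if "s \<in> {0..T}" "t \<in> {0..T}" for s t
    using x_vholder[OF that] norm_le_vnorm order_trans by blast
  have \<sigma>_lip: "norm (\<sigma> t y - \<sigma> t z) \<le> K * vnorm (y - z)" if "t \<in> {0..T}" for t y z
    using A that norm_le_mnorm order_trans unfolding cond_A_def by blast
  have \<sigma>_time: "norm (\<sigma> t y - \<sigma> s y) \<le> K * \<bar>t - s\<bar> powr \<beta>" if "s \<in> {0..T}" "t \<in> {0..T}" for s t y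
  proof -
    have "mnorm (\<sigma> t y - \<sigma> s y) + mnorm (partial_deriv i (\<sigma> t) y - partial_deriv i (\<sigma> s) y) \<le> K * \<bar>t - s\<bar> powr \<beta>" for i
      using A that unfolding cond_A_def by blast
    from this[of undefined] show ?thesis
      using norm_le_mnorm[of "\<sigma> t y - \<sigma> s y"] mnorm_nonneg[of "partial_deriv undefined (\<sigma> t) y - partial_deriv undefined (\<sigma> s) y"]
      by linarith
  qed
  have b_vlip: "norm (b t y - b t z) \<le> L * vnorm (y - z)" if "t \<in> {0..T}" for t y z
    using b_cond that norm_le_vnorm order_trans unfolding cond_B_def by blast
  have b_time: "norm (b t y - b s y) \<le> C\<^sub>b * \<bar>t - s\<bar> powr \<gamma>" if "s \<in> {0..T}" "t \<in> {0..T}" for s t y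
    using D that norm_le_vnorm order_trans unfolding cond_D1_def by blast
  have powr_T: "\<bar>t - s\<bar> powr q \<le> T powr (q - p) * \<bar>t - s\<bar> powr p" if "s \<in> {0..T}" "t \<in> {0..T}" "p \<le> q" for s t p q
    using that by (intro powr_le_powr_bound) auto

  define F where "F = K * (T powr (\<beta> - \<theta>) + A\<^sub>x)"
  have \<sigma>_holder: "\<bar>\<sigma> t (x t) $ i $ j - \<sigma> s (x s) $ i $ j\<bar> \<le> F * \<bar>t - s\<bar> powr \<theta>"
    if st: "s \<in> {0..T}" "t \<in> {0..T}" for i j s t
  proof -
    have "\<bar>\<sigma> t (x t) $ i $ j - \<sigma> s (x s) $ i $ j\<bar> \<le> norm (\<sigma> t (x t) - \<sigma> s (x s))"
      using component_le_norm_cart[of "(\<sigma> t (x t) - \<sigma> s (x s)) $ i" j] Finite_Cartesian_Product.norm_nth_le[where x = "\<sigma> t (x t) - \<sigma> s (x s)" and i = i]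
      by simp
    also have "\<dots> \<le> norm (\<sigma> t (x t) - \<sigma> s (x t)) + norm (\<sigma> s (x t) - \<sigma> s (x s))"
      by (rule norm_diff_triangle_le[OF order_refl order_refl])
    also have "\<dots> \<le> K * \<bar>t - s\<bar> powr \<beta> + K * vnorm (x t - x s)"
      using st by (intro add_mono \<sigma>_time \<sigma>_lip)
    also have "\<dots> \<le> K * (T powr (\<beta> - \<theta>) * \<bar>t - s\<bar> powr \<theta>) + K * (A\<^sub>x * \<bar>t - s\<bar> powr \<theta>)"
      using pos st \<beta> by (intro add_mono mult_left_mono powr_T x_vholder) auto
    finally show ?thesis
      by (simp add: F_def algebra_simps)
  qed
  have F: "0 \<le> F"
    using pos Ax by (simp add: F_def)
  define F\<^sub>b where "F\<^sub>b = C\<^sub>b * T powr (\<gamma> - (2 * \<theta> - 1)) + L * A\<^sub>x * T powr (\<theta> - (2 * \<theta> - 1))"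
  have Fb: "0 \<le> F\<^sub>b"
    using pos Ax by (simp add: F\<^sub>b_def)
  have b_holder: "\<bar>b t (x t) $ i - b s (x s) $ i\<bar> \<le> F\<^sub>b * \<bar>t - s\<bar> powr (2 * \<theta> - 1)"
    if st: "s \<in> {0..T}" "t \<in> {0..T}" for i s t
  proof -
    have "\<bar>b t (x t) $ i - b s (x s) $ i\<bar> \<le> norm (b t (x t) - b s (x s))"
      using component_le_norm_cart[of "b t (x t) - b s (x s)" i] by simp
    also have "\<dots> \<le> norm (b t (x t) - b s (x t)) + norm (b s (x t) - b s (x s))"
      by (rule norm_diff_triangle_le[OF order_refl order_refl])
    also have "\<dots> \<le> C\<^sub>b * \<bar>t - s\<bar> powr \<gamma> + L * vnorm (x t - x s)"
      using st by (intro add_mono b_time b_vlip)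
    also have "\<dots> \<le> C\<^sub>b * \<bar>t - s\<bar> powr \<gamma> + L * (A\<^sub>x * \<bar>t - s\<bar> powr \<theta>)"
      using pos st by (intro add_mono mult_left_mono x_vholder) auto
    also have "\<dots> \<le> C\<^sub>b * (T powr (\<gamma> - (2 * \<theta> - 1)) * \<bar>t - s\<bar> powr (2 * \<theta> - 1))
        + L * (A\<^sub>x * (T powr (\<theta> - (2 * \<theta> - 1)) * \<bar>t - s\<bar> powr (2 * \<theta> - 1)))"
      using pos st \<gamma> \<theta> Ax by (intro add_mono mult_left_mono powr_T) auto
    finally show ?thesis
      by (simp add: F\<^sub>b_def algebra_simps)
  qed
  have "\<exists>E\<ge>0. \<forall>u\<in>{0..T}. \<forall>s\<in>{0..T}. u \<le> s \<longrightarrow>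
      norm (x s - x u - (\<Sum>j\<in>UNIV. (B j s - B j u) *\<^sub>R column j (\<sigma> u (x u))) - (s - u) *\<^sub>R b u (x u))
        \<le> E * (s - u) powr (2 * \<theta>)" (is "\<exists>E\<ge>0. ?P E")
    by (rule solution_expansion[where x = x and \<sigma> = \<sigma> and b = b and B = B and x\<^sub>0 = x\<^sub>0
          and F = F and F\<^sub>b = F\<^sub>b and G = G and \<alpha> = \<alpha>])
      (fact T \<alpha> F Fb G \<sigma>_holder b_holder B_holder b_int sol)+
  then obtain E where E: "0 \<le> E" and "?P E"
    by blast
  note expansion = this(2)[rule_format]

  define K' where "K' = K * n * n"
  have nn: "1 \<le> n * n"
    using n mult_mono[of 1 n 1 n] by simp
  have vn: "vnorm y \<le> n * norm y" for y :: "real ^ 'd"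
    unfolding n_def by (rule vnorm_le_norm)
  have vnn: "vnorm y \<le> n * n * norm y" for y :: "real ^ 'd"
  proof -
    have "n * norm y \<le> n * n * norm y"
      using n by (intro mult_right_mono) auto
    with vn[of y] show ?thesis by linarith
  qed
  have K': "0 \<le> K'" "K \<le> K'"
    using pos n nn by (auto simp: K'_def mult.assoc)
  have "(LBINT s:{0..0}. h s) = 0" for h :: "real \<Rightarrow> real"
    unfolding set_lebesgue_integral_def
    by (rule integral_eq_zero_AE) (use AE_lborel_singleton[of "0 :: real"] in \<open>eventually_elim, simp\<close>)
  then have x0: "x 0 = x\<^sub>0"
    using sol[of 0] T by (simp add: vec_eq_iff pathwise_integral_def set_lebesgue_integral_def)
  have "\<exists>C\<ge>0. \<forall>N>0. \<forall>Y. Y 0 = x 0 \<longrightarrow>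
    (\<forall>n<N. \<forall>t\<in>{grid T N n..grid T N (Suc n)}. Y t = Y (grid T N n)
        + (t - grid T N n) *\<^sub>R b (grid T N n) (Y (grid T N n))
        + (\<Sum>j\<in>UNIV. (B j t - B j (grid T N n)) *\<^sub>R column j (\<sigma> (grid T N n) (Y (grid T N n))))) \<longrightarrow>
    (\<forall>s\<in>{0..T}. \<forall>t\<in>{0..T}.
      norm ((x t - Y t) - (x s - Y s)) \<le> C * (T / real N) powr (2 * \<theta> - 1) * \<bar>t - s\<bar> powr \<theta>)" (is "\<exists>C\<ge>0. ?Q C")
  proof (rule euler_difference_holder[where S = "\<lambda>j t y. column j (\<sigma> t y)" and L = "L * n" and K = K' and C\<^sub>b = C\<^sub>b,
        OF T half \<theta> \<kappa> \<beta> \<gamma> K'(1) _ _ G Ax E])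
    have col: "column j P - column j Q = column j (P - Q)" for j and P Q :: "real ^ 'm ^ 'd"
      by (simp add: column_def vec_eq_iff)
    show "norm (column j (\<sigma> t y) - column j (\<sigma> t z)) \<le> K' * norm (y - z)" if "t \<in> {0..T}" for j t y z
    proof -
      have "norm (column j (\<sigma> t y) - column j (\<sigma> t z)) \<le> norm (\<sigma> t y - \<sigma> t z)"
        unfolding col by (rule norm_column_le)
      also have "\<dots> \<le> K * vnorm (y - z)"
        by (rule \<sigma>_lip[OF that])
      also have "\<dots> \<le> K * (n * n * norm (y - z))"
        using pos by (intro mult_left_mono vnn) auto
      finally show ?thesis
        by (simp add: K'_def mult.assoc)
    qed
    show "norm (column j (\<sigma> t y) - column j (\<sigma> s y)) \<le> K' * \<bar>t - s\<bar> powr \<beta>" if "s \<in> {0..T}" "t \<in> {0..T}" for j s t y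
    proof -
      have "norm (column j (\<sigma> t y) - column j (\<sigma> s y)) \<le> norm (\<sigma> t y - \<sigma> s y)"
        unfolding col by (rule norm_column_le)
      also have "\<dots> \<le> K * \<bar>t - s\<bar> powr \<beta>"
        by (rule \<sigma>_time[OF that])
      also have "\<dots> \<le> K' * \<bar>t - s\<bar> powr \<beta>"
        using K' by (intro mult_right_mono) auto
      finally show ?thesis .
    qed
    show "norm (column j (\<sigma> t y) - column j (\<sigma> t y') - column j (\<sigma> s z) + column j (\<sigma> s z'))
        \<le> K' * norm (y - y' - z + z') + K' * norm (z - z') * (norm (y' - z') powr \<kappa> + \<bar>t - s\<bar> powr \<beta>)"
      if "s \<in> {0..T}" "t \<in> {0..T}" for j s t y y' z z'
    proof -
      have "column j (\<sigma> t y) - column j (\<sigma> t y') - column j (\<sigma> s z) + column j (\<sigma> s z')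
          = column j (\<sigma> t y - \<sigma> t y' - \<sigma> s z + \<sigma> s z')"
        by (simp add: column_def vec_eq_iff)
      then have "norm (column j (\<sigma> t y) - column j (\<sigma> t y') - column j (\<sigma> s z) + column j (\<sigma> s z'))
          \<le> norm (\<sigma> t y - \<sigma> t y' - \<sigma> s z + \<sigma> s z')"
        by (simp add: norm_column_le)
      also have "\<dots> \<le> K * vnorm (y - y' - z + z') + K * vnorm (z - z') * (vnorm (y' - z') powr \<kappa> + \<bar>t - s\<bar> powr \<beta>)"
        by (rule cond_A_four_point[OF A that])
      also have "\<dots> \<le> K * (n * n * norm (y - y' - z + z'))
          + K * (n * norm (z - z')) * (n * (norm (y' - z') powr \<kappa> + \<bar>t - s\<bar> powr \<beta>))"
      proof (intro add_mono mult_left_mono mult_mono vn vnn)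
        have "vnorm (y' - z') powr \<kappa> \<le> (n * norm (y' - z')) powr \<kappa>"
          using vnorm_nonneg \<kappa> by (intro powr_mono2 vn) auto
        also have "\<dots> = n powr \<kappa> * norm (y' - z') powr \<kappa>"
          by (rule powr_mult)
        also have "\<dots> \<le> n * norm (y' - z') powr \<kappa>"
          using n \<kappa> powr_mono[of \<kappa> 1 n] by (intro mult_right_mono) auto
        finally have 1: "vnorm (y' - z') powr \<kappa> \<le> n * norm (y' - z') powr \<kappa>" .
        have "1 * \<bar>t - s\<bar> powr \<beta> \<le> n * \<bar>t - s\<bar> powr \<beta>"
          using n by (intro mult_right_mono) auto
        with 1 show "vnorm (y' - z') powr \<kappa> + \<bar>t - s\<bar> powr \<beta> \<le> n * (norm (y' - z') powr \<kappa> + \<bar>t - s\<bar> powr \<beta>)"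
          by (simp add: distrib_left)
      qed (use pos n in auto)
      finally show ?thesis
        by (simp add: K'_def mult_ac)
    qed
    show "norm (b t y - b t z) \<le> L * n * norm (y - z)" if "t \<in> {0..T}" for t y z
    proof -
      have "norm (b t y - b t z) \<le> L * vnorm (y - z)"
        by (rule b_vlip[OF that])
      also have "\<dots> \<le> L * (n * norm (y - z))"
        using pos by (intro mult_left_mono vn) auto
      finally show ?thesis
        by (simp add: mult.assoc)
    qed
  qed (use pos n b_time B_holder x_holder expansion in auto)
  then obtain C where C: "0 \<le> C" and C_bound: "?Q C"
    by blast
  define C' where "C' = n * C * (T powr \<theta> + T powr (\<theta> - \<alpha>) / (\<theta> - \<alpha>))"
  have "euler_error \<alpha> T N x Y \<le> ennreal (C' * (T / real N) powr (2 * \<theta> - 1))"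
    if N: "0 < N" and Y: "euler_approximation T N b \<sigma> B x\<^sub>0 Y" for N Y
  proof -
    have Y0: "Y 0 = x 0"
      using Y x0 by (simp add: euler_approximation_def)
    have step: "\<forall>n<N. \<forall>t\<in>{grid T N n..grid T N (Suc n)}. Y t = Y (grid T N n)
        + (t - grid T N n) *\<^sub>R b (grid T N n) (Y (grid T N n))
        + (\<Sum>j\<in>UNIV. (B j t - B j (grid T N n)) *\<^sub>R column j (\<sigma> (grid T N n) (Y (grid T N n))))"
    proof (intro allI impI ballI)
      fix n t assume "n < N" "t \<in> {grid T N n..grid T N (Suc n)}"
      then have "Y t $ i = Y (grid T N n) $ i
          + b (grid T N n) (Y (grid T N n)) $ i * (t - grid T N n)
          + (\<Sum>j\<in>UNIV. \<sigma> (grid T N n) (Y (grid T N n)) $ i $ j * (B j t - B j (grid T N n)))" for i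
        using Y unfolding euler_approximation_def by blast
      then show "Y t = Y (grid T N n)
        + (t - grid T N n) *\<^sub>R b (grid T N n) (Y (grid T N n))
        + (\<Sum>j\<in>UNIV. (B j t - B j (grid T N n)) *\<^sub>R column j (\<sigma> (grid T N n) (Y (grid T N n))))"
        by (simp add: vec_eq_iff column_def mult.commute)
    qed
    have "norm ((x t - Y t) - (x s - Y s)) \<le> (C * (T / real N) powr (2 * \<theta> - 1)) * \<bar>t - s\<bar> powr \<theta>"
      if "s \<in> {0..T}" "t \<in> {0..T}" for s t
      using C_bound[rule_format, OF N Y0 step[rule_format] that] .
    then have "euler_error \<alpha> T N x Y \<le> ennreal (real CARD('d) * (C * (T / real N) powr (2 * \<theta> - 1))
        * (T powr \<theta> + T powr (\<theta> - \<alpha>) / (\<theta> - \<alpha>)))"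
      using T \<alpha> C Y0 half by (intro euler_error_le) auto
    then show ?thesis
      by (simp add: C'_def n_def mult_ac)
  qed
  then show ?thesis
    by blast
qed

theorem theorem2:
  fixes M :: "'w measure"
    and T H \<alpha> K \<beta> \<kappa> L C\<^sub>\<sigma> C\<^sub>b \<gamma> :: real
    and B :: "'m::finite \<Rightarrow> real \<Rightarrow> 'w \<Rightarrow> real"
    and X\<^sub>0 :: "'w \<Rightarrow> real ^ 'd::finite"
    and \<sigma> :: "'w \<Rightarrow> real \<Rightarrow> real ^ 'd \<Rightarrow> real ^ 'm ^ 'd"
    and b :: "'w \<Rightarrow> real \<Rightarrow> real ^ 'd \<Rightarrow> real ^ 'd"
    and X :: "real \<Rightarrow> 'w \<Rightarrow> real ^ 'd"
    and Y :: "nat \<Rightarrow> real \<Rightarrow> 'w \<Rightarrow> real ^ 'd"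
  assumes "prob_space M" and "complete_measure M"
    and "T > 0" and "1/2 < H" and "H < 1"
    and "\<And>j. fractional_brownian_motion M H {0..T} (B j)"
    and "X\<^sub>0 \<in> borel_measurable M"
    and "\<And>i j. coeff_measurable M T (\<lambda>w t x. \<sigma> w t x $ i $ j)"
    and "\<And>i. coeff_measurable M T (\<lambda>w t x. b w t x $ i)"
    and "K > 0" and "1 - H < \<beta>" and "\<beta> \<le> 1" and "1 / H - 1 < \<kappa>" and "\<kappa> \<le> 1"
    and "AE w in M. cond_A T K \<beta> \<kappa> (\<sigma> w)"
    and "L > 0" and "AE w in M. cond_B T L (b w)"
    and "C\<^sub>\<sigma> > 0" and "AE w in M. cond_C T C\<^sub>\<sigma> (\<sigma> w)"
    and "C\<^sub>b > 0" and "2 * H - 1 < \<gamma>" and "\<gamma> \<le> 1" and "AE w in M. cond_D1 T C\<^sub>b \<gamma> (b w)"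
    and "\<beta> > H"
    and "1 - H < \<alpha>" and "\<alpha> < H"
    and "sde_solution M T H \<alpha> b \<sigma> B X\<^sub>0 X"
    and "\<And>N w. N > 0 \<Longrightarrow> w \<in> space M \<Longrightarrow>
           euler_approximation T N (b w) (\<sigma> w) (\<lambda>j t. B j t w) (X\<^sub>0 w) (\<lambda>t. Y N t w)"
  shows
    "(\<exists>\<rho>\<^sub>0>0. \<forall>\<rho>. 0 < \<rho> \<and> \<rho> < \<rho>\<^sub>0 \<longrightarrow>
        (\<exists>C :: 'w \<Rightarrow> real. \<forall>\<epsilon>>0. \<exists>\<delta>\<^sub>0>0. \<exists>\<Omega>' \<in> sets M. measure M \<Omega>' > 1 - \<epsilon> \<and>
           (\<forall>w\<in>\<Omega>'. \<forall>N>0. T / real N < \<delta>\<^sub>0 \<longrightarrow>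
              euler_error \<alpha> T N (\<lambda>t. X t w) (\<lambda>t. Y N t w)
                \<le> ennreal (C w * (T / real N) powr (2 * H - 1 - \<rho>)))))
     \<and>
     ((\<exists>R. AE w in M. \<forall>t\<in>{0..T}. \<forall>x. vnorm (b w t x) \<le> R \<and> mnorm (\<sigma> w t x) \<le> R) \<longrightarrow>
      (\<forall>\<rho>. 0 < \<rho> \<and> \<rho> < 2 * H - 1 \<longrightarrow>
        (\<exists>C :: 'w \<Rightarrow> real. AE w in M. \<forall>N>0.
           euler_error \<alpha> T N (\<lambda>t. X t w) (\<lambda>t. Y N t w)
             \<le> ennreal (C w * (T / real N) powr (2 * H - 1 - \<rho>)))))"
proof -
  have rate: "\<exists>C :: 'w \<Rightarrow> real. AE w in M. \<forall>N>0.
      euler_error \<alpha> T N (\<lambda>t. X t w) (\<lambda>t. Y N t w) \<le> ennreal (C w * (T / real N) powr (2 * H - 1 - \<rho>))"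
    if \<rho>: "0 < \<rho>" for \<rho>
  proof -
    have "1 < 1 / H"
      using assms(4,5) by simp
    then have \<kappa>: "0 < \<kappa>"
      using assms(13) by linarith
    then have "1 / (1 + \<kappa>) < H"
      using assms(4,13) by (simp add: field_simps)
    then have gap: "max (max (H - \<rho> / 2) \<alpha>) (max (1 - \<alpha>) (1 / (1 + \<kappa>))) < H"
      using \<rho> assms by auto
    then obtain \<theta> where \<theta>: "H - \<rho> / 2 < \<theta>" "\<alpha> < \<theta>" "1 - \<alpha> < \<theta>" "1 / (1 + \<kappa>) < \<theta>" "\<theta> < H"
      using dense[OF gap] by auto
    have \<kappa>\<theta>: "1 < \<theta> + \<kappa> * \<theta>"
      using \<theta>(4) \<kappa> by (simp add: field_simps)
    have \<theta>0: "0 < \<theta>"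
      using \<theta> assms by linarith
    have B: "AE w in M. \<forall>j. \<exists>K\<ge>0. \<forall>s\<in>{0..T}. \<forall>t\<in>{0..T}. \<bar>B j t w - B j s w\<bar> \<le> K * \<bar>t - s\<bar> powr \<theta>"
      using fbm_holder[OF assms(1,6,3) \<theta>0 \<theta>(5)] by (simp add: AE_all_countable)
    have sol: "AE w in M. (\<forall>\<rho>. 0 < \<rho> \<and> \<rho> < H \<longrightarrow> holder_on (H - \<rho>) {0..T} (\<lambda>t. X t w)) \<and>
        (\<forall>t\<in>{0..T}. \<forall>i.
           (\<forall>j. pathwise_integrable \<alpha> 0 t (\<lambda>s. \<sigma> w s (X s w) $ i $ j) (\<lambda>s. B j s w)) \<and>
           set_integrable lborel {0..t} (\<lambda>s. b w s (X s w) $ i) \<and>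
           X t w $ i = X\<^sub>0 w $ i
             + (\<Sum>j\<in>UNIV. pathwise_integral \<alpha> 0 t (\<lambda>s. \<sigma> w s (X s w) $ i $ j) (\<lambda>s. B j s w))
             + (LBINT s:{0..t}. b w s (X s w) $ i))"
      using assms(27) unfolding sde_solution_def by blast
    define P where "P = (\<lambda>w C. \<forall>N>0. euler_error \<alpha> T N (\<lambda>t. X t w) (\<lambda>t. Y N t w)
        \<le> ennreal (C * (T / real N) powr (2 * H - 1 - \<rho>)))"
    have "AE w in M. \<exists>C. P w C"
      using B sol assms(15,17,23) AE_space
    proof eventually_elim
      case (elim w)
      have holder: "holder_on \<theta> {0..T} (\<lambda>t. X t w)"
        using conjunct1[OF elim(2), rule_format, of "H - \<theta>"] \<theta> \<theta>0 by simp
      have "\<exists>C. \<forall>N>0. \<forall>Y. euler_approximation T N (b w) (\<sigma> w) (\<lambda>j t. B j t w) (X\<^sub>0 w) Y \<longrightarrow>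
          euler_error \<alpha> T N (\<lambda>t. X t w) Y \<le> ennreal (C * (T / real N) powr (2 * \<theta> - 1))"
      proof (rule euler_rate_pathwise)
        show "0 < \<alpha>" "\<alpha> < 1" "\<theta> < 1" "\<theta> \<le> \<beta>" "2 * \<theta> - 1 \<le> \<gamma>"
          using assms(4,5,21,24-26) \<theta> by linarith+
        show "\<exists>G\<ge>0. \<forall>s\<in>{0..T}. \<forall>t\<in>{0..T}. \<bar>B j t w - B j s w\<bar> \<le> G * \<bar>t - s\<bar> powr \<theta>" for j
          using elim(1) by blast
        show "set_integrable lborel {0..t} (\<lambda>s. b w s (X s w) $ i)"
          and "X t w $ i = X\<^sub>0 w $ i
            + (\<Sum>j\<in>UNIV. pathwise_integral \<alpha> 0 t (\<lambda>s. \<sigma> w s (X s w) $ i $ j) (\<lambda>s. B j s w))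
            + (LBINT s:{0..t}. b w s (X s w) $ i)" if "t \<in> {0..T}" for t i
          using conjunct2[OF elim(2)] that by blast+
      qed (fact assms \<theta> \<kappa> \<kappa>\<theta> elim holder)+
      then obtain C where C: "\<And>N Y. 0 < N \<Longrightarrow> euler_approximation T N (b w) (\<sigma> w) (\<lambda>j t. B j t w) (X\<^sub>0 w) Y \<Longrightarrow>
          euler_error \<alpha> T N (\<lambda>t. X t w) Y \<le> ennreal (C * (T / real N) powr (2 * \<theta> - 1))"
        by blast
      define C' where "C' = max 0 C * T powr (2 * \<theta> - 1 - (2 * H - 1 - \<rho>))"
      have "euler_error \<alpha> T N (\<lambda>t. X t w) (\<lambda>t. Y N t w) \<le> ennreal (C' * (T / real N) powr (2 * H - 1 - \<rho>))"
        if N: "0 < N" for N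
      proof -
        have "euler_error \<alpha> T N (\<lambda>t. X t w) (\<lambda>t. Y N t w) \<le> ennreal (C * (T / real N) powr (2 * \<theta> - 1))"
          using elim(6) N by (intro C assms(28))
        also have "\<dots> \<le> ennreal (max 0 C * (T / real N) powr (2 * \<theta> - 1))"
          by (intro ennreal_leI mult_right_mono) auto
        also have "\<dots> \<le> ennreal (max 0 C * (T powr (2 * \<theta> - 1 - (2 * H - 1 - \<rho>)) * (T / real N) powr (2 * H - 1 - \<rho>)))"
          using N assms(3) \<theta> by (intro ennreal_leI mult_left_mono powr_le_powr_bound) (auto simp: field_simps)
        finally show ?thesis
          by (simp add: C'_def mult.assoc)
      qed
      then show ?case
        unfolding P_def by blast
    qed
    then have "AE w in M. P w (SOME C. P w C)"
      by eventually_elim (rule someI_ex)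
    then show ?thesis
      unfolding P_def by (rule exI[where x = "\<lambda>w. SOME C. P w C", unfolded P_def])
  qed
  have "\<exists>C :: 'w \<Rightarrow> real. \<forall>\<epsilon>>0. \<exists>\<delta>\<^sub>0>0. \<exists>\<Omega>' \<in> sets M. measure M \<Omega>' > 1 - \<epsilon> \<and>
      (\<forall>w\<in>\<Omega>'. \<forall>N>0. T / real N < \<delta>\<^sub>0 \<longrightarrow> euler_error \<alpha> T N (\<lambda>t. X t w) (\<lambda>t. Y N t w)
        \<le> ennreal (C w * (T / real N) powr (2 * H - 1 - \<rho>)))"
    if \<rho>: "0 < \<rho>" for \<rho>
  proof -
    interpret prob_space M by fact
    obtain C :: "'w \<Rightarrow> real" where "AE w in M. \<forall>N>0.
        euler_error \<alpha> T N (\<lambda>t. X t w) (\<lambda>t. Y N t w) \<le> ennreal (C w * (T / real N) powr (2 * H - 1 - \<rho>))"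
      using rate[OF \<rho>] by blast
    then obtain Z where Z: "Z \<in> null_sets M" "{w \<in> space M. \<not> (\<forall>N>0.
        euler_error \<alpha> T N (\<lambda>t. X t w) (\<lambda>t. Y N t w) \<le> ennreal (C w * (T / real N) powr (2 * H - 1 - \<rho>)))} \<subseteq> Z"
      unfolding eventually_ae_filter by blast
    have "prob (space M - Z) = 1"
      using Z(1) prob_compl[of Z] by (auto simp: null_sets_def measure_def)
    then show ?thesis
      using Z by (intro exI[of _ C] allI impI exI[of _ 1] conjI bexI[of _ "space M - Z"]) auto
  qed
  then show ?thesis
    using rate by (intro conjI impI allI exI[of _ "1::real"]) auto
qed

end
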